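(* Let $(\Omega_t)$ be an L-admissible family and $p\in\partial_\infty\Omega_0$. Suppose that the following conditions hold: (i) there exists a $C^{3,+0}$-smooth closed Jordan curve $C$ in the Riemann sphere $\overline{\mathbb{C}}$ such that $p\in C$ and one of the two connected components of $\overline{\mathbb{C}}\setminus C$ is contained in $\Omega_0$; (ii) for each $t>0$ there exists a $C^{3,+0}$-smooth closed Jordan curve $C_t$ in the Riemann sphere such that (ii.1) $p\in C_t$, (ii.2) the curves $C$ and $C_t$ have second order contact at the point $p$, and (ii.3) $\Omega_t\cap C_t=\emptyset$. Then there exists a family $(F_t)_{t\ge0}$ of univalent functions in the unit disk $\mathbb{D}$ such that $F_t(\mathbb{D})=\Omega_t$ and $F_t^{-1}\circ F_0\in\tilde{\mathcal{C}}$ for all $t\ge0$.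
   Context: $\mathbb{D}=\{z:|z|<1\}$, $\mathbb{T}=\partial\mathbb{D}$, $\mathbb{H}=\{z:\mathrm{Im}\,z>0\}$; $\angle\lim$ denotes angular (non-tangential) limit; $\partial_\infty E$ is the boundary of $E$ in the Riemann sphere $\overline{\mathbb{C}}$; $H(\zeta):=i\frac{1+\zeta}{1-\zeta}$ maps $\mathbb{D}$ onto $\mathbb{H}$. $r(D,z)$ is the conformal radius of a simply connected domain $D\subsetneq\mathbb{C}$ with respect to $z\in D$: $r(D,z)=|f'(0)|$ for $f$ a conformal map of $\mathbb{D}$ onto $D$ with $f(0)=z$. An L-admissible family (of order $d\in[1,+\infty]$; if unspecified, of some order) is a family $(\Omega_t)_{t\ge0}$ of simply connected domains $\Omega_t\subset\mathbb{C}$ such that (AF1) $\Omega_s\subset\Omega_t\ne\mathbb{C}$ whenever $t\ge s\ge0$; (AF2) there is $w_*\in\Omega_0$ such that $t\mapsto r(\Omega_t,w_* )$ is locally absolutely continuous on $[0,+\infty)$ with derivative in $L^d_{loc}$. A closed Jordan curve $C\subset\mathbb{C}$ is $C^{n,+0}$-smooth ($n\in\mathbb{N}$) if there is a bijective map $h$ of $\mathbb{T}$ onto $C$ such that $h_1:\mathbb{R}\ni\theta\mapsto h(e^{i\theta})\in C$ has derivatives up to order $n$, $h_1'$ does not vanish, and $h_1^{(n)}$ is Hölder continuous with some exponent $\alpha>0$. A closed Jordan curve $C\subset\overline{\mathbb{C}}$ is $C^{n,+0}$-smooth if for some (equivalently, every) Möbius transformation $T$ sending $C$ into $\mathbb{C}$,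 $T(C)$ is $C^{n,+0}$-smooth. Two $C^1$-smooth Jordan curves $C_1,C_2\subset\mathbb{C}$ with a common point $p$ have contact of order $n\in\mathbb{N}$ at $p$ if there exist $C^1$-smooth parameterizations $w_1,w_2:[-1,1]\to\mathbb{C}$ of $C_1$ and $C_2$ respectively such that $w_1(0)=w_2(0)=p$, $w_1'(0),w_2'(0)\ne0$ and $|w_1(t)-w_2(t)|=o(t^n)$ as $t\to0$. By means of Möbius transformations this is extended to Jordan curves in $\overline{\mathbb{C}}$ and to $p=\infty$. Second order contact is contact of order $2$. $\mathcal{C}$ is the class of all univalent holomorphic $\varphi:\mathbb{D}\to\mathbb{D}$ with $\angle\lim_{z\to1}\varphi(z)=1$ and $\varphi'(1):=\angle\lim_{z\to1}\frac{\varphi(z)-1}{z-1}<\infty$. $\tilde{\mathcal{C}}$ is the class of all $\varphi\in\mathcal{C}$ such that $\varphi^{(j)}(1)\neq\infty$ exists in the angular sense (finite angular limit of $\varphi^{(j)}$ at $1$) for $j=1,2,3$ and $\mathrm{Re}\,\varphi''(1)=\varphi'(1)(\varphi'(1)-1)$; the last condition means exactly that the coefficient $b$ in the expansion $(H\circ\varphi\circ H^{-1})(z)=az+b+\frac cz+\gamma(z)$, $\angle\lim_{z\to\infty}z\gamma(z)=0$, is real. *)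

theory Defs
  imports "HOL-Complex_Analysis.Complex_Analysis" "HOL-Library.Landau_Symbols"
begin

section \<open>The Riemann sphere\<close>

text \<open>The point \<^term>\<open>None\<close> is the point at infinity and \<^term>\<open>Some z\<close> the finite point \<^term>\<open>z\<close>.\<close>

type_synonym ecomplex = "complex option"

abbreviation Riemann_sphere :: "ecomplex topology" where
  "Riemann_sphere \<equiv> Alexandroff_compactification euclidean"

definition moebius_ext :: "complex \<Rightarrow> complex \<Rightarrow> complex \<Rightarrow> complex \<Rightarrow> ecomplex \<Rightarrow> ecomplex" where
  "moebius_ext a b c d x =
     (case x of
        None \<Rightarrow> (if c = 0 then None else Some (a / c))
      | Some z \<Rightarrow> (if c * z + d = 0 then None else Some (moebius a b c d z)))"

definition moebius_transformation :: "(ecomplex \<Rightarrow> ecomplex) \<Rightarrow> bool" where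
  "moebius_transformation T \<longleftrightarrow>
     (\<exists>a b c d. a * d - b * c \<noteq> 0 \<and> T = moebius_ext a b c d)"


section \<open>Smooth Jordan curves and contact\<close>

definition closed_Jordan_curve :: "ecomplex set \<Rightarrow> bool" where
  "closed_Jordan_curve C \<longleftrightarrow>
     subtopology Riemann_sphere C homeomorphic_space top_of_set (sphere (0::complex) 1)"

text \<open>
  \<open>C\<^sup>n\<^sup>,\<^sup>+\<^sup>0\<close>-smoothness, for \<open>n \<ge> 1\<close>; \<open>D k\<close> is the \<open>k\<close>-th derivative of
  \<open>\<theta> \<mapsto> h (e\<^sup>i\<^sup>\<theta>)\<close>, which is \<open>2\<pi>\<close>-periodic, so that the global Hoelder condition is no
  stronger than the local one.
\<close>

definition smooth_plane_curve :: "nat \<Rightarrow> complex set \<Rightarrow> bool" where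
  "smooth_plane_curve n C \<longleftrightarrow>
     C homeomorphic sphere (0::complex) 1 \<and>
     (\<exists>(h :: complex \<Rightarrow> complex) (D :: nat \<Rightarrow> real \<Rightarrow> complex).
        bij_betw h (sphere 0 1) C \<and>
        D 0 = (\<lambda>\<theta>. h (cis \<theta>)) \<and>
        (\<forall>k<n. \<forall>\<theta>. (D k has_vector_derivative D (Suc k) \<theta>) (at \<theta>)) \<and>
        (\<forall>\<theta>. D 1 \<theta> \<noteq> 0) \<and>
        (\<exists>\<alpha>>0. \<exists>M. \<forall>x y. norm (D n x - D n y) \<le> M * \<bar>x - y\<bar> powr \<alpha>))"

definition smooth_curve :: "nat \<Rightarrow> ecomplex set \<Rightarrow> bool" where
  "smooth_curve n C \<longleftrightarrow>
     closed_Jordan_curve C \<and>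
     (\<exists>T C'. moebius_transformation T \<and> T ` C = Some ` C' \<and> smooth_plane_curve n C')"

text \<open>
  Requiring two-sided derivatives at the end points, as \<^const>\<open>C1_differentiable_on\<close> does, is
  harmless: a \<open>C\<^sup>1\<close> map on \<open>[-1,1]\<close> has a \<open>C\<^sup>1\<close> extension, and the values of \<open>w\<close> outside
  \<open>[-1,1]\<close> do not matter otherwise.
\<close>

definition C1_parameterization :: "(real \<Rightarrow> complex) \<Rightarrow> complex set \<Rightarrow> bool" where
  "C1_parameterization w C \<longleftrightarrow>
     w C1_differentiable_on {-1..1} \<and> w (-1) = w 1 \<and> inj_on w {-1..<1} \<and> w ` {-1..1} = C"

definition plane_contact :: "nat \<Rightarrow> complex set \<Rightarrow> complex set \<Rightarrow> complex \<Rightarrow> bool" where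
  "plane_contact n C\<^sub>1 C\<^sub>2 p \<longleftrightarrow>
     (\<exists>w\<^sub>1 w\<^sub>2. C1_parameterization w\<^sub>1 C\<^sub>1 \<and> C1_parameterization w\<^sub>2 C\<^sub>2 \<and>
        w\<^sub>1 0 = p \<and> w\<^sub>2 0 = p \<and>
        vector_derivative w\<^sub>1 (at 0) \<noteq> 0 \<and> vector_derivative w\<^sub>2 (at 0) \<noteq> 0 \<and>
        (\<lambda>t. norm (w\<^sub>1 t - w\<^sub>2 t)) \<in> o[at 0](\<lambda>t. t ^ n))"

definition contact :: "nat \<Rightarrow> ecomplex set \<Rightarrow> ecomplex set \<Rightarrow> ecomplex \<Rightarrow> bool" where
  "contact n C\<^sub>1 C\<^sub>2 p \<longleftrightarrow>
     (\<exists>T C\<^sub>1' C\<^sub>2' p'. moebius_transformation T \<and>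
        T ` C\<^sub>1 = Some ` C\<^sub>1' \<and> T ` C\<^sub>2 = Some ` C\<^sub>2' \<and> T p = Some p' \<and>
        plane_contact n C\<^sub>1' C\<^sub>2' p')"


section \<open>L-admissible families\<close>

definition univalent_on :: "(complex \<Rightarrow> complex) \<Rightarrow> complex set \<Rightarrow> bool" where
  "univalent_on f S \<longleftrightarrow> f holomorphic_on S \<and> inj_on f S"

definition conformal_radius :: "complex set \<Rightarrow> complex \<Rightarrow> real" where
  "conformal_radius D z =
     (THE r. \<exists>f. univalent_on f (ball 0 1) \<and> f ` ball 0 1 = D \<and> f 0 = z \<and> r = norm (deriv f 0))"

definition absolutely_continuous_on :: "real \<Rightarrow> real \<Rightarrow> (real \<Rightarrow> real) \<Rightarrow> bool" where
  "absolutely_continuous_on a b f \<longleftrightarrow>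
     (\<forall>\<epsilon>>0. \<exists>\<delta>>0. \<forall>\<D> S. \<D> division_of S \<and> S \<subseteq> {a..b} \<and> (\<Sum>K\<in>\<D>. Sup K - Inf K) < \<delta> \<longrightarrow>
        (\<Sum>K\<in>\<D>. \<bar>f (Sup K) - f (Inf K)\<bar>) < \<epsilon>)"

definition L_loc :: "ennreal \<Rightarrow> (real \<Rightarrow> real) \<Rightarrow> bool" where
  "L_loc d g \<longleftrightarrow>
     (\<forall>b>0. g \<in> borel_measurable (lebesgue_on {0..b}) \<and>
        (if d = \<infinity> then \<exists>M. AE t in lebesgue_on {0..b}. \<bar>g t\<bar> \<le> M
         else integrable (lebesgue_on {0..b}) (\<lambda>t. \<bar>g t\<bar> powr enn2real d)))"

definition simply_connected_domain :: "complex set \<Rightarrow> bool" where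
  "simply_connected_domain D \<longleftrightarrow> open D \<and> D \<noteq> {} \<and> simply_connected D"

text \<open>The values of \<open>\<Omega>\<close> at negative times are irrelevant.\<close>

definition L_admissible :: "ennreal \<Rightarrow> (real \<Rightarrow> complex set) \<Rightarrow> bool" where
  "L_admissible d \<Omega> \<longleftrightarrow>
     1 \<le> d \<and>
     (\<forall>t\<ge>0. simply_connected_domain (\<Omega> t)) \<and>
     (\<forall>s\<ge>0. \<forall>t\<ge>s. \<Omega> s \<subseteq> \<Omega> t \<and> \<Omega> t \<noteq> UNIV) \<and>
     (\<exists>w\<in>\<Omega> 0. (\<forall>b>0. absolutely_continuous_on 0 b (\<lambda>t. conformal_radius (\<Omega> t) w)) \<and>
        (\<exists>g. L_loc d g \<and>
           (AE t in lebesgue. t > 0 \<longrightarrow>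
              ((\<lambda>t. conformal_radius (\<Omega> t) w) has_real_derivative g t) (at t))))"


section \<open>Angular limits and the classes of self-maps of the disk\<close>

text \<open>The limit is taken inside every Stolz angle with vertex \<open>1\<close>.\<close>

definition angular_lim_at_1 :: "(complex \<Rightarrow> complex) \<Rightarrow> complex \<Rightarrow> bool" where
  "angular_lim_at_1 f l \<longleftrightarrow>
     (\<forall>M>1. (f \<longlongrightarrow> l) (at 1 within {z \<in> ball 0 1. norm (1 - z) < M * (1 - norm z)}))"

text \<open>
  A finite angular derivative of a self-map of the disk at the boundary fixed point \<open>1\<close> is
  real, hence the real parameter \<open>a\<close>.
\<close>

definition has_angular_deriv_at_1 :: "(complex \<Rightarrow> complex) \<Rightarrow> real \<Rightarrow> bool" where
  "has_angular_deriv_at_1 \<phi> a \<longleftrightarrow> angular_lim_at_1 (\<lambda>z. (\<phi> z - 1) / (z - 1)) (complex_of_real a)"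

definition class_C :: "(complex \<Rightarrow> complex) set" where
  "class_C =
     {\<phi>. univalent_on \<phi> (ball 0 1) \<and> \<phi> ` ball 0 1 \<subseteq> ball 0 1 \<and>
         angular_lim_at_1 \<phi> 1 \<and> (\<exists>a. has_angular_deriv_at_1 \<phi> a)}"

definition class_C_tilde :: "(complex \<Rightarrow> complex) set" where
  "class_C_tilde =
     {\<phi> \<in> class_C. \<exists>a c.
         has_angular_deriv_at_1 \<phi> a \<and>
         (\<forall>j\<in>{1,2,3}. angular_lim_at_1 ((deriv ^^ j) \<phi>) (c j)) \<and>
         Re (c 2) = a * (a - 1)}"

end

theory Submission
  imports Defs
begin

text \<open>
  Transport everything to the upper half-plane, the boundary point \<open>1\<close> of the disk going to \<open>\<infinity>\<close>.
  Suppose that there are holomorphic maps \<open>f\<close> of the half-plane into \<open>\<Omega> 0\<close> and \<open>G t\<close> of \<open>\<Omega> t\<close> into the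
  half-plane with \<open>G t (f (\<i>y)) = \<i>y + O(1/y)\<close>. With Riemann maps \<open>S t\<close> of the half-plane onto \<open>\<Omega> t\<close>,
  this composition splits into three self-maps of the half-plane,
  \<open>(G t \<circ> S t) \<circ> (S t\<^sup>-\<^sup>1 \<circ> S 0) \<circ> (S 0\<^sup>-\<^sup>1 \<circ> f)\<close>. By Julia's lemma every self-map \<open>g\<close> satisfies
  \<open>Im (g z) \<ge> \<alpha> Im z\<close>, where \<open>\<alpha>\<close> is its angular derivative at \<open>\<infinity>\<close>, and angular derivatives multiply.
  Hence the nonnegative excesses \<open>Im (g z) - \<alpha> Im z\<close> of the three factors add up, with positive
  weights, to at most \<open>O(1/y)\<close>, so that the excess of the middle factor is \<open>O(1/y)\<close> by itself. Julia's lemma,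
  applied once more to \<open>g z - \<alpha> z\<close> at its now finite boundary value at \<open>\<infinity>\<close>, turns this into the expansion
  \<open>\<alpha> z + b + c / z + o(1 / z)\<close> with \<open>b\<close> real, which is membership in the class
  (\<open>middle_factor_expansion\<close>, \<open>class_C_tilde_if_half_plane_expansion\<close>,
  \<open>conjugates_in_class_C_tilde\<close>).

  The maps \<open>f\<close> and \<open>G t\<close> are given by formulas. In a Moebius chart that osculates \<open>C\<close> to second order at
  \<open>p\<close>, third order smoothness with a Hoelder exponent puts \<open>C\<close> near \<open>0\<close> into a set
  \<open>\<bar>Im w - c Re w \<bar>w\<bar>\<^sup>2\<bar> \<le> K \<bar>Re w\<bar>\<^sup>s\<close> with \<open>s > 3\<close>; contact of second order says that the \<open>2\<close>-jets of
  the curves \<open>C\<^sub>t\<close> are real in this chart, so these curves obey bounds of the same form with other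
  constants. In the coordinate \<open>z = -1 / w\<close> the bound becomes
  \<open>\<bar>Im z + c Re (1 / z)\<bar> \<le> K \<bar>z\<bar>\<^sup>-\<^sup>\<beta>\<close> with \<open>\<beta> = s - 2 > 1\<close>. The map \<open>z \<mapsto> z \<plusminus> \<i> c / z\<close> accounts for the
  term with \<open>c\<close>, and since \<open>\<beta> > 1\<close> there is a holomorphic function of size \<open>O(1 / z)\<close> whose imaginary part
  is at least a multiple of \<open>\<bar>z\<bar>\<^sup>-\<^sup>\<beta>\<close> in the half-plane outside the unit disk (\<open>power_kernel\<close>). A pole below the half-plane takes care of
  the bounded part. This gives a map into the region above the curve \<open>C\<close> and a map of the region above
  \<open>C\<^sub>t\<close> into the half-plane, both \<open>z + O(1 / z)\<close> (\<open>inner_model_map\<close>, \<open>outer_model_map\<close>).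

  It remains to know on which side of the curves the domains lie. Near \<open>p\<close> both curves are graphs over
  the real axis, and every component of the complement of a Jordan curve has the whole curve as its
  frontier. So the component inside \<open>\<Omega> 0\<close> contains one side of \<open>C\<close> near \<open>p\<close>, the two sides of \<open>C\<^sub>t\<close> belong to
  different components, and \<open>\<Omega> t\<close>, being connected and touching one side, misses the other
  (\<open>component_contains_side_in_chart\<close>, \<open>domain_on_one_side\<close>).
\<close>

section \<open>Self-maps of the upper half-plane near infinity\<close>

lemma holomorphic_on_compose_into:
  "f holomorphic_on A \<Longrightarrow> g holomorphic_on B \<Longrightarrow> (\<And>z. z \<in> A \<Longrightarrow> f z \<in> B) \<Longrightarrow> (\<lambda>z. g (f z)) holomorphic_on A"
  using holomorphic_on_compose_gen[of f A g B] by (auto simp: o_def)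

abbreviation upper_half_plane :: "complex set" where
  "upper_half_plane \<equiv> {z. 0 < Im z}"

text \<open>
  A limit at \<open>\<infinity>\<close> is angular if it exists along these filters for all \<^term>\<open>M\<close>.
\<close>

definition stolz_at_infinity :: "real \<Rightarrow> complex filter" where
  "stolz_at_infinity M = inf at_infinity (principal {z. 0 < Im z \<and> norm z \<le> M * Im z})"

lemma eventually_stolz_at_infinity:
  "eventually P (stolz_at_infinity M) \<longleftrightarrow>
     (\<exists>R. \<forall>z. R \<le> norm z \<and> 0 < Im z \<and> norm z \<le> M * Im z \<longrightarrow> P z)"
  unfolding stolz_at_infinity_def eventually_inf_principal eventually_at_infinity by auto

text \<open>
  This identity converts the Schwarz--Pick inequality between pseudo-hyperbolic distances into an
  inequality between imaginary parts.
\<close>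

lemma norm_diff_cnj_sq:
  "(norm (a - cnj b))\<^sup>2 = (norm (a - b))\<^sup>2 + 4 * Im a * Im b"
  unfolding cmod_power2 by (simp add: algebra_simps power2_eq_square)

text \<open>
  Schwarz's lemma for \<^term>\<open>p\<close> conjugated by the Moebius maps onto the disk that send \<^term>\<open>z0\<close> and
  \<^term>\<open>p z0\<close> to \<open>0\<close>. Written without denominators, the inequality survives the passage of \<^term>\<open>z0\<close> to the
  boundary, and all versions of Julia's lemma below are such limits.
\<close>

lemma Schwarz_Pick_strict:
  fixes p :: "complex \<Rightarrow> complex"
  assumes hol: "p holomorphic_on upper_half_plane"
    and maps: "\<And>z. 0 < Im z \<Longrightarrow> 0 < Im (p z)"
    and z: "0 < Im z" and z0: "0 < Im z0"
  shows "(norm (p z - cnj (p z0)))\<^sup>2 * (Im z * Im z0) \<le> Im (p z) * Im (p z0) * (norm (z - cnj z0))\<^sup>2"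
proof -
  \<comment> \<open>the inverse of \<open>z \<mapsto> (z - z0) / (z - cnj z0)\<close>\<close>
  define v where "v = (\<lambda>w. (z0 - cnj z0 * w) / (1 - w))"
  have Im_v: "0 < Im (v w)" if "norm w < 1" for w
  proof -
    have n1: "1 - w \<noteq> 0" using that by auto
    have "v w = ((z0 - cnj z0 * w) * cnj (1 - w)) / of_real ((norm (1 - w))\<^sup>2)"
      unfolding v_def complex_norm_square using n1
      by (subst mult_divide_mult_cancel_right) (simp_all del: complex_cnj_diff)
    moreover have "Im ((z0 - cnj z0 * w) * cnj (1 - w)) = Im z0 * (1 - (norm w)\<^sup>2)"
      unfolding cmod_power2 by (simp add: algebra_simps power2_eq_square)
    ultimately have "Im (v w) = Im z0 * (1 - (norm w)\<^sup>2) / (norm (1 - w))\<^sup>2"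
      by (metis Im_divide_of_real)
    moreover have "(norm w)\<^sup>2 < 1" using that by (simp add: abs_square_less_1)
    ultimately show ?thesis using n1 z0 by simp
  qed
  define g where "g = (\<lambda>w. (p (v w) - p z0) / (p (v w) - cnj (p z0)))"
  have nz: "a - cnj b \<noteq> 0" if "0 < Im a" "0 < Im b" for a b
    using that by (auto simp: complex_eq_iff)
  have "g holomorphic_on ball 0 1"
  proof -
    have "v holomorphic_on ball 0 1" unfolding v_def by (intro holomorphic_intros) auto
    then have "(p \<circ> v) holomorphic_on ball 0 1"
      using hol by (rule holomorphic_on_compose_gen) (use Im_v in auto)
    then have h: "(\<lambda>w. p (v w)) holomorphic_on ball 0 1" by (simp add: o_def)
    show ?thesis unfolding g_def
      by (intro holomorphic_intros h) (use nz maps Im_v z0 in auto)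
  qed
  moreover have "g 0 = 0" by (simp add: g_def v_def)
  moreover have "norm (g w) < 1" if "norm w < 1" for w
  proof -
    have "(norm (p (v w) - p z0))\<^sup>2 < (norm (p (v w) - cnj (p z0)))\<^sup>2"
      unfolding norm_diff_cnj_sq using maps Im_v[OF that] z0 by simp
    then have "norm (p (v w) - p z0) < norm (p (v w) - cnj (p z0))"
      by (rule power_less_imp_less_base) simp
    then show ?thesis unfolding g_def norm_divide using nz maps Im_v[OF that] z0
      by (subst divide_less_eq_1_pos) auto
  qed
  moreover
  define w where "w = (z - z0) / (z - cnj z0)"
  have D: "norm (z - cnj z0) > 0" using nz z z0 by simp
  have "norm w < 1"
  proof -
    have "(norm (z - z0))\<^sup>2 < (norm (z - cnj z0))\<^sup>2"
      unfolding norm_diff_cnj_sq using z z0 by simp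
    then have "norm (z - z0) < norm (z - cnj z0)"
      by (rule power_less_imp_less_base) simp
    then show ?thesis unfolding w_def norm_divide using D by simp
  qed
  ultimately have le: "norm (g w) \<le> norm w" by (rule Schwarz_Lemma(1))
  have "1 - w = (z0 - cnj z0) / (z - cnj z0)" "z0 - cnj z0 * w = z * (z0 - cnj z0) / (z - cnj z0)"
    unfolding w_def using nz[OF z z0] by (simp_all add: field_simps)
  then have vw: "v w = z" unfolding v_def using nz[OF z z0] nz[OF z0 z0] by simp
  have P: "norm (p z - cnj (p z0)) > 0" using nz maps z z0 by simp
  have "norm (p z - p z0) * norm (z - cnj z0) \<le> norm (z - z0) * norm (p z - cnj (p z0))"
    using le P D unfolding g_def vw unfolding w_def norm_divide
    by (simp add: field_simps)
  then have "(norm (p z - p z0))\<^sup>2 * (norm (z - cnj z0))\<^sup>2 \<le> (norm (z - z0))\<^sup>2 * (norm (p z - cnj (p z0)))\<^sup>2"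
    unfolding power_mult_distrib[symmetric] by (intro power_mono) auto
  then show ?thesis unfolding norm_diff_cnj_sq by (simp add: algebra_simps)
qed

text \<open>
  Translation of \<^term>\<open>p\<close> by \<open>\<i>\<delta>\<close> with \<open>\<delta> \<longrightarrow> 0\<close> extends the inequality to maps into the closed half-plane.
  In this form it applies to \<open>g z - \<alpha> z\<close>, which may be a real constant.
\<close>

lemma Schwarz_Pick:
  fixes p :: "complex \<Rightarrow> complex"
  assumes hol: "p holomorphic_on upper_half_plane"
    and maps: "\<And>z. 0 < Im z \<Longrightarrow> 0 \<le> Im (p z)"
    and z: "0 < Im z" and z0: "0 < Im z0"
  shows "(norm (p z - cnj (p z0)))\<^sup>2 * (Im z * Im z0) \<le> Im (p z) * Im (p z0) * (norm (z - cnj z0))\<^sup>2"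
proof -
  have *: "(norm (p z - cnj (p z0) + 2 * \<i> * of_real d))\<^sup>2 * (Im z * Im z0)
        \<le> (Im (p z) + d) * (Im (p z0) + d) * (norm (z - cnj z0))\<^sup>2" if "0 < d" for d
  proof -
    have "(norm ((p z + \<i> * of_real d) - cnj (p z0 + \<i> * of_real d)))\<^sup>2 * (Im z * Im z0)
        \<le> Im (p z + \<i> * of_real d) * Im (p z0 + \<i> * of_real d) * (norm (z - cnj z0))\<^sup>2"
      by (rule Schwarz_Pick_strict[where p="\<lambda>z. p z + \<i> * of_real d"])
         (use that maps z z0 in \<open>auto intro!: holomorphic_intros hol add_nonneg_pos\<close>)
    then show ?thesis by (simp add: algebra_simps)
  qed
  have l: "((\<lambda>d. (norm (p z - cnj (p z0) + 2 * \<i> * of_real d))\<^sup>2 * (Im z * Im z0)) \<longlongrightarrow>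
      (norm (p z - cnj (p z0) + 2 * \<i> * of_real 0))\<^sup>2 * (Im z * Im z0)) (at_right 0)"
    and r: "((\<lambda>d. (Im (p z) + d) * (Im (p z0) + d) * (norm (z - cnj z0))\<^sup>2) \<longlongrightarrow>
      (Im (p z) + 0) * (Im (p z0) + 0) * (norm (z - cnj z0))\<^sup>2) (at_right 0)"
    by (intro tendsto_intros)+
  have "\<forall>\<^sub>F d::real in at_right 0. d > 0" by (rule eventually_at_right_less)
  then have "\<forall>\<^sub>F d in at_right 0. (norm (p z - cnj (p z0) + 2 * \<i> * of_real d))\<^sup>2 * (Im z * Im z0)
        \<le> (Im (p z) + d) * (Im (p z0) + d) * (norm (z - cnj z0))\<^sup>2"
    by eventually_elim (rule *)
  from tendsto_le[OF _ r l this] show ?thesis by simp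
qed

text \<open>
  Here \<open>\<alpha>\<close> is the infimum of \<open>Im (g z) / Im z\<close>. After subtraction of \<open>\<alpha> z\<close> this infimum is \<open>0\<close>, and the
  Schwarz--Pick inequality against a point \<open>z0\<close> with \<open>Im (h z0) \<le> \<epsilon> Im z0\<close> bounds
  \<open>\<bar>h z - cnj (h z0)\<bar>\<^sup>2\<close> by a multiple of \<open>\<epsilon> \<bar>h z\<bar> \<bar>z\<bar>\<close> in a Stolz angle, so that \<open>h z / z \<longrightarrow> 0\<close>.
\<close>

lemma Julia_at_infinity:
  fixes g :: "complex \<Rightarrow> complex"
  assumes hol: "g holomorphic_on upper_half_plane"
    and maps: "\<And>z. 0 < Im z \<Longrightarrow> 0 \<le> Im (g z)"
  obtains \<alpha> :: real where "0 \<le> \<alpha>" "\<And>z. 0 < Im z \<Longrightarrow> \<alpha> * Im z \<le> Im (g z)"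
    "\<And>M. ((\<lambda>z. g z / z) \<longlongrightarrow> of_real \<alpha>) (stolz_at_infinity M)"
proof -
  define A where "A = (\<lambda>z. Im (g z) / Im z) ` upper_half_plane"
  define \<alpha> where "\<alpha> = Inf A"
  have A0: "0 \<le> x" if "x \<in> A" for x using that maps by (auto simp: A_def)
  have ne: "A \<noteq> {}" unfolding A_def using imaginary_unit.simps(2) by (auto intro!: exI[of _ \<i>])
  have bdd: "bdd_below A" using A0 by (rule bdd_belowI)
  have \<alpha>0: "0 \<le> \<alpha>" unfolding \<alpha>_def using ne A0 by (rule cInf_greatest)
  have \<alpha>le: "\<alpha> * Im z \<le> Im (g z)" if "0 < Im z" for z
  proof -
    have "\<alpha> \<le> Im (g z) / Im z" unfolding \<alpha>_def
      by (rule cInf_lower) (use that bdd in \<open>auto simp: A_def\<close>)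
    then show ?thesis using that by (simp add: field_simps)
  qed
  define h where "h = (\<lambda>z. g z - of_real \<alpha> * z)"
  have holh: "h holomorphic_on upper_half_plane" unfolding h_def by (intro holomorphic_intros hol)
  have maph: "0 \<le> Im (h z)" if "0 < Im z" for z using \<alpha>le[OF that] by (simp add: h_def)
  have lim: "((\<lambda>z. g z / z) \<longlongrightarrow> of_real \<alpha>) (stolz_at_infinity M)" for M
  proof (rule tendstoI)
    fix e :: real assume e: "0 < e"
    define N where "N = max M 1"
    define \<epsilon> where "\<epsilon> = e / (8 * N)"
    have N: "1 \<le> N" "M \<le> N" by (auto simp: N_def)
    have \<epsilon>: "0 < \<epsilon>" unfolding \<epsilon>_def using e N by simp
    have "\<exists>x\<in>A. x < \<alpha> + \<epsilon>" using cInf_lessD[OF ne, of "\<alpha> + \<epsilon>"] \<epsilon> by (auto simp: \<alpha>_def)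
    then obtain z0 where z0: "0 < Im z0" "Im (g z0) / Im z0 < \<alpha> + \<epsilon>" by (auto simp: A_def)
    have hz0: "Im (h z0) \<le> \<epsilon> * Im z0" using z0 by (simp add: h_def field_simps)
    define B where "B = norm (h z0)"
    define R where "R = norm z0 + 4 * B / e + 1"
    have B0: "0 \<le> B" by (simp add: B_def)
    have R: "norm z0 \<le> R" "4 * B / e < R" "0 < R" using B0 e
      unfolding R_def by (auto intro: add_nonneg_pos simp: add_strict_increasing)
    have "dist (g z / z) (of_real \<alpha>) < e" if z: "R \<le> norm z" "0 < Im z" "norm z \<le> M * Im z" for z
    proof -
      define a where "a = norm (h z)"
      have zp: "0 < norm z" using z R by linarith
      have zN: "norm z \<le> N * Im z" using z(3) N(2) z(2) by (meson mult_right_mono less_imp_le order_trans)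
      have "norm (z - cnj z0) \<le> norm z + norm (cnj z0)" by (rule norm_triangle_ineq4)
      then have "norm (z - cnj z0) \<le> 2 * norm z" using z(1) R(1) by simp
      then have q: "(norm (z - cnj z0))\<^sup>2 \<le> (2 * norm z)\<^sup>2" by (intro power_mono) auto
      have "(norm (h z - cnj (h z0)))\<^sup>2 * (Im z * Im z0) \<le> Im (h z) * Im (h z0) * (norm (z - cnj z0))\<^sup>2"
        by (rule Schwarz_Pick[OF holh maph z(2) z0(1)])
      also have "\<dots> \<le> a * (\<epsilon> * Im z0) * (2 * norm z)\<^sup>2"
      proof -
        have "Im (h z) \<le> a" using abs_Im_le_cmod[of "h z"] by (simp add: a_def)
        then show ?thesis
          using hz0 maph[OF z(2)] maph[OF z0(1)] q by (intro mult_mono) auto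
      qed
      finally have "(norm (h z - cnj (h z0)))\<^sup>2 * Im z \<le> a * \<epsilon> * (2 * norm z)\<^sup>2"
        using z0(1) by (simp add: mult.assoc mult.left_commute[of _ "Im z0"])
      moreover have "a * \<epsilon> * (2 * norm z)\<^sup>2 \<le> (4 * a * \<epsilon> * N * norm z) * Im z"
      proof -
        have "a * \<epsilon> * (2 * norm z)\<^sup>2 = 4 * a * \<epsilon> * norm z * norm z" by (simp add: power2_eq_square)
        also have "\<dots> \<le> 4 * a * \<epsilon> * norm z * (N * Im z)"
          using zN \<epsilon> by (intro mult_left_mono) (auto simp: a_def)
        finally show ?thesis by (simp add: algebra_simps)
      qed
      ultimately have "(norm (h z - cnj (h z0)))\<^sup>2 * Im z \<le> (4 * a * \<epsilon> * N * norm z) * Im z"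
        by linarith
      then have "(norm (h z - cnj (h z0)))\<^sup>2 \<le> 4 * a * \<epsilon> * N * norm z"
        using z(2) by simp
      moreover have "(a - B)\<^sup>2 \<le> (norm (h z - cnj (h z0)))\<^sup>2"
      proof -
        have "\<bar>a - B\<bar> \<le> norm (h z - cnj (h z0))"
          using norm_triangle_ineq3[of "h z" "cnj (h z0)"] by (simp add: a_def B_def)
        then show ?thesis by (metis abs_ge_zero power2_abs power_mono)
      qed
      ultimately have "(a - B)\<^sup>2 \<le> 4 * a * \<epsilon> * N * norm z" by linarith
      moreover have "(a - B)\<^sup>2 = a * a - 2 * a * B + B * B"
        by (simp add: power2_eq_square algebra_simps)
      moreover have "a * (2 * B + 4 * \<epsilon> * N * norm z) = 2 * a * B + 4 * a * \<epsilon> * N * norm z"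
        by (simp add: algebra_simps)
      ultimately have "a * a \<le> a * (2 * B + 4 * \<epsilon> * N * norm z)"
        using zero_le_square[of B] by linarith
      then have "a \<le> 2 * B + 4 * \<epsilon> * N * norm z"
        using B0 \<epsilon> N by (cases "a = 0") (auto simp: a_def mult_le_cancel_left)
      also have "4 * \<epsilon> * N = e / 2" unfolding \<epsilon>_def using N by simp
      also have "2 * B < e / 2 * norm z"
      proof -
        have "4 * B / e < norm z" using R(2) z(1) by linarith
        then show ?thesis using e by (simp add: field_simps)
      qed
      finally have "a < e * norm z" by simp
      moreover have "g z / z - of_real \<alpha> = h z / z" using zp by (auto simp: h_def field_simps)
      ultimately show ?thesis using zp by (simp add: dist_norm a_def norm_divide field_simps)
    qed
    then show "\<forall>\<^sub>F z in stolz_at_infinity M. dist (g z / z) (of_real \<alpha>) < e"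
      unfolding eventually_stolz_at_infinity by blast
  qed
  show thesis by (rule that[OF \<alpha>0 \<alpha>le lim])
qed


text \<open>
  In the Schwarz--Pick inequality against \<open>w n\<close> the quotient
  \<open>Im (p (w n)) / Im (w n)\<close> decays like \<open>1 / (Im (w n))\<^sup>2\<close>, which compensates the growth of \<open>\<bar>z - cnj (w n)\<bar>\<^sup>2\<close>
  because the sequence is nontangential. Hence the values \<open>p (w n)\<close> are bounded; they accumulate at a
  real number \<open>b\<close>, and the inequality holds in the limit.
\<close>

lemma finite_boundary_value_at_infinity:
  fixes p :: "complex \<Rightarrow> complex" and w :: "nat \<Rightarrow> complex"
  assumes hol: "p holomorphic_on upper_half_plane"
    and maps: "\<And>z. 0 < Im z \<Longrightarrow> 0 \<le> Im (p z)"
    and w: "\<And>n. 0 < Im (w n)" "\<And>n. norm (w n) \<le> M * Im (w n)"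
    and winf: "filterlim (\<lambda>n. Im (w n)) at_top sequentially"
    and bnd: "\<And>n. Im (p (w n)) * Im (w n) \<le> C"
  obtains b K :: real where "\<And>z. 0 < Im z \<Longrightarrow> (norm (p z - of_real b))\<^sup>2 * Im z \<le> K * Im (p z)"
proof -
  define \<rho> where "\<rho> = (\<lambda>n. inverse (Im (w n)))"
  have \<rho>0: "\<rho> \<longlonglongrightarrow> 0" unfolding \<rho>_def using winf by (rule tendsto_inverse_0_at_top)
  have C0: "0 \<le> C" using bnd[of 0] maps[OF w(1)[of 0]] w(1)[of 0]
    by (meson less_imp_le mult_nonneg_nonneg order_trans)
  have M0: "0 \<le> M" using w(1,2)[of 0] by (meson linorder_not_le mult_neg_pos norm_ge_zero order_less_le_trans)
  have key: "(norm (p z - cnj (p (w n))))\<^sup>2 * Im z \<le> Im (p z) * C * (norm z * \<rho> n + M)\<^sup>2"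
    if z: "0 < Im z" for z n
  proof -
    define y where "y = Im (w n)"
    have y: "0 < y" using w(1) by (simp add: y_def)
    have "(norm (p z - cnj (p (w n))))\<^sup>2 * (Im z * y) \<le> Im (p z) * Im (p (w n)) * (norm (z - cnj (w n)))\<^sup>2"
      unfolding y_def by (rule Schwarz_Pick[OF hol maps z w(1)])
    also have "\<dots> \<le> Im (p z) * (C / y) * (norm z + M * y)\<^sup>2"
    proof (intro mult_mono power_mono)
      show "Im (p (w n)) \<le> C / y" using bnd[of n] y by (simp add: y_def field_simps)
      have "norm (z - cnj (w n)) \<le> norm z + norm (w n)"
        using norm_triangle_ineq4[of z "cnj (w n)"] by simp
      then show "norm (z - cnj (w n)) \<le> norm z + M * y" using w(2)[of n] by (simp add: y_def)
    qed (use maps z w(1) C0 y in auto)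
    also have "\<dots> = (Im (p z) * C * (norm z * \<rho> n + M)\<^sup>2) * y"
      using y by (simp add: \<rho>_def y_def[symmetric] field_simps power2_eq_square)
    finally show ?thesis using y by simp
  qed
  have "Bseq (\<lambda>n. p (w n))"
  proof -
    have "Bseq \<rho>" using \<rho>0 by (intro convergent_imp_Bseq) (auto simp: convergent_def)
    then obtain B where B: "\<And>n. norm (\<rho> n) \<le> B" by (auto simp: Bseq_def)
    define L where "L = Im (p \<i>) * C * (B + M)\<^sup>2"
    have "norm (p (w n)) \<le> norm (p \<i>) + L + 1" for n
    proof -
      have "(norm (p \<i> - cnj (p (w n))))\<^sup>2 \<le> Im (p \<i>) * C * (\<rho> n + M)\<^sup>2"
        using key[of \<i> n] by simp
      also have "\<dots> \<le> L" unfolding L_def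
        using B[of n] w(1)[of n] C0 maps[of \<i>] M0 by (intro mult_left_mono power_mono) (auto simp: \<rho>_def)
      finally have "(norm (p \<i> - cnj (p (w n))))\<^sup>2 \<le> L" .
      moreover have "x \<le> x\<^sup>2 + 1" for x :: real
      proof -
        have "0 \<le> (x - 1/2)\<^sup>2" by simp
        then show ?thesis by (simp add: power2_eq_square algebra_simps)
      qed
      ultimately have "norm (p \<i> - cnj (p (w n))) \<le> L + 1" by (meson add_right_mono order_trans)
      then show ?thesis using norm_triangle_ineq3[of "p \<i>" "cnj (p (w n))"] by simp
    qed
    then show ?thesis by (rule BseqI')
  qed
  then have "bounded (range (\<lambda>n. p (w n)))" by (simp add: Bseq_eq_bounded)
  then obtain b r where r: "strict_mono r" and lim: "((\<lambda>n. p (w n)) \<circ> r) \<longlonglongrightarrow> b"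
    by (meson bounded_imp_convergent_subsequence)
  have lim\<rho>: "(\<lambda>n. \<rho> (r n)) \<longlonglongrightarrow> 0" using LIMSEQ_subseq_LIMSEQ[OF \<rho>0 r] by (simp add: o_def)
  have Imb: "Im b = 0"
  proof -
    have "(\<lambda>n. Im (p (w (r n)))) \<longlonglongrightarrow> Im b" using lim by (intro tendsto_intros) (simp add: o_def)
    moreover have "(\<lambda>n. Im (p (w (r n)))) \<longlonglongrightarrow> 0"
    proof (rule real_tendsto_sandwich)
      show "\<forall>\<^sub>F n in sequentially. 0 \<le> Im (p (w (r n)))" using maps w(1) by simp
      show "\<forall>\<^sub>F n in sequentially. Im (p (w (r n))) \<le> C * \<rho> (r n)"
        using bnd w(1) by (auto simp: \<rho>_def field_simps)
      show "(\<lambda>n. C * \<rho> (r n)) \<longlonglongrightarrow> 0" using tendsto_mult_right_zero[OF lim\<rho>] by simp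
    qed simp
    ultimately show ?thesis by (rule LIMSEQ_unique)
  qed
  have "(norm (p z - of_real (Re b)))\<^sup>2 * Im z \<le> C * M\<^sup>2 * Im (p z)" if z: "0 < Im z" for z
  proof -
    have "(\<lambda>n. (norm (p z - cnj (p (w (r n)))))\<^sup>2 * Im z) \<longlonglongrightarrow> (norm (p z - cnj b))\<^sup>2 * Im z"
      using lim by (intro tendsto_intros) (simp add: o_def)
    moreover have "(\<lambda>n. Im (p z) * C * (norm z * \<rho> (r n) + M)\<^sup>2) \<longlonglongrightarrow> Im (p z) * C * (norm z * 0 + M)\<^sup>2"
      by (intro tendsto_intros lim\<rho>)
    ultimately have "(norm (p z - cnj b))\<^sup>2 * Im z \<le> Im (p z) * C * (norm z * 0 + M)\<^sup>2"
      using key[OF z] by (intro LIMSEQ_le) auto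
    moreover have "cnj b = of_real (Re b)" using Imb by (simp add: complex_eq_iff)
    ultimately show ?thesis by (simp add: mult_ac)
  qed
  then show thesis by (rule that)
qed

text \<open>
  Unless \<open>p\<close> is the constant \<open>b\<close>, the previous lemma says that the self-map \<open>-1 / (p z - b)\<close> has a positive angular derivative at \<open>\<infinity>\<close>;
  inverting its asymptotics gives those of \<open>p\<close>.
\<close>

lemma angular_expansion_at_infinity:
  fixes p :: "complex \<Rightarrow> complex" and w :: "nat \<Rightarrow> complex"
  assumes hol: "p holomorphic_on upper_half_plane"
    and maps: "\<And>z. 0 < Im z \<Longrightarrow> 0 \<le> Im (p z)"
    and w: "\<And>n. 0 < Im (w n)" "\<And>n. norm (w n) \<le> M * Im (w n)"
    and winf: "filterlim (\<lambda>n. Im (w n)) at_top sequentially"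
    and bnd: "\<And>n. Im (p (w n)) * Im (w n) \<le> C"
  obtains b :: real and c :: complex
    where "\<And>M. ((\<lambda>z. z * (p z - of_real b)) \<longlongrightarrow> c) (stolz_at_infinity M)"
proof -
  obtain b K where K: "\<And>z. 0 < Im z \<Longrightarrow> (norm (p z - of_real b))\<^sup>2 * Im z \<le> K * Im (p z)"
    using finite_boundary_value_at_infinity[OF hol maps w winf bnd] by blast
  show thesis
  proof (cases "\<exists>z0. 0 < Im z0 \<and> Im (p z0) = 0")
    case True
    then obtain z0 where z0: "0 < Im z0" "Im (p z0) = 0" by blast
    have "p z = of_real b" if z: "0 < Im z" for z
    proof -
      have "(norm (p z - cnj (p z0)))\<^sup>2 * (Im z * Im z0) \<le> 0"
        using Schwarz_Pick[OF hol maps z z0(1)] z0 by simp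
      then have "p z = cnj (p z0)" using z z0 by (simp add: mult_le_0_iff not_less)
      moreover have "p z0 = of_real b" using K[OF z0(1)] z0
        by (simp add: mult_le_0_iff not_less)
      ultimately show ?thesis by simp
    qed
    then have "((\<lambda>z. z * (p z - of_real b)) \<longlongrightarrow> 0) (stolz_at_infinity M)" for M
      by (intro tendsto_eventually) (auto simp: eventually_stolz_at_infinity)
    then show thesis by (rule that)
  next
    case False
    then have pos: "0 < Im (p z)" if "0 < Im z" for z using maps[OF that] that by (metis order_le_less)
    define h where "h = (\<lambda>z. - 1 / (p z - of_real b))"
    have nz: "p z - of_real b \<noteq> 0" if "0 < Im z" for z
      using pos[OF that] by (auto simp: complex_eq_iff)
    have Imh: "Im (h z) = Im (p z) / (norm (p z - of_real b))\<^sup>2" for z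
      unfolding h_def by (simp add: Im_divide cmod_power2)
    have holh: "h holomorphic_on upper_half_plane"
      unfolding h_def by (intro holomorphic_intros hol) (use nz in auto)
    have K0: "0 < K"
    proof -
      have "0 < (norm (p \<i> - of_real b))\<^sup>2" using nz[of \<i>] by simp
      also have "\<dots> \<le> K * Im (p \<i>)" using K[of \<i>] by simp
      finally show ?thesis using pos[of \<i>] by (simp add: zero_less_mult_iff)
    qed
    have low: "Im z / K \<le> Im (h z)" if z: "0 < Im z" for z
      unfolding Imh using K[OF z] K0 nz[OF z] by (simp add: field_simps)
    obtain \<alpha> where \<alpha>: "0 \<le> \<alpha>" "\<And>M. ((\<lambda>z. h z / z) \<longlongrightarrow> of_real \<alpha>) (stolz_at_infinity M)"
      using Julia_at_infinity[OF holh] pos Imh by (metis divide_nonneg_nonneg less_imp_le zero_le_power2)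
    have ne: "stolz_at_infinity 1 \<noteq> bot"
    proof -
      have "\<exists>z. R \<le> norm z \<and> 0 < Im z \<and> norm z \<le> 1 * Im z" for R
        by (rule exI[of _ "\<i> * of_real (\<bar>R\<bar> + 1)"]) (auto simp: norm_mult)
      then show ?thesis unfolding trivial_limit_def eventually_stolz_at_infinity by blast
    qed
    have "1 / K \<le> \<alpha>"
    proof -
      have "((\<lambda>z. norm (h z / z)) \<longlongrightarrow> norm (of_real \<alpha> :: complex)) (stolz_at_infinity 1)"
        by (intro tendsto_norm \<alpha>(2))
      moreover have "\<forall>\<^sub>F z in stolz_at_infinity 1. 1 / K \<le> norm (h z / z)"
        unfolding eventually_stolz_at_infinity
      proof (rule exI[of _ 0], intro allI impI)
        fix z :: complex assume z: "0 \<le> norm z \<and> 0 < Im z \<and> norm z \<le> 1 * Im z"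
        have "norm z / K \<le> Im z / K" using z K0 by (simp add: divide_right_mono)
        also have "\<dots> \<le> Im (h z)" using low z by blast
        also have "\<dots> \<le> norm (h z)" using abs_Im_le_cmod[of "h z"] by linarith
        finally have "norm z / K \<le> norm (h z)" .
        moreover have "0 < norm z" using z by auto
        ultimately show "1 / K \<le> norm (h z / z)" using K0 by (simp add: norm_divide field_simps)
      qed
      ultimately show ?thesis using ne \<alpha>(1) tendsto_lowerbound by fastforce
    qed
    then have \<alpha>p: "of_real \<alpha> \<noteq> (0::complex)" using K0 by (auto simp: field_simps)
    have "((\<lambda>z. z * (p z - of_real b)) \<longlongrightarrow> - 1 / of_real \<alpha>) (stolz_at_infinity M)" for M
    proof -
      have "((\<lambda>z. - 1 / (h z / z)) \<longlongrightarrow> - 1 / of_real \<alpha>) (stolz_at_infinity M)"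
        by (intro tendsto_intros \<alpha>(2) \<alpha>p)
      moreover have "\<forall>\<^sub>F z in stolz_at_infinity M. - 1 / (h z / z) = z * (p z - of_real b)"
        unfolding eventually_stolz_at_infinity using nz by (auto simp: h_def)
      ultimately show ?thesis by (rule Lim_transform_eventually)
    qed
    then show thesis by (rule that)
  qed
qed

section \<open>Angular expansions in the half-plane and in the disk\<close>

definition stolz_at_1 :: "real \<Rightarrow> complex filter" where
  "stolz_at_1 M = at 1 within {z \<in> ball 0 1. norm (1 - z) < M * (1 - norm z)}"

lemma angular_lim_at_1_iff:
  "angular_lim_at_1 f l \<longleftrightarrow> (\<forall>M>1. (f \<longlongrightarrow> l) (stolz_at_1 M))"
  by (simp add: angular_lim_at_1_def stolz_at_1_def)

lemma eventually_stolz_at_1: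
  "eventually P (stolz_at_1 M) \<longleftrightarrow>
     (\<exists>d>0. \<forall>z. norm z < 1 \<and> norm (1 - z) < M * (1 - norm z) \<and> norm (1 - z) < d \<longrightarrow> P z)"
proof -
  have "z \<noteq> 1" if "norm z < 1" for z :: complex using that by auto
  then show ?thesis
    unfolding stolz_at_1_def eventually_at mem_Collect_eq mem_ball_0 dist_norm
    by (simp add: norm_minus_commute) blast
qed

lemma stolz_at_1_le: "stolz_at_1 M \<le> at 1"
  by (simp add: stolz_at_1_def at_le)

definition cayley :: "complex \<Rightarrow> complex" where
  "cayley z = \<i> * (1 + z) / (1 - z)"

definition inv_cayley :: "complex \<Rightarrow> complex" where
  "inv_cayley w = (w - \<i>) / (w + \<i>)"

lemma Im_cayley:
  assumes "norm z < 1"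
  shows "Im (cayley z) = (1 - (norm z)\<^sup>2) / (norm (1 - z))\<^sup>2" "0 < Im (cayley z)"
proof -
  have n1: "1 - z \<noteq> 0" using assms by auto
  show eq: "Im (cayley z) = (1 - (norm z)\<^sup>2) / (norm (1 - z))\<^sup>2"
    unfolding cayley_def Im_divide cmod_power2 by (simp add: algebra_simps power2_eq_square)
  have "(norm z)\<^sup>2 < 1" using assms by (simp add: abs_square_less_1)
  then show "0 < Im (cayley z)" unfolding eq using n1 by simp
qed

lemma norm_inv_cayley_less_1:
  assumes "0 < Im w" shows "norm (inv_cayley w) < 1"
proof -
  have nz: "w + \<i> \<noteq> 0" using assms by (auto simp: complex_eq_iff)
  have "(norm (w - \<i>))\<^sup>2 < (norm (w + \<i>))\<^sup>2"
    unfolding cmod_power2 using assms by (simp add: power2_eq_square algebra_simps)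
  then have "norm (w - \<i>) < norm (w + \<i>)" by (rule power_less_imp_less_base) simp
  then show ?thesis using nz by (simp add: inv_cayley_def norm_divide)
qed

lemma cayley_inv_cayley: "0 < Im w \<Longrightarrow> cayley (inv_cayley w) = w"
proof -
  assume "0 < Im w"
  then have nz: "w + \<i> \<noteq> 0" by (auto simp: complex_eq_iff)
  have "1 - inv_cayley w = 2 * \<i> / (w + \<i>)" "1 + inv_cayley w = 2 * w / (w + \<i>)"
    unfolding inv_cayley_def using nz by (simp_all add: field_simps)
  then show ?thesis unfolding cayley_def using nz by simp
qed

lemma inv_cayley_cayley: "norm z < 1 \<Longrightarrow> inv_cayley (cayley z) = z"
proof -
  assume "norm z < 1"
  then have nz: "1 - z \<noteq> 0" by auto
  have "cayley z - \<i> = 2 * \<i> * z / (1 - z)" "cayley z + \<i> = 2 * \<i> / (1 - z)"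
    unfolding cayley_def using nz by (simp_all add: field_simps)
  then show ?thesis unfolding inv_cayley_def using nz by simp
qed

lemma cayley_holomorphic: "cayley holomorphic_on ball 0 1"
  unfolding cayley_def[abs_def] by (intro holomorphic_intros) auto

lemma inv_cayley_holomorphic: "inv_cayley holomorphic_on upper_half_plane"
  unfolding inv_cayley_def[abs_def] by (intro holomorphic_intros) (auto simp: complex_eq_iff)

text \<open>
  This transfers angular limits at \<open>\<infinity>\<close> to angular limits at \<open>1\<close>. The opening is at most doubled, because
  \<open>\<bar>cayley z\<bar> \<le> 2 / \<bar>1 - z\<bar>\<close> and \<open>Im (cayley z) \<ge> (1 - \<bar>z\<bar>) / \<bar>1 - z\<bar>\<^sup>2\<close>.
\<close>

lemma filterlim_cayley:
  assumes M: "0 < M"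
  shows "filterlim cayley (stolz_at_infinity (2 * M)) (stolz_at_1 M)"
  unfolding filterlim_def le_filter_def eventually_filtermap
proof (intro allI impI)
  fix P assume "eventually P (stolz_at_infinity (2 * M))"
  then obtain R where R: "\<And>z. R \<le> norm z \<Longrightarrow> 0 < Im z \<Longrightarrow> norm z \<le> 2 * M * Im z \<Longrightarrow> P z"
    unfolding eventually_stolz_at_infinity by blast
  define d where "d = 1 / (\<bar>R\<bar> + 1)"
  have d: "0 < d" "d \<le> 1" by (auto simp: d_def field_simps)
  have "P (cayley z)" if z: "norm z < 1" "norm (1 - z) < M * (1 - norm z)" "norm (1 - z) < d" for z
  proof (rule R)
    have n1: "0 < norm (1 - z)" using z by auto
    show "0 < Im (cayley z)" using Im_cayley(2)[OF z(1)] .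
    have nc: "norm (cayley z) = norm (1 + z) / norm (1 - z)"
      by (simp add: cayley_def norm_divide norm_mult)
    have "norm (1 + z) \<ge> 1"
    proof -
      have "norm (1 + z) = norm (2 - (1 - z))" by simp
      also have "\<dots> \<ge> norm (2::complex) - norm (1 - z)" by (rule norm_triangle_ineq2)
      finally show ?thesis using z(3) d(2) by simp
    qed
    then have "norm (cayley z) \<ge> 1 / norm (1 - z)" unfolding nc using n1 by (simp add: divide_right_mono)
    moreover have "1 / norm (1 - z) \<ge> \<bar>R\<bar> + 1" using z(3) n1 unfolding d_def by (simp add: field_simps)
    ultimately show "R \<le> norm (cayley z)" by linarith
    have "norm (1 + z) \<le> norm (1::complex) + norm z" by (rule norm_triangle_ineq)
    then have "norm (1 + z) \<le> 2" using z(1) by simp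
    then have "norm (cayley z) \<le> 2 / norm (1 - z)" unfolding nc using n1 by (simp add: divide_right_mono)
    also have "\<dots> = 2 * norm (1 - z) / (norm (1 - z))\<^sup>2" using n1 by (simp add: power2_eq_square)
    also have "\<dots> \<le> 2 * (M * (1 - (norm z)\<^sup>2)) / (norm (1 - z))\<^sup>2"
    proof (intro divide_right_mono mult_left_mono)
      have "1 - norm z \<le> 1 - (norm z)\<^sup>2" using z(1) by (simp add: power2_eq_square mult_left_le)
      then have "M * (1 - norm z) \<le> M * (1 - (norm z)\<^sup>2)" using M by simp
      then show "norm (1 - z) \<le> M * (1 - (norm z)\<^sup>2)" using z(2) by linarith
    qed auto
    also have "\<dots> = 2 * M * Im (cayley z)" using Im_cayley(1)[OF z(1)] by simp
    finally show "norm (cayley z) \<le> 2 * M * Im (cayley z)" .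
  qed
  then show "\<forall>\<^sub>F z in stolz_at_1 M. P (cayley z)" unfolding eventually_stolz_at_1 using d by blast
qed

text \<open>
  Cauchy's estimate on the disk of radius \<open>\<bar>1 - z\<bar> / (4 M)\<close>, which stays inside the Stolz angle of twice
  the opening.
\<close>

lemma angular_decay_deriv:
  fixes \<epsilon> :: "complex \<Rightarrow> complex"
  assumes hol: "\<epsilon> holomorphic_on ball 0 1"
    and lim: "\<And>M. 1 < M \<Longrightarrow> ((\<lambda>z. \<epsilon> z / (1 - z) ^ Suc n) \<longlongrightarrow> 0) (stolz_at_1 M)"
    and M: "1 < M"
  shows "((\<lambda>z. deriv \<epsilon> z / (1 - z) ^ n) \<longlongrightarrow> 0) (stolz_at_1 M)"
proof (rule tendstoI)
  fix e :: real assume e: "0 < e"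
  define e' where "e' = e / (8 * M * 2 ^ Suc n)"
  have e': "0 < e'" using e M by (simp add: e'_def)
  have "\<forall>\<^sub>F z in stolz_at_1 (2 * M). dist (\<epsilon> z / (1 - z) ^ Suc n) 0 < e'"
    using lim[of "2 * M"] M e' by (intro tendstoD) auto
  then obtain d where d: "0 < d" and small: "\<And>z. norm z < 1 \<Longrightarrow> norm (1 - z) < 2 * M * (1 - norm z) \<Longrightarrow>
      norm (1 - z) < d \<Longrightarrow> norm (\<epsilon> z / (1 - z) ^ Suc n) < e'"
    unfolding eventually_stolz_at_1 dist_norm diff_zero by blast
  have "dist (deriv \<epsilon> z / (1 - z) ^ n) 0 < e"
    if z: "norm z < 1" "norm (1 - z) < M * (1 - norm z)" "norm (1 - z) < d / 2" for z
  proof -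
    define t where "t = norm (1 - z)"
    have t: "0 < t" using z by (auto simp: t_def)
    define r where "r = t / (4 * M)"
    have r: "0 < r" "r \<le> t / 4" using t M by (auto simp: r_def field_simps)
    have near: "norm y < 1 \<and> norm (\<epsilon> y) \<le> e' * (2 * t) ^ Suc n" if y: "norm (z - y) \<le> r" for y
    proof -
      have ny: "norm y \<le> norm z + r" using norm_triangle_ineq2[of y z] y by (simp add: norm_minus_commute)
      have "t / M < 1 - norm z" using z(2) M by (simp add: t_def field_simps)
      then have a: "3 * t / (4 * M) < 1 - norm y" using ny M unfolding r_def by (simp add: field_simps)
      have "norm (1 - y) \<le> norm (1 - z) + norm (z - y)" using norm_triangle_ineq[of "1 - z" "z - y"] by simp
      then have b: "norm (1 - y) \<le> 5 / 4 * t" using y r(2) by (simp add: t_def)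
      have "0 \<le> 3 * t / (4 * M)" using t M by simp
      then have y1: "norm y < 1" using a by linarith
      have "5 / 4 * t < 2 * M * (3 * t / (4 * M))" using t M by simp
      also have "\<dots> < 2 * M * (1 - norm y)" using a M by (intro mult_strict_left_mono) auto
      finally have st: "norm (1 - y) < 2 * M * (1 - norm y)" using b by linarith
      have "norm (\<epsilon> y / (1 - y) ^ Suc n) < e'"
        by (rule small[OF y1 st]) (use b z(3) t in \<open>unfold t_def, linarith\<close>)
      moreover have n1: "0 < norm (1 - y)" using y1 by auto
      ultimately have "norm (\<epsilon> y) < e' * norm (1 - y) ^ Suc n"
        by (simp add: norm_divide norm_power norm_mult field_simps del: power_Suc)
      also have "\<dots> \<le> e' * (2 * t) ^ Suc n" using b t e' by (intro mult_left_mono power_mono) auto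
      finally show ?thesis using y1 by simp
    qed
    have sub: "cball z r \<subseteq> ball 0 1" using near by (auto simp: dist_norm)
    have "norm ((deriv ^^ 1) \<epsilon> z) \<le> fact 1 * (e' * (2 * t) ^ Suc n) / r ^ 1"
    proof (rule Cauchy_inequality[OF _ _ r(1)])
      show "\<epsilon> holomorphic_on ball z r" using hol sub by (meson ball_subset_cball holomorphic_on_subset)
      show "continuous_on (cball z r) \<epsilon>"
        using hol sub by (meson holomorphic_on_imp_continuous_on holomorphic_on_subset)
    qed (use near in auto)
    then have "norm (deriv \<epsilon> z) \<le> e' * (2 * t) ^ Suc n / r" by simp
    also have "\<dots> = e / 2 * t ^ n"
      unfolding e'_def r_def using t M by (simp add: field_simps power_mult_distrib)
    also have "\<dots> < e * t ^ n" using e t by simp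
    finally show ?thesis using t by (simp add: norm_divide norm_power t_def[symmetric] field_simps)
  qed
  then show "\<forall>\<^sub>F z in stolz_at_1 M. dist (deriv \<epsilon> z / (1 - z) ^ n) 0 < e"
    unfolding eventually_stolz_at_1 using d by (intro exI[of _ "d / 2"]) auto
qed

text \<open>
  With \<open>u = 1 - z\<close> the conjugated map satisfies \<open>1 - \<phi> z = u / X z\<close>, where \<open>X = \<alpha> + \<beta> u + \<kappa> u\<^sup>2\<close> and \<open>\<kappa>\<close> has an
  angular limit. Expanding the quotient gives a cubic polynomial \<open>P\<close> with \<open>\<phi> - P = o(u\<^sup>3)\<close>, and
  \<open>angular_decay_deriv\<close> differentiates this relation three times. The condition on the real part of the second
  derivative expresses that \<open>b\<close> is real: \<open>\<phi>''(1) = 2 \<beta> / \<alpha>\<^sup>2\<close> and \<open>2 \<beta> = 1 - \<alpha> - \<i> b\<close>.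
\<close>

lemma class_C_tilde_if_half_plane_expansion:
  fixes f :: "complex \<Rightarrow> complex" and \<alpha> b :: real
  assumes hol: "f holomorphic_on upper_half_plane" and inj: "inj_on f upper_half_plane"
    and maps: "\<And>z. 0 < Im z \<Longrightarrow> 0 < Im (f z)"
    and \<alpha>: "0 < \<alpha>"
    and expn: "\<And>M. ((\<lambda>z. z * (f z - of_real \<alpha> * z - of_real b)) \<longlongrightarrow> c) (stolz_at_infinity M)"
  shows "(\<lambda>z. inv_cayley (f (cayley z))) \<in> class_C_tilde"
proof -
  define \<phi> where "\<phi> = (\<lambda>z. inv_cayley (f (cayley z)))"
  have hol\<phi>: "\<phi> holomorphic_on ball 0 1"
  proof -
    have "(f \<circ> cayley) holomorphic_on ball 0 1"
      using cayley_holomorphic hol by (rule holomorphic_on_compose_gen) (use Im_cayley in auto)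
    then have "(inv_cayley \<circ> (f \<circ> cayley)) holomorphic_on ball 0 1"
      using inv_cayley_holomorphic by (rule holomorphic_on_compose_gen) (use maps Im_cayley in auto)
    then show ?thesis by (simp add: \<phi>_def o_def)
  qed
  have inj\<phi>: "inj_on \<phi> (ball 0 1)"
  proof (rule inj_onI)
    fix x y assume xy: "x \<in> ball 0 1" "y \<in> ball 0 1" "\<phi> x = \<phi> y"
    then have i: "0 < Im (cayley x)" "0 < Im (cayley y)" using Im_cayley by auto
    have "f (cayley x) = f (cayley y)"
      using xy(3) cayley_inv_cayley maps i unfolding \<phi>_def by metis
    then have "cayley x = cayley y" using inj i by (auto dest: inj_onD)
    then show "x = y" using xy inv_cayley_cayley by (metis mem_ball_0)
  qed
  have map\<phi>: "\<phi> ` ball 0 1 \<subseteq> ball 0 1"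
    unfolding \<phi>_def using norm_inv_cayley_less_1 maps Im_cayley by auto
  define A where "A = (of_real \<alpha> :: complex)"
  have A: "A \<noteq> 0" using \<alpha> by (simp add: A_def)
  define \<beta> where "\<beta> = (of_real b + \<i> - \<i> * A) / (2 * \<i>)"
  define \<kappa> where "\<kappa> = (\<lambda>z. - (cayley z * (f (cayley z) - A * cayley z - of_real b)) / (2 * (1 + z)))"
  define X where "X = (\<lambda>z. A + \<beta> * (1 - z) + (1 - z)\<^sup>2 * \<kappa> z)"
  define k where "k = - c / 4"
  have \<kappa>lim: "(\<kappa> \<longlongrightarrow> k) (stolz_at_1 M)" if "1 < M" for M
  proof -
    have "((\<lambda>z. cayley z * (f (cayley z) - A * cayley z - of_real b)) \<longlongrightarrow> c) (stolz_at_1 M)"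
      using filterlim_compose[OF expn filterlim_cayley[of M]] that by (simp add: A_def)
    moreover have "((\<lambda>z. z) \<longlongrightarrow> 1) (stolz_at_1 M)" using stolz_at_1_le by (rule tendsto_mono) simp
    ultimately have "(\<kappa> \<longlongrightarrow> - c / (2 * (1 + 1))) (stolz_at_1 M)"
      unfolding \<kappa>_def by (intro tendsto_intros) auto
    then show ?thesis by (simp add: k_def)
  qed
  have idlim: "((\<lambda>z. 1 - z) \<longlongrightarrow> 0) (stolz_at_1 M)" for M
  proof -
    have "((\<lambda>z::complex. 1 - z) \<longlongrightarrow> 1 - 1) (at 1)" by (intro tendsto_intros)
    then show ?thesis using tendsto_mono[OF stolz_at_1_le] by fastforce
  qed
  have Xlim: "(X \<longlongrightarrow> A) (stolz_at_1 M)" if "1 < M" for M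
  proof -
    have "(X \<longlongrightarrow> A + \<beta> * 0 + 0\<^sup>2 * k) (stolz_at_1 M)"
      unfolding X_def by (intro tendsto_intros idlim \<kappa>lim that)
    then show ?thesis by simp
  qed
  have \<phi>X: "1 - \<phi> z = (1 - z) / X z \<and> X z \<noteq> 0" if z: "norm z < 1" for z
  proof -
    have n1: "1 - z \<noteq> 0" using z by auto
    have n2: "1 + z \<noteq> 0" using z by (metis add.commute add_eq_0_iff norm_minus_cancel norm_one order_less_irrefl)
    define Z where "Z = cayley z"
    have fi: "f Z + \<i> \<noteq> 0" using maps[of Z] Im_cayley(2)[OF z] by (auto simp: Z_def complex_eq_iff)
    have e1: "1 - \<phi> z = 2 * \<i> / (f Z + \<i>)" unfolding \<phi>_def inv_cayley_def Z_def[symmetric]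
      using fi by (simp add: field_simps)
    have Zu: "Z * (1 - z) = \<i> * (1 + z)" unfolding Z_def cayley_def using n1 by simp
    have "(1 - z)\<^sup>2 * \<kappa> z = - (1 - z) * ((Z * (1 - z)) * (f Z - A * Z - of_real b)) / (2 * (1 + z))"
      unfolding \<kappa>_def Z_def[symmetric] by (simp add: power2_eq_square algebra_simps)
    also have "\<dots> = - \<i> * (1 - z) * (f Z - A * Z - of_real b) / 2"
    proof -
      have "- u * (\<i> * s * G) / (2 * s) = - \<i> * u * G / 2" if "s \<noteq> 0" for u s G :: complex
        using that by simp
      then show ?thesis unfolding Zu using n2 .
    qed
    also have "\<dots> = - \<i> * (1 - z) * f Z / 2 + \<i> * A * (Z * (1 - z)) / 2 + \<i> * (1 - z) * of_real b / 2"
      by (simp add: algebra_simps diff_divide_distrib add_divide_distrib)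
    finally have k2: "(1 - z)\<^sup>2 * \<kappa> z = - \<i> * (1 - z) * f Z / 2 - A * (1 + z) / 2 + \<i> * (1 - z) * of_real b / 2"
    proof -
      have "\<i> * A * (\<i> * s) / 2 = - (A * s / 2)" for s by (simp add: algebra_simps)
      then show "(1 - z)\<^sup>2 * \<kappa> z = - \<i> * (1 - z) * f Z / 2 + \<i> * A * (Z * (1 - z)) / 2 + \<i> * (1 - z) * of_real b / 2
          \<Longrightarrow> ?thesis" unfolding Zu by simp
    qed
    have \<beta>2: "\<beta> = (1 - A) / 2 - \<i> * of_real b / 2" unfolding \<beta>_def by (simp add: field_simps)
    have X2: "X z = (1 - z) * (f Z + \<i>) / (2 * \<i>)"
    proof -
      have c: "2 * \<beta> = 1 - A - \<i> * of_real b" unfolding \<beta>2 by (simp add: right_diff_distrib)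
      have d: "2 * ((1 - z)\<^sup>2 * \<kappa> z) = - \<i> * (1 - z) * f Z - A * (1 + z) + \<i> * (1 - z) * of_real b"
      proof -
        have "2 * (- \<i> * (1 - z) * F / 2 - A * s / 2 + \<i> * (1 - z) * B / 2) =
            - \<i> * (1 - z) * F - A * s + \<i> * (1 - z) * B" for F s B
          by (simp add: distrib_left right_diff_distrib)
        then show ?thesis unfolding k2 .
      qed
      have "2 * X z = 2 * A + 2 * \<beta> * (1 - z) + 2 * ((1 - z)\<^sup>2 * \<kappa> z)"
        unfolding X_def by (simp add: distrib_left mult.assoc)
      also have "\<dots> = - \<i> * ((1 - z) * (f Z + \<i>))"
        unfolding c d by (simp add: algebra_simps)
      finally have "X z = - \<i> * ((1 - z) * (f Z + \<i>)) / 2" by (metis nonzero_mult_div_cancel_left zero_neq_numeral)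
      moreover have "- \<i> * W / 2 = W / (2 * \<i>)" for W by (simp add: field_simps)
      ultimately show ?thesis by metis
    qed
    have "2 * \<i> / F = u / (u * F / (2 * \<i>)) \<and> u * F / (2 * \<i>) \<noteq> 0" if "u \<noteq> 0" "F \<noteq> 0" for u F :: complex
      using that by (auto simp: field_simps)
    then show ?thesis unfolding e1 X2 using n1 fi by blast
  qed
  \<comment> \<open>the coefficient of \<open>u\<^sup>2\<close> in the expansion of \<open>1 / X\<close>; then \<open>P\<close> is \<open>1\<close> minus the expansion of \<open>u / X\<close> up to \<open>u\<^sup>3\<close>\<close>
  define e where "e = \<beta>\<^sup>2 / A ^ 3 - k / A\<^sup>2"
  define P where "P = (\<lambda>z. 1 - (1 - z) / A + \<beta> / A\<^sup>2 * (1 - z)\<^sup>2 - e * (1 - z) ^ 3)"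
  define \<epsilon> where "\<epsilon> = (\<lambda>z. \<phi> z - P z)"
  have holP: "P holomorphic_on S" for S unfolding P_def by (intro holomorphic_intros) (use A in auto)
  have hol\<epsilon>: "\<epsilon> holomorphic_on ball 0 1" unfolding \<epsilon>_def by (intro holomorphic_intros hol\<phi> holP)
  have \<epsilon>3: "((\<lambda>z. \<epsilon> z / (1 - z) ^ 3) \<longlongrightarrow> 0) (stolz_at_1 M)" if M: "1 < M" for M
  proof -
    define q where "q = (\<lambda>z. ((\<kappa> z / A - \<beta>\<^sup>2 / A\<^sup>2 + e * A) + (1 - z) * (e * \<beta> - \<beta> * \<kappa> z / A\<^sup>2)
       + (1 - z)\<^sup>2 * (e * \<kappa> z)) / X z)"
    have "(q \<longlongrightarrow> ((k / A - \<beta>\<^sup>2 / A\<^sup>2 + e * A) + 0 * (e * \<beta> - \<beta> * k / A\<^sup>2) + 0\<^sup>2 * (e * k)) / A) (stolz_at_1 M)"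
      unfolding q_def by (intro tendsto_intros \<kappa>lim idlim Xlim M A) (use A in auto)
    moreover have "k / A - \<beta>\<^sup>2 / A\<^sup>2 + e * A = 0"
      unfolding e_def using A by (simp add: field_simps power2_eq_square power3_eq_cube)
    ultimately have "(q \<longlongrightarrow> 0) (stolz_at_1 M)" by simp
    moreover have "\<forall>\<^sub>F z in stolz_at_1 M. q z = \<epsilon> z / (1 - z) ^ 3"
      unfolding eventually_stolz_at_1
    proof (intro exI[of _ 1] conjI allI impI)
      fix z :: complex
      assume "norm z < 1 \<and> norm (1 - z) < M * (1 - norm z) \<and> norm (1 - z) < 1"
      then have z: "norm z < 1" by simp
      define u where "u = 1 - z"
      define K where "K = \<kappa> z"
      define x where "x = X z"
      have u: "u \<noteq> 0" using z by (auto simp: u_def)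
      have x: "x \<noteq> 0" "x = A + \<beta> * u + u\<^sup>2 * K" using \<phi>X[OF z] by (auto simp: x_def X_def u_def K_def)
      have "\<phi> z = 1 - u / x" using \<phi>X[OF z] by (simp add: u_def x_def algebra_simps)
      then have "\<epsilon> z = u * ((1 / A - \<beta> / A\<^sup>2 * u + e * u\<^sup>2) - 1 / x)"
        unfolding \<epsilon>_def P_def u_def[symmetric] by (simp add: algebra_simps power2_eq_square power3_eq_cube)
      also have "\<dots> = u / x * ((1 / A - \<beta> / A\<^sup>2 * u + e * u\<^sup>2) * x - 1)"
        using x(1) by (simp add: field_simps)
      also have "(1 / A - \<beta> / A\<^sup>2 * u + e * u\<^sup>2) * x - 1 =
         u\<^sup>2 * ((K / A - \<beta>\<^sup>2 / A\<^sup>2 + e * A) + u * (e * \<beta> - \<beta> * K / A\<^sup>2) + u\<^sup>2 * (e * K))"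
        unfolding x(2) using A by (simp add: field_simps power2_eq_square)
      finally show "q z = \<epsilon> z / (1 - z) ^ 3"
        unfolding q_def u_def[symmetric] K_def[symmetric] x_def[symmetric]
        using u x(1) by (simp add: power2_eq_square power3_eq_cube)
    qed simp
    ultimately show ?thesis by (rule Lim_transform_eventually)
  qed
  have hold: "(deriv ^^ j) \<epsilon> holomorphic_on ball 0 1" for j by (intro holomorphic_higher_deriv hol\<epsilon>) auto
  have \<epsilon>d1: "((\<lambda>z. (deriv ^^ 1) \<epsilon> z / (1 - z) ^ 2) \<longlongrightarrow> 0) (stolz_at_1 M)" if "1 < M" for M
    using angular_decay_deriv[OF hol\<epsilon>, of 2 M] \<epsilon>3 that by (simp add: eval_nat_numeral)
  have \<epsilon>d2: "((\<lambda>z. (deriv ^^ 2) \<epsilon> z / (1 - z) ^ 1) \<longlongrightarrow> 0) (stolz_at_1 M)" if "1 < M" for M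
    using angular_decay_deriv[OF hold[of 1], of 1 M] \<epsilon>d1 that by (simp add: eval_nat_numeral)
  have \<epsilon>d3: "((\<lambda>z. (deriv ^^ 3) \<epsilon> z / (1 - z) ^ 0) \<longlongrightarrow> 0) (stolz_at_1 M)" if "1 < M" for M
    using angular_decay_deriv[OF hold[of 2], of 0 M] \<epsilon>d2 that by (simp add: eval_nat_numeral)
  have unpow: "(g \<longlongrightarrow> 0) (stolz_at_1 M)"
    if "((\<lambda>z. g z / (1 - z) ^ m) \<longlongrightarrow> 0) (stolz_at_1 M)" for g :: "complex \<Rightarrow> complex" and m M
  proof -
    have "((\<lambda>z. g z / (1 - z) ^ m * (1 - z) ^ m) \<longlongrightarrow> 0 * 0 ^ m) (stolz_at_1 M)"
      by (intro tendsto_mult that tendsto_power idlim)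
    moreover have "\<forall>\<^sub>F z in stolz_at_1 M. g z / (1 - z) ^ m * (1 - z) ^ m = g z"
      unfolding eventually_stolz_at_1 by (intro exI[of _ 1]) auto
    ultimately have "(g \<longlongrightarrow> 0 * 0 ^ m) (stolz_at_1 M)" by (rule Lim_transform_eventually)
    then show ?thesis by simp
  qed
  have derivs: "angular_lim_at_1 ((deriv ^^ j) \<phi>) ((deriv ^^ j) P 1)" if j: "j \<in> {1, 2, 3}" for j
    unfolding angular_lim_at_1_iff
  proof (intro allI impI)
    fix M :: real assume M: "1 < M"
    have "((deriv ^^ j) \<epsilon> \<longlongrightarrow> 0) (stolz_at_1 M)"
      using j unpow[OF \<epsilon>d1[OF M]] unpow[OF \<epsilon>d2[OF M]] unpow[OF \<epsilon>d3[OF M]] by fastforce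
    moreover have "((deriv ^^ j) P \<longlongrightarrow> (deriv ^^ j) P 1) (stolz_at_1 M)"
    proof -
      have "(deriv ^^ j) P holomorphic_on UNIV" by (intro holomorphic_higher_deriv holP) auto
      then have "isCont ((deriv ^^ j) P) 1"
        using holomorphic_on_imp_continuous_on continuous_on_eq_continuous_at by blast
      then show ?thesis unfolding isCont_def by (rule tendsto_mono[OF stolz_at_1_le])
    qed
    ultimately have "((\<lambda>z. (deriv ^^ j) \<epsilon> z + (deriv ^^ j) P z) \<longlongrightarrow> 0 + (deriv ^^ j) P 1) (stolz_at_1 M)"
      by (rule tendsto_add)
    moreover have "\<forall>\<^sub>F z in stolz_at_1 M. (deriv ^^ j) \<epsilon> z + (deriv ^^ j) P z = (deriv ^^ j) \<phi> z"
      unfolding eventually_stolz_at_1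
    proof (intro exI[of _ 1] conjI allI impI)
      fix z :: complex
      assume "norm z < 1 \<and> norm (1 - z) < M * (1 - norm z) \<and> norm (1 - z) < 1"
      then have z: "z \<in> ball 0 1" by simp
      have "(deriv ^^ j) (\<lambda>w. \<epsilon> w + P w) z = (deriv ^^ j) \<epsilon> z + (deriv ^^ j) P z"
        by (rule higher_deriv_add[OF hol\<epsilon> holP _ z]) simp
      then show "(deriv ^^ j) \<epsilon> z + (deriv ^^ j) P z = (deriv ^^ j) \<phi> z" by (simp add: \<epsilon>_def)
    qed simp
    ultimately have "((deriv ^^ j) \<phi> \<longlongrightarrow> 0 + (deriv ^^ j) P 1) (stolz_at_1 M)"
      by (rule Lim_transform_eventually)
    then show "((deriv ^^ j) \<phi> \<longlongrightarrow> (deriv ^^ j) P 1) (stolz_at_1 M)" by simp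
  qed
  have dP: "(deriv ^^ 2) P 1 = 2 * \<beta> / A\<^sup>2"
  proof -
    have d1: "deriv P = (\<lambda>z. 1 / A - 2 * \<beta> / A\<^sup>2 * (1 - z) + 3 * e * (1 - z)\<^sup>2)"
      unfolding P_def
      by (intro ext DERIV_imp_deriv) (auto intro!: derivative_eq_intros simp: A power2_eq_square field_simps)
    have "deriv (deriv P) 1 = 2 * \<beta> / A\<^sup>2"
      unfolding d1 by (rule DERIV_imp_deriv)
        (use A in \<open>auto intro!: derivative_eq_intros simp: field_simps eval_nat_numeral\<close>)
    then show ?thesis by (simp add: eval_nat_numeral)
  qed
  have "has_angular_deriv_at_1 \<phi> (1 / \<alpha>)"
    unfolding has_angular_deriv_at_1_def angular_lim_at_1_iff
  proof (intro allI impI)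
    fix M :: real assume M: "1 < M"
    have "((\<lambda>z. 1 / X z) \<longlongrightarrow> 1 / A) (stolz_at_1 M)" by (intro tendsto_intros Xlim M A)
    moreover have "\<forall>\<^sub>F z in stolz_at_1 M. 1 / X z = (\<phi> z - 1) / (z - 1)"
      unfolding eventually_stolz_at_1
    proof (intro exI[of _ 1] conjI allI impI)
      fix z :: complex
      assume "norm z < 1 \<and> norm (1 - z) < M * (1 - norm z) \<and> norm (1 - z) < 1"
      then have z: "norm z < 1" by simp
      then have "z - 1 \<noteq> 0" by auto
      moreover have "\<phi> z - 1 = (z - 1) / X z" using \<phi>X[OF z] by (metis minus_diff_eq minus_divide_left)
      ultimately show "1 / X z = (\<phi> z - 1) / (z - 1)" by simp
    qed simp
    ultimately have "((\<lambda>z. (\<phi> z - 1) / (z - 1)) \<longlongrightarrow> 1 / A) (stolz_at_1 M)" by (rule Lim_transform_eventually)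
    then show "((\<lambda>z. (\<phi> z - 1) / (z - 1)) \<longlongrightarrow> complex_of_real (1 / \<alpha>)) (stolz_at_1 M)" by (simp add: A_def)
  qed
  moreover have "angular_lim_at_1 \<phi> 1"
    unfolding angular_lim_at_1_iff
  proof (intro allI impI)
    fix M :: real assume M: "1 < M"
    have "((\<lambda>z. 1 - (1 - z) / X z) \<longlongrightarrow> 1 - 0 / A) (stolz_at_1 M)" by (intro tendsto_intros Xlim idlim M A)
    moreover have "\<forall>\<^sub>F z in stolz_at_1 M. 1 - (1 - z) / X z = \<phi> z"
      unfolding eventually_stolz_at_1 using \<phi>X by (intro exI[of _ 1]) (auto simp: algebra_simps)
    ultimately have "(\<phi> \<longlongrightarrow> 1 - 0 / A) (stolz_at_1 M)" by (rule Lim_transform_eventually)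
    then show "(\<phi> \<longlongrightarrow> 1) (stolz_at_1 M)" by simp
  qed
  moreover have "Re (2 * \<beta> / A\<^sup>2) = 1 / \<alpha> * (1 / \<alpha> - 1)"
  proof -
    have "2 * \<beta> = (1 - A) - \<i> * of_real b" unfolding \<beta>_def by (simp add: field_simps)
    then have "2 * \<beta> / A\<^sup>2 = (of_real (1 - \<alpha>) - \<i> * of_real b) / of_real (\<alpha>\<^sup>2)" by (simp add: A_def)
    then have "Re (2 * \<beta> / A\<^sup>2) = (1 - \<alpha>) / \<alpha>\<^sup>2" by (simp only: Re_divide_of_real) simp
    then show ?thesis using \<alpha> by (simp add: field_simps power2_eq_square)
  qed
  ultimately show ?thesis
    unfolding \<phi>_def[symmetric] class_C_tilde_def class_C_def univalent_on_def
    using hol\<phi> inj\<phi> map\<phi> derivs[of 1] derivs[of 2] derivs[of 3] dP by (auto intro!: exI[of _ "1 / \<alpha>"] exI[of _ "\<lambda>j. (deriv ^^ j) P 1"])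
qed

section \<open>Compositions of three self-maps of the half-plane\<close>

lemma filterlim_iy: "filterlim (\<lambda>y. \<i> * of_real y) (stolz_at_infinity 1) at_top"
  unfolding filterlim_def le_filter_def eventually_filtermap
proof (intro allI impI)
  fix P assume "eventually P (stolz_at_infinity 1)"
  then obtain R where R: "\<And>z. R \<le> norm z \<Longrightarrow> 0 < Im z \<Longrightarrow> norm z \<le> 1 * Im z \<Longrightarrow> P z"
    unfolding eventually_stolz_at_infinity by blast
  have "P (\<i> * of_real y)" if "y \<ge> \<bar>R\<bar> + 1" for y
    by (rule R) (use that in \<open>auto simp: norm_mult\<close>)
  then show "\<forall>\<^sub>F y in at_top. P (\<i> * of_real y)"
    unfolding eventually_at_top_linorder by blast
qed

text \<open>
  Such curves arise as images of the imaginary half-axis under self-maps with positive angular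
  derivative; along them angular limits may be evaluated.
\<close>

lemma nontangential_curve:
  fixes v :: "real \<Rightarrow> complex"
  assumes a: "0 < a" and low: "\<And>y. 0 < y \<Longrightarrow> a * y \<le> Im (v y)"
    and lim: "((\<lambda>y. v y / (\<i> * of_real y)) \<longlongrightarrow> of_real \<alpha>) at_top"
  shows "a \<le> \<alpha>" "\<forall>\<^sub>F y in at_top. norm (v y) \<le> 2 * \<alpha> * y"
    "filterlim v (stolz_at_infinity (2 * \<alpha> / a)) at_top"
proof -
  have "((\<lambda>y. Re (v y / (\<i> * of_real y))) \<longlongrightarrow> Re (of_real \<alpha>)) at_top" by (intro tendsto_Re lim)
  moreover have ev0: "\<forall>\<^sub>F y::real in at_top. 0 < y" by (rule eventually_gt_at_top)
  then have "\<forall>\<^sub>F y in at_top. a \<le> Re (v y / (\<i> * of_real y))"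
  proof eventually_elim
    case (elim y)
    have "Re (v y / (\<i> * of_real y)) = Im (v y) / y"
      using elim by (simp add: Re_divide power2_eq_square)
    then show ?case using low[OF elim] elim by (simp add: pos_le_divide_eq)
  qed
  ultimately show al: "a \<le> \<alpha>" using tendsto_lowerbound by fastforce
  have "((\<lambda>y. norm (v y / (\<i> * of_real y))) \<longlongrightarrow> norm (of_real \<alpha> :: complex)) at_top"
    by (intro tendsto_norm lim)
  then have "\<forall>\<^sub>F y in at_top. norm (v y / (\<i> * of_real y)) < 2 * \<alpha>"
    using al a by (intro order_tendstoD) auto
  with ev0 show up: "\<forall>\<^sub>F y in at_top. norm (v y) \<le> 2 * \<alpha> * y"
    by eventually_elim (simp add: norm_divide norm_mult field_simps)
  show "filterlim v (stolz_at_infinity (2 * \<alpha> / a)) at_top"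
    unfolding filterlim_def le_filter_def eventually_filtermap
  proof (intro allI impI)
    fix P assume "eventually P (stolz_at_infinity (2 * \<alpha> / a))"
    then obtain R where R: "\<And>z. R \<le> norm z \<Longrightarrow> 0 < Im z \<Longrightarrow> norm z \<le> 2 * \<alpha> / a * Im z \<Longrightarrow> P z"
      unfolding eventually_stolz_at_infinity by blast
    have "\<forall>\<^sub>F y in at_top. R / a \<le> y" by (rule eventually_ge_at_top)
    with ev0 up show "\<forall>\<^sub>F y in at_top. P (v y)"
    proof eventually_elim
      case (elim y)
      have i: "a * y \<le> Im (v y)" using low elim by blast
      show ?case
      proof (rule R)
        have "R \<le> a * y" using elim(3) a by (simp add: field_simps)
        then show "R \<le> norm (v y)" using i abs_Im_le_cmod[of "v y"] by linarith
        show "0 < Im (v y)" using i elim(1) a by (meson less_le_trans mult_pos_pos)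
        have "2 * \<alpha> * y = 2 * \<alpha> / a * (a * y)" using a by simp
        also have "\<dots> \<le> 2 * \<alpha> / a * Im (v y)" using i a al by (intro mult_left_mono) auto
        finally show "norm (v y) \<le> 2 * \<alpha> / a * Im (v y)" using elim(2) by linarith
      qed
    qed
  qed
qed

text \<open>
  The chain rule for angular derivatives at \<open>\<infinity>\<close>.
\<close>

lemma angular_derivative_along_curve:
  fixes v :: "real \<Rightarrow> complex"
  assumes v: "0 < a" "\<And>y. 0 < y \<Longrightarrow> a * y \<le> Im (v y)"
    and lim: "((\<lambda>y. v y / (\<i> * of_real y)) \<longlongrightarrow> of_real \<alpha>) at_top"
    and g: "\<And>M. ((\<lambda>z. g z / z) \<longlongrightarrow> of_real \<beta>) (stolz_at_infinity M)"
  shows "((\<lambda>y. g (v y) / (\<i> * of_real y)) \<longlongrightarrow> of_real (\<beta> * \<alpha>)) at_top"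
proof -
  have "((\<lambda>y. g (v y) / v y * (v y / (\<i> * of_real y))) \<longlongrightarrow> of_real \<beta> * of_real \<alpha>) at_top"
    by (intro tendsto_mult lim filterlim_compose[OF g nontangential_curve(3)[OF v lim]])
  moreover have "\<forall>\<^sub>F y::real in at_top. 0 < y" by (rule eventually_gt_at_top)
  then have "\<forall>\<^sub>F y in at_top. g (v y) / v y * (v y / (\<i> * of_real y)) = g (v y) / (\<i> * of_real y)"
  proof eventually_elim
    case (elim y)
    have "0 < Im (v y)" using v(1) v(2)[OF elim] elim by (meson less_le_trans mult_pos_pos)
    then have "v y \<noteq> 0" by auto
    then show ?case by simp
  qed
  ultimately have "((\<lambda>y. g (v y) / (\<i> * of_real y)) \<longlongrightarrow> of_real \<beta> * of_real \<alpha>) at_top"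
    by (rule Lim_transform_eventually)
  then show ?thesis by simp
qed

text \<open>
  Let \<open>\<alpha>0\<close>, \<open>\<alpha>1\<close>, \<open>\<alpha>2\<close> be the angular derivatives of \<open>e\<close>, \<open>g\<close>, \<open>h\<close>. By the chain rule \<open>\<alpha>2 \<alpha>1 \<alpha>0 = 1\<close>. Writing
  \<open>v = e (\<i>y)\<close>, the inequalities \<open>Im (h (g v)) \<ge> \<alpha>2 Im (g v)\<close> and \<open>Im v \<ge> \<alpha>0 y\<close> yield
  \<open>\<alpha>2 (Im (g v) - \<alpha>1 Im v) \<le> Im (h (g v)) - y \<le> C / y\<close>. So \<open>g z - \<alpha>1 z\<close> satisfies the hypotheses of
  \<open>angular_expansion_at_infinity\<close> along the curve \<open>v\<close>.
\<close>

lemma middle_factor_expansion: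
  fixes e g h :: "complex \<Rightarrow> complex"
  assumes hole: "e holomorphic_on upper_half_plane"
    and holg: "g holomorphic_on upper_half_plane" and holh: "h holomorphic_on upper_half_plane"
    and mape: "\<And>z. 0 < Im z \<Longrightarrow> 0 < Im (e z)" and mapg: "\<And>z. 0 < Im z \<Longrightarrow> 0 < Im (g z)"
    and maph: "\<And>z. 0 < Im z \<Longrightarrow> 0 < Im (h z)"
    and a: "0 < a" and lowe: "\<And>z. 0 < Im z \<Longrightarrow> a * Im z \<le> Im (e z)"
    and a': "0 < a'" and lowge: "\<And>z. 0 < Im z \<Longrightarrow> a' * Im z \<le> Im (g (e z))"
    and comp: "\<And>y. Y \<le> y \<Longrightarrow> norm (h (g (e (\<i> * of_real y))) - \<i> * of_real y) \<le> C / y"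
  obtains \<alpha> b :: real and c :: complex where "0 < \<alpha>"
    "\<And>M. ((\<lambda>z. z * (g z - of_real \<alpha> * z - of_real b)) \<longlongrightarrow> c) (stolz_at_infinity M)"
proof -
  define v where "v = (\<lambda>y. e (\<i> * of_real y))"
  obtain \<alpha>0 where \<alpha>0: "\<And>M. ((\<lambda>z. e z / z) \<longlongrightarrow> of_real \<alpha>0) (stolz_at_infinity M)"
      "\<And>z. 0 < Im z \<Longrightarrow> \<alpha>0 * Im z \<le> Im (e z)"
    using Julia_at_infinity[OF hole] mape by (metis less_imp_le)
  obtain \<alpha>1 where \<alpha>1: "\<And>z. 0 < Im z \<Longrightarrow> \<alpha>1 * Im z \<le> Im (g z)"
      "\<And>M. ((\<lambda>z. g z / z) \<longlongrightarrow> of_real \<alpha>1) (stolz_at_infinity M)"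
    using Julia_at_infinity[OF holg] mapg by (metis less_imp_le)
  obtain \<alpha>2 where \<alpha>2: "0 \<le> \<alpha>2" "\<And>z. 0 < Im z \<Longrightarrow> \<alpha>2 * Im z \<le> Im (h z)"
      "\<And>M. ((\<lambda>z. h z / z) \<longlongrightarrow> of_real \<alpha>2) (stolz_at_infinity M)"
    using Julia_at_infinity[OF holh] maph by (metis less_imp_le)
  have lowv: "a * y \<le> Im (v y)" if "0 < y" for y using lowe[of "\<i> * of_real y"] that by (simp add: v_def)
  have lowgv: "a' * y \<le> Im (g (v y))" if "0 < y" for y using lowge[of "\<i> * of_real y"] that by (simp add: v_def)
  have limv: "((\<lambda>y. v y / (\<i> * of_real y)) \<longlongrightarrow> of_real \<alpha>0) at_top"
    unfolding v_def using filterlim_compose[OF \<alpha>0(1) filterlim_iy] .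
  have limg: "((\<lambda>y. g (v y) / (\<i> * of_real y)) \<longlongrightarrow> of_real (\<alpha>1 * \<alpha>0)) at_top"
    by (rule angular_derivative_along_curve[OF a lowv limv \<alpha>1(2)])
  have limh: "((\<lambda>y. h (g (v y)) / (\<i> * of_real y)) \<longlongrightarrow> of_real (\<alpha>2 * (\<alpha>1 * \<alpha>0))) at_top"
    by (rule angular_derivative_along_curve[OF a' lowgv limg \<alpha>2(3)])
  have p0: "0 < \<alpha>0" using nontangential_curve(1)[OF a lowv limv] a by simp
  have p10: "0 < \<alpha>1 * \<alpha>0" using nontangential_curve(1)[OF a' lowgv limg] a' by simp
  then have p1: "0 < \<alpha>1" using p0 by (simp add: zero_less_mult_iff)
  have "((\<lambda>y. h (g (v y)) / (\<i> * of_real y)) \<longlongrightarrow> 1) at_top"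
  proof -
    have "((\<lambda>y. h (g (v y)) / (\<i> * of_real y) - 1) \<longlongrightarrow> 0) at_top"
    proof (rule Lim_null_comparison)
      have "\<forall>\<^sub>F y in at_top. max Y 1 \<le> y" by (rule eventually_ge_at_top)
      then show "\<forall>\<^sub>F y in at_top. norm (h (g (v y)) / (\<i> * of_real y) - 1) \<le> \<bar>C\<bar> * inverse y"
      proof eventually_elim
        case (elim y)
        have "h (g (v y)) / (\<i> * of_real y) - 1 = (h (g (v y)) - \<i> * of_real y) / (\<i> * of_real y)"
          using elim by (simp add: diff_divide_distrib)
        then have "norm (h (g (v y)) / (\<i> * of_real y) - 1) = norm (h (g (v y)) - \<i> * of_real y) / y"
          using elim by (simp add: norm_divide norm_mult)
        also have "\<dots> \<le> (C / y) / y" using comp[of y] elim by (intro divide_right_mono) (auto simp: v_def)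
        also have "\<dots> \<le> \<bar>C\<bar> * inverse y"
        proof -
          have "C / y \<le> \<bar>C\<bar> / 1" using elim by (intro order_trans[OF _ divide_left_mono[of 1 y "\<bar>C\<bar>"]])
             (auto simp: divide_right_mono)
          then show ?thesis using elim by (simp add: divide_inverse mult_right_mono)
        qed
        finally show ?case .
      qed
      show "((\<lambda>y. \<bar>C\<bar> * inverse y) \<longlongrightarrow> 0) at_top"
        using tendsto_mult_right_zero[OF tendsto_inverse_0_at_top[OF filterlim_ident]] by simp
    qed
    then show ?thesis by (simp add: LIM_zero_iff)
  qed
  then have "of_real (\<alpha>2 * (\<alpha>1 * \<alpha>0)) = (1::complex)"
    using limh tendsto_unique[OF trivial_limit_at_top_linorder] by blast
  then have prod: "\<alpha>2 * (\<alpha>1 * \<alpha>0) = 1" by (metis of_real_eq_1_iff)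
  have p2: "0 < \<alpha>2" using prod \<alpha>2(1) by (cases "\<alpha>2 = 0") auto
  define p where "p = (\<lambda>z. g z - of_real \<alpha>1 * z)"
  have holp: "p holomorphic_on upper_half_plane" unfolding p_def by (intro holomorphic_intros holg)
  have mapp: "0 \<le> Im (p z)" if "0 < Im z" for z using \<alpha>1(1)[OF that] by (simp add: p_def)
  have bound: "Im (p (v y)) \<le> C / y / \<alpha>2" if y: "max Y 1 \<le> y" for y
  proof -
    have y0: "0 < y" using y by simp
    have vpos: "0 < Im (v y)" unfolding v_def by (rule mape) (use y0 in simp)
    have gpos: "0 < Im (g (v y))" by (rule mapg[OF vpos])
    have av: "\<alpha>0 * y \<le> Im (v y)" using \<alpha>0(2)[of "\<i> * of_real y"] y0 by (simp add: v_def)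
    have "Im (h (g (v y))) - y \<le> norm (h (g (v y)) - \<i> * of_real y)"
      using abs_Im_le_cmod[of "h (g (v y)) - \<i> * of_real y"] by simp
    also have "\<dots> \<le> C / y" using comp[of y] y by (simp add: v_def)
    finally have "Im (h (g (v y))) \<le> y + C / y" by simp
    moreover have "\<alpha>2 * Im (g (v y)) \<le> Im (h (g (v y)))" by (rule \<alpha>2(2)[OF gpos])
    moreover have "\<alpha>2 * Im (g (v y)) = \<alpha>2 * Im (p (v y)) + \<alpha>2 * \<alpha>1 * Im (v y)"
      by (simp add: p_def algebra_simps)
    moreover have "\<alpha>2 * \<alpha>1 * (\<alpha>0 * y) \<le> \<alpha>2 * \<alpha>1 * Im (v y)"
      using av p1 p2 by (intro mult_left_mono) auto
    moreover have "\<alpha>2 * \<alpha>1 * (\<alpha>0 * y) = y" using prod by (metis mult.assoc mult_1)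
    ultimately have "\<alpha>2 * Im (p (v y)) \<le> C / y" by linarith
    then show ?thesis by (subst pos_le_divide_eq[OF p2]) (simp add: mult.commute)
  qed
  obtain Y1 where Y1: "\<And>y. Y1 \<le> y \<Longrightarrow> norm (v y) \<le> 2 * \<alpha>0 * y"
    using nontangential_curve(2)[OF a lowv limv] unfolding eventually_at_top_linorder by blast
  define N where "N = max (max Y 1) Y1"
  define w where "w = (\<lambda>n. v (N + real n))"
  have Nn: "max Y 1 \<le> N + real n" "Y1 \<le> N + real n" "1 \<le> N + real n" for n by (auto simp: N_def)
  have C0: "0 \<le> C"
  proof -
    have "Y \<le> N" by (auto simp: N_def)
    then have "0 \<le> C / N" using comp[of N] norm_ge_zero order_trans by blast
    moreover have "0 < N" by (auto simp: N_def)
    ultimately show ?thesis by (simp add: zero_le_divide_iff)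
  qed
  have wpos: "0 < Im (w n)" for n
    unfolding w_def v_def by (rule mape) (use Nn(3)[of n] in simp)
  have wa: "a * (N + real n) \<le> Im (w n)" for n
    unfolding w_def by (rule lowv) (use Nn(3)[of n] in simp)
  have wn: "norm (w n) \<le> 2 * \<alpha>0 * (N + real n)" for n unfolding w_def by (rule Y1[OF Nn(2)])
  obtain b c where "\<And>M. ((\<lambda>z. z * (p z - of_real b)) \<longlongrightarrow> c) (stolz_at_infinity M)"
  proof (rule angular_expansion_at_infinity[OF holp mapp, where w = w and M = "2 * \<alpha>0 / a" and C = "2 * \<alpha>0 * (C / \<alpha>2)"])
    show "norm (w n) \<le> 2 * \<alpha>0 / a * Im (w n)" for n
    proof -
      have "2 * \<alpha>0 * (N + real n) = 2 * \<alpha>0 / a * (a * (N + real n))" using a by simp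
      also have "\<dots> \<le> 2 * \<alpha>0 / a * Im (w n)" using wa[of n] p0 a by (intro mult_left_mono) auto
      finally show ?thesis using wn[of n] by linarith
    qed
    have "filterlim (\<lambda>n. a * (N + real n)) at_top sequentially"
      using a by (intro filterlim_tendsto_pos_mult_at_top[OF tendsto_const]
          filterlim_tendsto_add_at_top[OF tendsto_const] filterlim_real_sequentially) auto
    then show "filterlim (\<lambda>n. Im (w n)) at_top sequentially"
      by (rule filterlim_at_top_mono) (use wa in auto)
    show "Im (p (w n)) * Im (w n) \<le> 2 * \<alpha>0 * (C / \<alpha>2)" for n
    proof -
      have "Im (p (w n)) * Im (w n) \<le> (C / (N + real n) / \<alpha>2) * (2 * \<alpha>0 * (N + real n))"
      proof (intro mult_mono)
        show "Im (p (w n)) \<le> C / (N + real n) / \<alpha>2" unfolding w_def by (rule bound[OF Nn(1)])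
        show "Im (w n) \<le> 2 * \<alpha>0 * (N + real n)" using wn[of n] abs_Im_le_cmod[of "w n"] by linarith
      qed (use C0 Nn(3)[of n] p2 wpos[of n] in auto)
      also have "\<dots> = 2 * \<alpha>0 * (C / \<alpha>2)"
      proof -
        have "C / q / \<alpha>2 * (2 * \<alpha>0 * q) = 2 * \<alpha>0 * (C / \<alpha>2)" if "1 \<le> q" for q
          using that by simp
        then show ?thesis using Nn(3) .
      qed
      finally show ?thesis .
    qed
  qed (auto intro: wpos)
  then show thesis using p1 that[of \<alpha>1 b c] by (simp add: p_def)
qed

lemma half_plane_Riemann_map:
  assumes "simply_connected_domain D" "D \<noteq> UNIV"
  obtains S T where "S holomorphic_on upper_half_plane" "T holomorphic_on D"
    "\<And>w. 0 < Im w \<Longrightarrow> S w \<in> D \<and> T (S w) = w" "\<And>z. z \<in> D \<Longrightarrow> 0 < Im (T z) \<and> S (T z) = z"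
proof -
  obtain k g where kg: "k holomorphic_on D" "g holomorphic_on ball 0 1"
    "\<forall>z\<in>D. k z \<in> ball 0 1 \<and> g (k z) = z" "\<forall>z\<in>ball 0 1. g z \<in> D \<and> k (g z) = z"
    using Riemann_mapping_theorem[of D] assms unfolding simply_connected_domain_def by auto
  show thesis
  proof (rule that[of "g \<circ> inv_cayley" "cayley \<circ> k"])
    show "(g \<circ> inv_cayley) holomorphic_on upper_half_plane"
      using inv_cayley_holomorphic kg(2) by (rule holomorphic_on_compose_gen) (use norm_inv_cayley_less_1 in auto)
    show "(cayley \<circ> k) holomorphic_on D"
      using kg(1) cayley_holomorphic by (rule holomorphic_on_compose_gen) (use kg(3) in auto)
  qed (use kg norm_inv_cayley_less_1 cayley_inv_cayley inv_cayley_cayley Im_cayley(2) in auto)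
qed

text \<open>
  Let \<open>e\<close> be \<open>f\<close> followed by the inverse of some Riemann map, and \<open>h\<close> that Riemann map followed by \<open>G\<close>. Since
  \<open>h (e (\<i>y))\<close> has imaginary part at least \<open>y / 2\<close> and \<open>Im (h w) \<le> c \<bar>w + \<i>\<bar>\<^sup>2 / Im w\<close>, the point \<open>e (\<i>y)\<close> approaches
  the boundary as fast as Julia's lemma requires. It accumulates at some boundary point, and the Riemann map
  is precomposed with a Moebius map that sends \<open>\<infinity>\<close> there.
\<close>

lemma normalised_Riemann_map:
  fixes f G :: "complex \<Rightarrow> complex"
  assumes D: "simply_connected_domain D" "D \<noteq> UNIV"
    and holf: "f holomorphic_on upper_half_plane" and mapf: "\<And>z. 0 < Im z \<Longrightarrow> f z \<in> D"
    and holG: "G holomorphic_on D" and mapG: "\<And>z. z \<in> D \<Longrightarrow> 0 < Im (G z)"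
    and low: "\<And>y. Y \<le> y \<Longrightarrow> y / 2 \<le> Im (G (f (\<i> * of_real y)))"
  obtains S T a where "S holomorphic_on upper_half_plane" "T holomorphic_on D"
    "\<And>w. 0 < Im w \<Longrightarrow> S w \<in> D \<and> T (S w) = w" "\<And>z. z \<in> D \<Longrightarrow> 0 < Im (T z) \<and> S (T z) = z"
    "0 < a" "\<And>z. 0 < Im z \<Longrightarrow> a * Im z \<le> Im (T (f z))"
proof -
  obtain S T where ST: "S holomorphic_on upper_half_plane" "T holomorphic_on D"
    "\<And>w. 0 < Im w \<Longrightarrow> S w \<in> D \<and> T (S w) = w" "\<And>z. z \<in> D \<Longrightarrow> 0 < Im (T z) \<and> S (T z) = z"
    using half_plane_Riemann_map[OF D] by metis
  define e where "e = (\<lambda>z. T (f z))"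
  define h where "h = (\<lambda>w. G (S w))"
  have hole: "e holomorphic_on upper_half_plane"
    unfolding e_def by (rule holomorphic_on_compose_into[OF holf ST(2)]) (use mapf in auto)
  have mape: "0 < Im (e z)" if "0 < Im z" for z using ST(4) mapf that by (simp add: e_def)
  have holh: "h holomorphic_on upper_half_plane"
    using holomorphic_on_compose_gen[OF ST(1) holG] ST(3) by (auto simp: h_def o_def)
  have maph: "0 < Im (h z)" if "0 < Im z" for z using ST(3) mapG that by (simp add: h_def)
  define c where "c = Im (h \<i>)"
  have c: "0 < c" unfolding c_def by (rule maph) simp
  have hup: "Im (h w) * Im w \<le> c * (norm (w + \<i>))\<^sup>2" if w: "0 < Im w" for w
  proof -
    have "Im (h w) \<le> norm (h w - cnj (h \<i>))"
      using abs_Im_le_cmod[of "h w - cnj (h \<i>)"] maph[OF w] c by (simp add: c_def)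
    then have "(Im (h w))\<^sup>2 \<le> (norm (h w - cnj (h \<i>)))\<^sup>2" using maph[OF w] by (intro power_mono) auto
    then have "(Im (h w))\<^sup>2 * (Im w * Im \<i>) \<le> (norm (h w - cnj (h \<i>)))\<^sup>2 * (Im w * Im \<i>)"
      using w by (intro mult_right_mono) auto
    also have "\<dots> \<le> Im (h w) * Im (h \<i>) * (norm (w - cnj \<i>))\<^sup>2"
      using Schwarz_Pick_strict[OF holh maph w, of \<i>] by simp
    finally have "Im (h w) * (Im (h w) * Im w) \<le> Im (h w) * (c * (norm (w + \<i>))\<^sup>2)"
      by (simp add: c_def power2_eq_square algebra_simps)
    then show ?thesis using maph[OF w] by simp
  qed
  \<comment> \<open>Schwarz--Pick for \<open>e\<close>, with \<open>Im (e (\<i>y)) / y\<close> estimated by the growth bound for \<open>h\<close>\<close>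
  have key: "(norm (e z - cnj (e (\<i> * of_real y))))\<^sup>2 * (Im z * y * y)
      \<le> Im (e z) * (2 * c * (norm (e (\<i> * of_real y) + \<i>))\<^sup>2) * (norm z + y)\<^sup>2"
    if z: "0 < Im z" and y: "max Y 1 \<le> y" for z y
  proof -
    define E where "E = e (\<i> * of_real y)"
    have y0: "0 < y" using y by simp
    have E: "0 < Im E" unfolding E_def by (rule mape) (use y0 in simp)
    have fD: "f (\<i> * of_real y) \<in> D" using mapf y0 by simp
    have "h E = G (f (\<i> * of_real y))" unfolding h_def E_def e_def using ST(4)[OF fD] by simp
    then have "y / 2 \<le> Im (h E)" using low y by simp
    then have "y / 2 * Im E \<le> Im (h E) * Im E" using E by (intro mult_right_mono) auto
    then have 1: "Im E * y \<le> 2 * c * (norm (E + \<i>))\<^sup>2" using hup[OF E] by (simp add: mult.commute)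
    have "(norm (e z - cnj E))\<^sup>2 * (Im z * Im (\<i> * of_real y)) \<le> Im (e z) * Im E * (norm (z - cnj (\<i> * of_real y)))\<^sup>2"
      unfolding E_def by (rule Schwarz_Pick_strict[OF hole mape z]) (use y0 in simp_all)
    then have "(norm (e z - cnj E))\<^sup>2 * (Im z * y) \<le> Im (e z) * Im E * (norm (z - cnj (\<i> * of_real y)))\<^sup>2"
      by simp
    also have "\<dots> \<le> Im (e z) * Im E * (norm z + y)\<^sup>2"
    proof (intro mult_left_mono power_mono)
      show "norm (z - cnj (\<i> * of_real y)) \<le> norm z + y"
        using norm_triangle_ineq4[of z "cnj (\<i> * of_real y)"] y0 by (simp add: norm_mult)
    qed (use E mape[OF z] in auto)
    finally have "(norm (e z - cnj E))\<^sup>2 * (Im z * y) * y \<le> Im (e z) * Im E * (norm z + y)\<^sup>2 * y"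
      using y0 by (intro mult_right_mono) auto
    also have "\<dots> = Im (e z) * (Im E * y) * (norm z + y)\<^sup>2" by (simp add: mult_ac)
    also have "\<dots> \<le> Im (e z) * (2 * c * (norm (E + \<i>))\<^sup>2) * (norm z + y)\<^sup>2"
      using 1 mape[OF z] by (intro mult_left_mono mult_right_mono) auto
    finally show ?thesis by (simp add: E_def mult_ac)
  qed
  define y where "y = (\<lambda>n. max Y 1 + real n)"
  define E where "E = (\<lambda>n. e (\<i> * of_real (y n)))"
  have y0: "max Y 1 \<le> y n" "0 < y n" for n by (auto simp: y_def)
  have yinf: "filterlim y at_top sequentially" unfolding y_def
    by (intro filterlim_tendsto_add_at_top[OF tendsto_const] filterlim_real_sequentially)
  have EIm: "0 < Im (E n)" for n unfolding E_def by (rule mape) (use y0(2)[of n] in simp)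
  have Ei: "0 < norm (E n + \<i>)" for n using EIm[of n] by (auto simp: complex_eq_iff)
  have key2: "(norm ((e z - cnj (E n)) / (E n + \<i>)))\<^sup>2 * Im z \<le> Im (e z) * (2 * c) * (norm z * inverse (y n) + 1)\<^sup>2"
    if z: "0 < Im z" for z n
  proof -
    define A where "A = (norm (e z - cnj (E n)))\<^sup>2"
    define B where "B = (norm (E n + \<i>))\<^sup>2"
    have B: "0 < B" using Ei[of n] by (simp add: B_def)
    have "A * (Im z * y n * y n) \<le> Im (e z) * (2 * c * B) * (norm z + y n)\<^sup>2"
      using key[OF z y0(1)[of n]] by (simp add: A_def B_def E_def)
    also have "norm z + y n = y n * (norm z * inverse (y n) + 1)" using y0(2)[of n] by (simp add: field_simps)
    finally have "(A * Im z) * (y n)\<^sup>2 \<le> (Im (e z) * (2 * c) * (norm z * inverse (y n) + 1)\<^sup>2 * B) * (y n)\<^sup>2"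
      by (simp add: power_mult_distrib power2_eq_square mult_ac)
    then have "A * Im z \<le> Im (e z) * (2 * c) * (norm z * inverse (y n) + 1)\<^sup>2 * B"
      using y0(2)[of n] by simp
    then show ?thesis using B unfolding norm_divide power_divide A_def[symmetric] B_def[symmetric]
      by (simp add: field_simps)
  qed
  have inv0: "(\<lambda>n. inverse (y n)) \<longlonglongrightarrow> 0" using yinf by (rule tendsto_inverse_0_at_top)
  have limit_key: "l\<^sup>2 * Im z \<le> Im (e z) * (2 * c)"
    if z: "0 < Im z" and r: "strict_mono (r :: nat \<Rightarrow> nat)"
      and l: "(\<lambda>n. norm ((e z - cnj (E (r n))) / (E (r n) + \<i>))) \<longlonglongrightarrow> l" for z l r
  proof -
    have i: "(\<lambda>n. inverse (y (r n))) \<longlonglongrightarrow> 0" using LIMSEQ_subseq_LIMSEQ[OF inv0 r] by (simp add: o_def)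
    have "(\<lambda>n. (norm ((e z - cnj (E (r n))) / (E (r n) + \<i>)))\<^sup>2 * Im z) \<longlonglongrightarrow> l\<^sup>2 * Im z"
      by (intro tendsto_intros l)
    moreover have "(\<lambda>n. Im (e z) * (2 * c) * (norm z * inverse (y (r n)) + 1)\<^sup>2) \<longlonglongrightarrow> Im (e z) * (2 * c) * (norm z * 0 + 1)\<^sup>2"
      by (intro tendsto_intros i)
    ultimately have "l\<^sup>2 * Im z \<le> Im (e z) * (2 * c) * (norm z * 0 + 1)\<^sup>2"
      using key2[OF z] by (intro LIMSEQ_le) auto
    then show ?thesis by simp
  qed
  show thesis
  proof (cases "bounded (range E)")
    case True
    then obtain b r where r: "strict_mono r" and lim: "(E \<circ> r) \<longlonglongrightarrow> b"
      by (meson bounded_imp_convergent_subsequence)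
    have limE: "(\<lambda>n. E (r n)) \<longlonglongrightarrow> b" using lim by (simp add: o_def)
    have "Im b \<ge> 0"
      by (rule LIMSEQ_le_const[OF tendsto_Im[OF limE]]) (use EIm in \<open>auto intro!: less_imp_le\<close>)
    then have bi: "b + \<i> \<noteq> 0" by (auto simp: complex_eq_iff)
    have L: "(norm ((e z - cnj b) / (b + \<i>)))\<^sup>2 * Im z \<le> Im (e z) * (2 * c)" if "0 < Im z" for z
      by (rule limit_key[OF that r]) (intro tendsto_intros limE bi)
    define B where "B = 2 * c * (norm (b + \<i>))\<^sup>2"
    have B: "0 < B" using c bi by (simp add: B_def)
    have L2: "(norm (e z - cnj b))\<^sup>2 * Im z \<le> B * Im (e z)" if "0 < Im z" for z
      using L[OF that] bi unfolding norm_divide power_divide B_def by (simp add: field_simps)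
    have Imb: "Im b = 0"
    proof -
      have "(Im (e (\<i> * of_real (y (r n)))) + Im b)\<^sup>2 * y (r n) \<le> B * Im (E (r n))" for n
      proof -
        have "(Im (E (r n)) + Im b)\<^sup>2 \<le> (norm (E (r n) - cnj b))\<^sup>2"
          using abs_Im_le_cmod[of "E (r n) - cnj b"] EIm[of "r n"] \<open>Im b \<ge> 0\<close> by (intro power_mono) auto
        then have "(Im (E (r n)) + Im b)\<^sup>2 * y (r n) \<le> (norm (E (r n) - cnj b))\<^sup>2 * y (r n)"
          using y0(2)[of "r n"] by (intro mult_right_mono) auto
        also have "\<dots> \<le> B * Im (E (r n))" using L2[of "\<i> * of_real (y (r n))"] y0(2)[of "r n"] by (simp add: E_def)
        finally show ?thesis by (simp add: E_def)
      qed
      then have "(Im (E (r n)) + Im b)\<^sup>2 \<le> B * Im (E (r n)) * inverse (y (r n))" for n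
        using y0(2)[of "r n"] by (simp add: E_def field_simps)
      moreover have "(\<lambda>n. (Im (E (r n)) + Im b)\<^sup>2) \<longlonglongrightarrow> (Im b + Im b)\<^sup>2" by (intro tendsto_intros limE)
      moreover have "(\<lambda>n. inverse (y (r n))) \<longlonglongrightarrow> 0" using LIMSEQ_subseq_LIMSEQ[OF inv0 r] by (simp add: o_def)
      then have "(\<lambda>n. B * Im (E (r n)) * inverse (y (r n))) \<longlonglongrightarrow> B * Im b * 0" by (intro tendsto_intros limE)
      ultimately have "(Im b + Im b)\<^sup>2 \<le> B * Im b * 0" by (intro LIMSEQ_le) auto
      then show ?thesis by simp
    qed
    then have cb: "cnj b = of_real (Re b)" "b = of_real (Re b)" by (simp_all add: complex_eq_iff)
    define \<beta> where "\<beta> = Re b"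
    have nzr: "w - of_real \<beta> \<noteq> 0" if "0 < Im w" for w using that by (auto simp: complex_eq_iff)
    have nz: "w \<noteq> 0" if "0 < Im w" for w using that by auto
    have Im1: "Im (- 1 / w) = Im w / (norm w)\<^sup>2" for w by (simp add: Im_divide cmod_power2)
    have Im2: "0 < Im (of_real \<beta> - 1 / w)" if "0 < Im w" for w
      using Im1[of w] nz[OF that] that by simp
    show thesis
    proof (rule that[of "\<lambda>w. S (of_real \<beta> + (- 1 / w))" "\<lambda>z. - 1 / (T z - of_real \<beta>)" "1 / B"])
      have "(\<lambda>w. of_real \<beta> + (- 1 / w)) holomorphic_on upper_half_plane"
        by (intro holomorphic_intros) (use nz in auto)
      from this ST(1)
      show "(\<lambda>w. S (of_real \<beta> + (- 1 / w))) holomorphic_on upper_half_plane"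
        by (rule holomorphic_on_compose_into) (use Im2 in auto)
      show "(\<lambda>z. - 1 / (T z - of_real \<beta>)) holomorphic_on D"
        by (intro holomorphic_intros ST(2)) (use ST(4) nzr in auto)
      show "S (of_real \<beta> + (- 1 / w)) \<in> D \<and> - 1 / (T (S (of_real \<beta> + (- 1 / w))) - of_real \<beta>) = w" if w: "0 < Im w" for w
      proof -
        have "0 < Im (of_real \<beta> + (- 1 / w))" using Im2[OF w] by simp
        then show ?thesis using ST(3) by simp
      qed
      show "0 < Im (- 1 / (T z - of_real \<beta>)) \<and> S (of_real \<beta> + (- 1 / (- 1 / (T z - of_real \<beta>)))) = z" if z: "z \<in> D" for z
      proof -
        have t: "0 < Im (T z)" "S (T z) = z" using ST(4)[OF z] by auto
        have "0 < Im (- 1 / (T z - of_real \<beta>))" unfolding Im1 using t nzr by simp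
        then show ?thesis using t by simp
      qed
      show "0 < 1 / B" using B by simp
      show "1 / B * Im z \<le> Im (- 1 / (T (f z) - of_real \<beta>))" if z: "0 < Im z" for z
      proof -
        have "(norm (e z - of_real \<beta>))\<^sup>2 * Im z \<le> B * Im (e z)" using L2[OF z] cb(1) by (simp add: \<beta>_def)
        then show ?thesis unfolding Im1 using B nzr[OF mape[OF z]] by (simp add: e_def field_simps)
      qed
    qed
  next
    case False
    have sub: "\<exists>r. strict_mono r \<and> filterlim (\<lambda>n. E (r n)) at_infinity sequentially"
    proof -
      have fin: "\<exists>m>n. K < norm (E m)" for n K
      proof (rule ccontr)
        assume "\<not> (\<exists>m>n. K < norm (E m))"
        then have s: "\<And>m. n < m \<Longrightarrow> norm (E m) \<le> K" by (meson linorder_not_le)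
        have "norm (E m) \<le> max K (Max ((\<lambda>m. norm (E m)) ` {..n}))" for m
          using s[of m] by (cases "n < m") (auto simp: le_max_iff_disj intro!: Max_ge)
        then have "bounded (range E)" unfolding bounded_iff by blast
        then show False using False by simp
      qed
      then have "\<forall>n. \<exists>m>n. real n < norm (E m)" by blast
      then have "\<exists>r. strict_mono r \<and> (\<forall>n. real n < norm (E (r n)))"
      proof -
        have "\<exists>r. \<forall>n. (real n < norm (E (r n))) \<and> r n < r (Suc n)"
        proof (rule dependent_nat_choice[where P = "\<lambda>n m. real n < norm (E m)" and Q = "\<lambda>n m m'. m < m'"])
          show "\<exists>m. real 0 < norm (E m)" using fin[of 0 0] by auto
          show "\<exists>m'. real (Suc n) < norm (E m') \<and> m < m'" for n m using fin[of m "real (Suc n)"] by blast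
        qed
        then show ?thesis by (meson strict_mono_Suc_iff)
      qed
      then obtain r where r: "strict_mono r" "\<And>n. real n < norm (E (r n))" by blast
      have "filterlim (\<lambda>n. norm (E (r n))) at_top sequentially"
        by (rule filterlim_at_top_mono[OF filterlim_real_sequentially]) (simp add: r(2) less_imp_le)
      then have "filterlim (\<lambda>n. E (r n)) at_infinity sequentially" by (rule filterlim_norm_at_top_imp_at_infinity)
      then show ?thesis using r(1) by blast
    qed
    then obtain r where r: "strict_mono r" and inf: "filterlim (\<lambda>n. E (r n)) at_infinity sequentially" by blast
    have Einv: "(\<lambda>n. inverse (E (r n))) \<longlonglongrightarrow> 0" using inf by (rule filterlim_compose[OF tendsto_inverse_0])
    have low1: "Im z \<le> Im (e z) * (2 * c)" if z: "0 < Im z" for z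
    proof -
      have l: "(\<lambda>n. norm ((e z - cnj (E (r n))) / (E (r n) + \<i>))) \<longlonglongrightarrow> 1"
      proof -
        have "(\<lambda>n. norm (e z * inverse (E (r n)) - cnj (E (r n)) / E (r n)) / norm (1 + \<i> * inverse (E (r n)))) \<longlonglongrightarrow> 1 / norm (1 + \<i> * 0)"
        proof (intro tendsto_divide)
          show "(\<lambda>n. norm (1 + \<i> * inverse (E (r n)))) \<longlonglongrightarrow> norm (1 + \<i> * 0)" by (intro tendsto_intros Einv)
          have "(\<lambda>n. norm (e z * inverse (E (r n)) - cnj (E (r n)) / E (r n)) - norm (cnj (E (r n)) / E (r n))) \<longlonglongrightarrow> 0"
          proof (rule Lim_null_comparison)
            show "\<forall>\<^sub>F n in sequentially. norm (norm (e z * inverse (E (r n)) - cnj (E (r n)) / E (r n)) - norm (cnj (E (r n)) / E (r n)))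
                \<le> norm (e z * inverse (E (r n)))"
            proof (rule always_eventually, rule allI)
              fix n
              have "\<bar>norm (a - b) - norm b\<bar> \<le> norm a" for a b :: complex
                using norm_triangle_ineq4[of a b] norm_triangle_ineq2[of b a] by (simp add: norm_minus_commute)
              then show "norm (norm (e z * inverse (E (r n)) - cnj (E (r n)) / E (r n)) - norm (cnj (E (r n)) / E (r n)))
                \<le> norm (e z * inverse (E (r n)))" by simp
            qed
            have "(\<lambda>n. norm (e z * inverse (E (r n)))) \<longlonglongrightarrow> norm (e z * 0)" by (intro tendsto_intros Einv)
            then show "(\<lambda>n. norm (e z * inverse (E (r n)))) \<longlonglongrightarrow> 0" by simp
          qed
          moreover have "norm (cnj (E (r n)) / E (r n)) = 1" for n
          proof -
            have "E (r n) \<noteq> 0" using EIm[of "r n"] by auto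
            then show ?thesis by (simp add: norm_divide)
          qed
          ultimately have "(\<lambda>n. norm (e z * inverse (E (r n)) - cnj (E (r n)) / E (r n)) - 1) \<longlonglongrightarrow> 0" by simp
          then show "(\<lambda>n. norm (e z * inverse (E (r n)) - cnj (E (r n)) / E (r n))) \<longlonglongrightarrow> 1"
            by (simp add: LIM_zero_iff)
        qed simp
        moreover have "norm (e z * inverse (E (r n)) - cnj (E (r n)) / E (r n)) / norm (1 + \<i> * inverse (E (r n)))
          = norm ((e z - cnj (E (r n))) / (E (r n) + \<i>))" for n
        proof -
          have nz: "E (r n) \<noteq> 0" using EIm[of "r n"] by auto
          have "e z * inverse (E (r n)) - cnj (E (r n)) / E (r n) = (e z - cnj (E (r n))) / E (r n)"
            "1 + \<i> * inverse (E (r n)) = (E (r n) + \<i>) / E (r n)" using nz by (simp_all add: field_simps)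
          then show ?thesis using nz by (simp add: norm_divide)
        qed
        ultimately show ?thesis by simp
      qed
      have "1\<^sup>2 * Im z \<le> Im (e z) * (2 * c)" by (rule limit_key[OF z r l])
      then show ?thesis by simp
    qed
    show thesis
      by (rule that[OF ST(1) ST(2) ST(3) ST(4), of "1 / (2 * c)"])
         (use c low1 in \<open>auto simp: e_def field_simps\<close>)
  qed
qed


lemma angular_lim_at_1_cong:
  assumes "\<And>z. z \<in> ball 0 1 \<Longrightarrow> f z = g z"
  shows "angular_lim_at_1 f l \<longleftrightarrow> angular_lim_at_1 g l"
  unfolding angular_lim_at_1_def by (intro all_cong tendsto_cong) (use assms in \<open>auto simp: eventually_at_filter\<close>)

lemma class_C_tilde_cong:
  assumes eq: "\<And>z. z \<in> ball 0 1 \<Longrightarrow> f z = g z"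
  shows "f \<in> class_C_tilde \<longleftrightarrow> g \<in> class_C_tilde"
proof -
  have d: "(deriv ^^ j) f z = (deriv ^^ j) g z" if "z \<in> ball 0 1" for j z
  proof (rule higher_deriv_cong_ev)
    show "\<forall>\<^sub>F x in nhds z. f x = g x"
      using eventually_nhds_in_open[OF open_ball that] by eventually_elim (rule eq)
  qed simp
  have 1: "univalent_on f (ball 0 1) = univalent_on g (ball 0 1)"
    unfolding univalent_on_def using eq holomorphic_cong inj_on_cong by metis
  have 2: "f ` ball 0 1 = g ` ball 0 1" using eq by (rule image_cong[OF refl])
  have 3: "has_angular_deriv_at_1 f a = has_angular_deriv_at_1 g a" for a
    unfolding has_angular_deriv_at_1_def by (rule angular_lim_at_1_cong) (use eq in simp)
  have 4: "angular_lim_at_1 ((deriv ^^ j) f) l = angular_lim_at_1 ((deriv ^^ j) g) l" for j l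
    by (rule angular_lim_at_1_cong) (rule d)
  have 5: "angular_lim_at_1 f l = angular_lim_at_1 g l" for l by (rule angular_lim_at_1_cong) (rule eq)
  show ?thesis
    unfolding class_C_tilde_def class_C_def mem_Collect_eq 1 2 3 4 5 ..
qed

text \<open>
  Two of the three self-maps only serve to control the middle one, which is the transition
  from \<open>\<Omega> 0\<close> to \<open>\<Omega> t\<close>. The Riemann maps for different times are normalised along the same
  curve \<open>f (\<i>y)\<close>, so that the transition fixes \<open>\<infinity>\<close>.
\<close>

theorem conjugates_in_class_C_tilde:
  fixes \<Omega> :: "real \<Rightarrow> complex set" and f :: "complex \<Rightarrow> complex" and G :: "real \<Rightarrow> complex \<Rightarrow> complex"
  assumes dom: "\<And>t. 0 \<le> t \<Longrightarrow> simply_connected_domain (\<Omega> t)"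
    and mono: "\<And>s t. 0 \<le> s \<Longrightarrow> s \<le> t \<Longrightarrow> \<Omega> s \<subseteq> \<Omega> t" and proper: "\<And>t. 0 \<le> t \<Longrightarrow> \<Omega> t \<noteq> UNIV"
    and holf: "f holomorphic_on upper_half_plane" and mapf: "\<And>z. 0 < Im z \<Longrightarrow> f z \<in> \<Omega> 0"
    and holG: "\<And>t. 0 < t \<Longrightarrow> G t holomorphic_on \<Omega> t"
    and mapG: "\<And>t z. 0 < t \<Longrightarrow> z \<in> \<Omega> t \<Longrightarrow> 0 < Im (G t z)"
    and asym: "\<And>t. 0 < t \<Longrightarrow> \<exists>C Y. \<forall>y\<ge>Y. norm (G t (f (\<i> * of_real y)) - \<i> * of_real y) \<le> C / y"
  shows "\<exists>F :: real \<Rightarrow> complex \<Rightarrow> complex. \<forall>t\<ge>0.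
           univalent_on (F t) (ball 0 1) \<and> F t ` ball 0 1 = \<Omega> t \<and>
           inv_into (ball 0 1) (F t) \<circ> F 0 \<in> class_C_tilde"
proof -
  define R where "R = (\<lambda>t S T a. S holomorphic_on upper_half_plane \<and> T holomorphic_on \<Omega> t \<and>
    (\<forall>w. 0 < Im w \<longrightarrow> S w \<in> \<Omega> t \<and> T (S w) = w) \<and> (\<forall>z. z \<in> \<Omega> t \<longrightarrow> 0 < Im (T z) \<and> S (T z) = z) \<and>
    0 < a \<and> (\<forall>z. 0 < Im z \<longrightarrow> a * Im z \<le> Im (T (f z))))"
  have ex: "\<exists>S T a. R t S T a" if t: "0 \<le> t" for t
  proof -
    \<comment> \<open>\<open>G\<close> is given for positive times only; at time \<open>0\<close> a later domain serves, as it contains \<open>\<Omega> 0\<close>\<close>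
    define s where "s = (if t = 0 then 1 else t)"
    have s: "0 < s" "\<Omega> t \<subseteq> \<Omega> s" using t mono[of t s] by (auto simp: s_def)
    obtain C Y where CY: "\<And>y. Y \<le> y \<Longrightarrow> norm (G s (f (\<i> * of_real y)) - \<i> * of_real y) \<le> C / y"
      using asym[OF s(1)] by blast
    define Y' where "Y' = max (max Y 1) (2 * \<bar>C\<bar>)"
    have low: "y / 2 \<le> Im (G s (f (\<i> * of_real y)))" if y: "Y' \<le> y" for y
    proof -
      have y': "Y \<le> y" "1 \<le> y" "2 * \<bar>C\<bar> \<le> y" using y by (auto simp: Y'_def)
      have "y - Im (G s (f (\<i> * of_real y))) \<le> C / y"
        using CY[OF y'(1)] abs_Im_le_cmod[of "G s (f (\<i> * of_real y)) - \<i> * of_real y"] by simp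
      also have "\<dots> \<le> \<bar>C\<bar> / 1" using y'(2) by (intro frac_le) auto
      finally show ?thesis using y'(3) by simp
    qed
    show ?thesis unfolding R_def
    proof (rule normalised_Riemann_map[OF dom[OF t] proper[OF t] holf, of "G s" Y'])
      show "f z \<in> \<Omega> t" if "0 < Im z" for z using mapf[OF that] mono[of 0 t] t by auto
      show "G s holomorphic_on \<Omega> t" using holG[OF s(1)] s(2) by (rule holomorphic_on_subset)
      show "0 < Im (G s z)" if "z \<in> \<Omega> t" for z using mapG s that by blast
    qed (use low in blast)+
  qed
  define S where "S = (\<lambda>t. SOME S. \<exists>T a. R t S T a)"
  define T where "T = (\<lambda>t. SOME T. \<exists>a. R t (S t) T a)"
  define a where "a = (\<lambda>t. SOME a. R t (S t) (T t) a)"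
  have R: "R t (S t) (T t) (a t)" if "0 \<le> t" for t
  proof -
    have "\<exists>T a. R t (S t) T a" unfolding S_def by (rule someI_ex[OF ex[OF that]])
    then have "\<exists>a. R t (S t) (T t) a" unfolding T_def by (rule someI_ex)
    then show ?thesis unfolding a_def by (rule someI_ex)
  qed
  have hS: "S t holomorphic_on upper_half_plane" and hT: "T t holomorphic_on \<Omega> t" and a: "0 < a t"
    if "0 \<le> t" for t using R[OF that] by (auto simp: R_def)
  have S: "S t w \<in> \<Omega> t \<and> T t (S t w) = w" if "0 \<le> t" "0 < Im w" for t w
    using R[OF that(1)] that(2) by (auto simp: R_def)
  have T: "0 < Im (T t z) \<and> S t (T t z) = z" if "0 \<le> t" "z \<in> \<Omega> t" for t z
    using R[OF that(1)] that(2) by (auto simp: R_def)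
  have low: "a t * Im z \<le> Im (T t (f z))" if "0 \<le> t" "0 < Im z" for t z
    using R[OF that(1)] that(2) by (auto simp: R_def)
  define F where "F = (\<lambda>t z. S t (cayley z))"
  have holF: "F t holomorphic_on ball 0 1" if "0 \<le> t" for t
    unfolding F_def by (rule holomorphic_on_compose_into[OF cayley_holomorphic hS[OF that]]) (use Im_cayley(2) in auto)
  have FT: "F t z \<in> \<Omega> t \<and> inv_cayley (T t (F t z)) = z" if "0 \<le> t" "z \<in> ball 0 1" for t z
    using S[OF that(1)] Im_cayley(2) inv_cayley_cayley that by (auto simp: F_def)
  have TF: "inv_cayley (T t z) \<in> ball 0 1 \<and> F t (inv_cayley (T t z)) = z" if "0 \<le> t" "z \<in> \<Omega> t" for t z
    using T[OF that] norm_inv_cayley_less_1 cayley_inv_cayley by (auto simp: F_def)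
  have injF: "inj_on (F t) (ball 0 1)" if "0 \<le> t" for t by (metis FT[OF that] inj_onI)
  have imF: "F t ` ball 0 1 = \<Omega> t" if "0 \<le> t" for t
    using FT[OF that] TF[OF that] by (metis image_subsetI rev_image_eqI subsetI subset_antisym)
  have tilde: "inv_into (ball 0 1) (F t) \<circ> F 0 \<in> class_C_tilde" if t: "0 \<le> t" for t
  proof -
    define g where "g = (\<lambda>w. T t (S 0 w))"
    have sub: "\<Omega> 0 \<subseteq> \<Omega> t" using mono t by simp
    have S0: "S 0 w \<in> \<Omega> t" if "0 < Im w" for w using S[of 0 w] that sub by auto
    have holg: "g holomorphic_on upper_half_plane"
      using holomorphic_on_compose_gen[OF hS[of 0] hT[OF t]] S0 by (auto simp: g_def o_def)
    have mapg: "0 < Im (g w)" if "0 < Im w" for w using T[OF t S0[OF that]] by (simp add: g_def)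
    have injg: "inj_on g upper_half_plane"
    proof (rule inj_onI)
      fix x y assume xy: "x \<in> upper_half_plane" "y \<in> upper_half_plane" "g x = g y"
      then have "S 0 x = S 0 y" using T[OF t] S0 unfolding g_def by (metis mem_Collect_eq)
      then show "x = y" using S[of 0] xy by (metis mem_Collect_eq order_refl)
    qed
    have "\<exists>\<alpha> b c. 0 < \<alpha> \<and> (\<forall>M. ((\<lambda>z. z * (g z - of_real \<alpha> * z - of_real b)) \<longlongrightarrow> c) (stolz_at_infinity M))"
    proof (cases "t = 0")
      case True
      have "((\<lambda>z. z * (g z - of_real 1 * z - of_real 0)) \<longlongrightarrow> 0) (stolz_at_infinity M)" for M
        by (rule tendsto_eventually)
           (use True S[of 0] in \<open>auto simp: eventually_stolz_at_infinity g_def\<close>)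
      then show ?thesis by (metis zero_less_one)
    next
      case False
      then have t0: "0 < t" using t by simp
      define e where "e = (\<lambda>z. T 0 (f z))"
      define h where "h = (\<lambda>w. G t (S t w))"
      have hole: "e holomorphic_on upper_half_plane"
        using holomorphic_on_compose_gen[OF holf hT[of 0]] mapf by (auto simp: e_def o_def)
      have mape: "0 < Im (e z)" if "0 < Im z" for z using T[of 0] mapf that by (simp add: e_def)
      have holh: "h holomorphic_on upper_half_plane"
        using holomorphic_on_compose_gen[OF hS[OF t] holG[OF t0]] S[OF t] by (auto simp: h_def o_def)
      have maph: "0 < Im (h z)" if "0 < Im z" for z using S[OF t] mapG[OF t0] that by (simp add: h_def)
      have ge: "g (e z) = T t (f z)" if "0 < Im z" for z using T[of 0] mapf that by (simp add: g_def e_def)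
      have hge: "h (g (e z)) = G t (f z)" if "0 < Im z" for z
        using ge[OF that] T[OF t, of "f z"] mapf[OF that] sub by (auto simp: h_def)
      obtain C Y where CY: "\<And>y. Y \<le> y \<Longrightarrow> norm (G t (f (\<i> * of_real y)) - \<i> * of_real y) \<le> C / y"
        using asym[OF t0] by blast
      show ?thesis
      proof (rule middle_factor_expansion[OF hole holg holh mape mapg maph a[of 0] _ a[OF t], where Y = "max Y 1" and C = C])
        show "a 0 * Im z \<le> Im (e z)" if "0 < Im z" for z using low[of 0 z] that by (simp add: e_def)
        show "a t * Im z \<le> Im (g (e z))" if "0 < Im z" for z using low[OF t that] ge[OF that] by simp
        show "norm (h (g (e (\<i> * of_real y))) - \<i> * of_real y) \<le> C / y" if "max Y 1 \<le> y" for y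
          using hge[of "\<i> * of_real y"] CY[of y] that by simp
      qed auto
    qed
    then obtain \<alpha> b c where ab: "0 < \<alpha>"
      "\<And>M. ((\<lambda>z. z * (g z - of_real \<alpha> * z - of_real b)) \<longlongrightarrow> c) (stolz_at_infinity M)" by blast
    have gc: "(\<lambda>z. inv_cayley (g (cayley z))) \<in> class_C_tilde"
      by (rule class_C_tilde_if_half_plane_expansion[OF holg injg mapg ab])
    have eq: "(inv_into (ball 0 1) (F t) \<circ> F 0) z = inv_cayley (g (cayley z))" if z: "z \<in> ball 0 1" for z
    proof -
      have "F 0 z \<in> \<Omega> t" using FT[of 0 z] z sub by auto
      then have "inv_into (ball 0 1) (F t) (F 0 z) = inv_cayley (T t (F 0 z))"
        using TF[OF t] inv_into_f_eq[OF injF[OF t]] by blast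
      then show ?thesis by (simp add: g_def F_def)
    qed
    have "inv_into (ball 0 1) (F t) \<circ> F 0 \<in> class_C_tilde \<longleftrightarrow> (\<lambda>z. inv_cayley (g (cayley z))) \<in> class_C_tilde"
      by (rule class_C_tilde_cong) (rule eq)
    then show ?thesis using gc by blast
  qed
  show ?thesis by (rule exI[of _ F]) (use holF injF imF tilde in \<open>auto simp: univalent_on_def\<close>)
qed

section \<open>Explicit maps to and from perturbed half-planes\<close>

lemma half_le_sin:
  fixes x :: real assumes "0 \<le> x" "x \<le> pi / 2" shows "x / 2 \<le> sin x"
proof -
  define y where "y = x / 2"
  have y: "0 \<le> y" "y \<le> pi / 4" using assms by (auto simp: y_def)
  have c: "cos (pi / 4) \<le> cos y" using y by (intro cos_monotone_0_pi_le) auto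
  have c0: "0 < cos y" using c cos_45 by (smt (verit) divide_pos_pos real_sqrt_gt_0_iff)
  have "y * cos y \<le> sin y"
  proof (cases "y = 0")
    case False
    have "\<bar>y\<bar> < pi / 2" using y pi_gt_zero by linarith
    then have "\<bar>y\<bar> \<le> \<bar>tan y\<bar>" by (rule abs_tan_ge)
    moreover have "0 \<le> tan y" using y pi_gt_zero False by (intro less_imp_le tan_gt_zero) linarith+
    ultimately have "y \<le> sin y / cos y" using y by (simp add: tan_def)
    then show ?thesis using c0 by (simp add: pos_le_divide_eq)
  qed simp
  then have "y * cos y * cos y \<le> sin y * cos y" using c0 by (intro mult_right_mono) auto
  moreover have "1 / 2 \<le> cos y * cos y"
  proof -
    have "(sqrt 2 / 2) * (sqrt 2 / 2) \<le> cos y * cos y"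
      using c c0 unfolding cos_45 by (intro mult_mono) auto
    then show ?thesis by simp
  qed
  then have "y * (1 / 2) \<le> y * (cos y * cos y)" using y by (intro mult_left_mono) auto
  ultimately have "y / 2 \<le> sin y * cos y" by (simp add: mult.assoc)
  moreover have "sin x = 2 * sin y * cos y" using sin_double[of y] by (simp add: y_def)
  ultimately show ?thesis by (simp add: y_def)
qed

text \<open>
  On the real axis \<open>- \<i> (- \<i> z)\<^sup>-\<^sup>\<beta>\<close> has imaginary part \<open>- cos (\<beta> \<pi> / 2) \<bar>z\<bar>\<^sup>-\<^sup>\<beta>\<close>, which is positive for \<open>1 < \<beta> < 2\<close>.
  It is negative near the imaginary axis; there \<open>Im (- 4 / z)\<close>, a multiple of the Poisson kernel, dominates, because it
  decays more slowly.
\<close>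

definition power_kernel :: "real \<Rightarrow> complex \<Rightarrow> complex" where
  "power_kernel \<beta> z = - 4 / z - \<i> * (- \<i> * z) powr of_real (- \<beta>)"

lemma power_kernel_holomorphic:
  "power_kernel \<beta> holomorphic_on upper_half_plane"
proof -
  have "- \<i> * z \<notin> \<real>\<^sub>\<le>\<^sub>0" if "0 < Im z" for z using that by (auto simp: complex_nonpos_Reals_iff)
  then show ?thesis unfolding power_kernel_def[abs_def]
    by (intro holomorphic_intros) auto
qed

lemma neg_cos_half_pi_pos:
  assumes "1 < \<beta>" "\<beta> < 2" shows "0 < - cos (\<beta> * pi / 2)"
proof -
  have "0 < sin (\<beta> * pi / 2 - pi / 2)"
  proof (rule sin_gt_zero)
    have "pi < \<beta> * pi" using assms pi_gt_zero by simp
    then show "0 < \<beta> * pi / 2 - pi / 2" by simp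
    have "\<beta> * pi < 2 * pi" using assms pi_gt_zero by simp
    then show "\<beta> * pi / 2 - pi / 2 < pi" using pi_gt_zero by linarith
  qed
  then show ?thesis by (simp add: sin_diff)
qed

text \<open>
  In polar coordinates with angle \<open>\<phi>\<close> measured from the imaginary axis the claim is
  \<open>- cos (\<beta> \<pi> / 2) \<le> 4 cos \<phi> - cos (\<beta> \<phi>)\<close>. It is an equality at \<open>\<bar>\<phi>\<bar> = \<pi> / 2\<close>. At distance
  \<open>x\<close> from there \<open>cos (\<beta> \<phi>)\<close> has changed by at most \<open>2 x\<close>, whereas \<open>4 cos \<phi> = 4 sin x\<close> is at least \<open>2 x\<close>.
\<close>

lemma Im_power_kernel_ge:
  assumes \<beta>: "1 < \<beta>" "\<beta> < 2" and z: "0 < Im z" "1 \<le> norm z"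
  shows "- cos (\<beta> * pi / 2) * norm z powr (- \<beta>) \<le> Im (power_kernel \<beta> z)"
proof -
  define w where "w = - \<i> * z"
  define r where "r = norm z"
  define \<phi> where "\<phi> = Arg w"
  have w: "w \<noteq> 0" "norm w = r" "Re w = Im z" using z by (auto simp: w_def r_def norm_mult)
  have r: "1 \<le> r" using z by (simp add: r_def)
  have \<phi>: "\<bar>\<phi>\<bar> < pi / 2" using z Arg_Re_pos[of w] w unfolding \<phi>_def by (simp add: abs_less_iff)
  have "w = of_real r * exp (\<i> * of_real \<phi>)" using Arg_eq[OF w(1)] w(2) by (simp add: \<phi>_def)
  then have Rew: "Im z = r * cos \<phi>" using w(3) by (simp add: Re_exp)
  have "w powr of_real (- \<beta>) = exp (of_real (- \<beta>) * Ln w)" using w by (simp add: powr_def)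
  also have "Ln w = of_real (ln r) + \<i> * of_real \<phi>" using Ln_Arg[OF w(1)] w(2) by (simp add: \<phi>_def)
  finally have pw: "w powr of_real (- \<beta>) = exp (of_real (- \<beta> * ln r) + \<i> * of_real (- \<beta> * \<phi>))"
    by (simp add: algebra_simps)
  have Rpw: "Re (w powr of_real (- \<beta>)) = r powr (- \<beta>) * cos (\<beta> * \<phi>)"
    unfolding pw Re_exp using r by (simp add: powr_def)
  have "Im (- 4 / z) = 4 * Im z / r\<^sup>2" by (simp add: Im_divide cmod_power2 r_def)
  also have "\<dots> = 4 * cos \<phi> / r" unfolding Rew using r by (simp add: power2_eq_square)
  finally have I4: "Im (- 4 / z) = 4 * cos \<phi> / r" .
  have Im: "Im (power_kernel \<beta> z) = 4 * cos \<phi> / r - r powr (- \<beta>) * cos (\<beta> * \<phi>)"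
    using I4 Rpw unfolding power_kernel_def w_def by simp
  have c0: "0 \<le> cos \<phi>" using \<phi> by (intro cos_ge_zero) auto
  have "r powr (- \<beta>) \<le> r powr (- 1)" using r \<beta> by (intro powr_mono) auto
  then have rp: "r powr (- \<beta>) \<le> 1 / r" using r by (simp add: powr_minus_divide)
  have "4 * cos \<phi> * r powr (- \<beta>) \<le> 4 * cos \<phi> * (1 / r)"
    using rp c0 by (intro mult_left_mono) auto
  moreover have "- cos (\<beta> * pi / 2) \<le> 4 * cos \<phi> - cos (\<beta> * \<phi>)"
  proof -
    define x where "x = pi / 2 - \<bar>\<phi>\<bar>"
    have x: "0 \<le> x" "x \<le> pi / 2" using \<phi> by (auto simp: x_def)
    have sx: "sin x = cos \<phi>" unfolding x_def by (simp add: sin_diff)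
    have e: "cos (\<beta> * \<phi>) = cos (\<beta> * \<bar>\<phi>\<bar>)" by (cases "0 \<le> \<phi>") auto
    have "\<bar>cos (\<beta> * \<bar>\<phi>\<bar>) - cos (\<beta> * pi / 2)\<bar> \<le> \<bar>\<beta> * \<bar>\<phi>\<bar> - \<beta> * pi / 2\<bar>"
    proof -
      have "norm (cos (\<beta> * \<bar>\<phi>\<bar>) - cos (\<beta> * pi / 2)) \<le> 1 * norm (\<beta> * \<bar>\<phi>\<bar> - \<beta> * pi / 2)"
        by (rule field_differentiable_bound[of UNIV cos "\<lambda>x. - sin x"])
          (auto intro!: derivative_eq_intros)
      then show ?thesis by simp
    qed
    also have "\<beta> * \<bar>\<phi>\<bar> - \<beta> * pi / 2 = - (\<beta> * x)" by (simp add: x_def algebra_simps)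
    also have "\<bar>- (\<beta> * x)\<bar> \<le> 2 * x" using x \<beta> by (simp add: mult_right_mono)
    also have "\<dots> \<le> 4 * sin x" using half_le_sin[OF x] by simp
    finally show ?thesis using sx e by linarith
  qed
  then have "- cos (\<beta> * pi / 2) * r powr (- \<beta>) \<le> (4 * cos \<phi> - cos (\<beta> * \<phi>)) * r powr (- \<beta>)"
    by (intro mult_right_mono) auto
  ultimately show ?thesis unfolding Im r_def[symmetric] by (simp add: algebra_simps)
qed

lemma norm_power_kernel_le:
  assumes \<beta>: "1 < \<beta>" and z: "1 \<le> norm z" "0 < Im z"
  shows "norm (power_kernel \<beta> z) \<le> 5 / norm z"
proof -
  have z0: "z \<noteq> 0" using z by auto
  have "norm ((- \<i> * z) powr of_real (- \<beta>)) = norm z powr (- \<beta>)"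
    using norm_powr_real_powr'[of "of_real (- \<beta>)" "- \<i> * z"] by (simp add: norm_mult)
  also have "\<dots> \<le> norm z powr (- 1)" using z \<beta> by (intro powr_mono) auto
  also have "\<dots> = 1 / norm z" using z0 by (simp add: powr_minus_divide)
  finally have "norm (\<i> * (- \<i> * z) powr of_real (- \<beta>)) \<le> 1 / norm z" by (simp add: norm_mult)
  moreover have "norm (- 4 / z) = 4 / norm z" by (simp add: norm_divide)
  ultimately have "norm (- 4 / z) + norm (\<i> * (- \<i> * z) powr of_real (- \<beta>)) \<le> 5 / norm z"
    by (simp add: add_divide_distrib[symmetric] field_simps)
  then show ?thesis unfolding power_kernel_def using norm_triangle_ineq4 order_trans by blast
qed

text \<open>
  The common form of both comparison maps. The term with \<open>s\<close> produces or cancels the cubic term of the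
  boundary curve, the term with \<open>L\<close> absorbs the Hoelder remainder, and the term with \<open>A\<close>, whose imaginary part
  is a multiple of the Poisson kernel with pole at \<open>-\<i>Y\<close>, is large on bounded sets.
\<close>

definition model_map :: "real \<Rightarrow> real \<Rightarrow> real \<Rightarrow> real \<Rightarrow> real \<Rightarrow> complex \<Rightarrow> complex" where
  "model_map \<beta> s Y A L z =
     z + (\<i> * of_real s - of_real A) / (z + \<i> * of_real Y) + of_real L * power_kernel \<beta> (z + \<i> * of_real Y)"

lemma model_map_holomorphic: "model_map \<beta> s Y A L holomorphic_on {z. - Y < Im z}"
proof -
  have nz: "z + \<i> * of_real Y \<noteq> 0" if "- Y < Im z" for z using that by (auto simp: complex_eq_iff)
  have "(\<lambda>z. z + \<i> * of_real Y) holomorphic_on {z. - Y < Im z}" by (intro holomorphic_intros)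
  from holomorphic_on_compose_gen[OF this power_kernel_holomorphic[of \<beta>]]
  have "(\<lambda>z. power_kernel \<beta> (z + \<i> * of_real Y)) holomorphic_on {z. - Y < Im z}"
    by (auto simp: o_def image_subset_iff)
  then show ?thesis unfolding model_map_def[abs_def]
    by (intro holomorphic_intros) (use nz in auto)
qed

lemma norm_model_map_diff:
  assumes \<beta>: "1 < \<beta>" and L: "0 \<le> L" and A: "0 \<le> A" and z: "- Y < Im z" "1 \<le> norm (z + \<i> * of_real Y)"
  shows "norm (model_map \<beta> s Y A L z - z + of_real A / (z + \<i> * of_real Y)) \<le> (\<bar>s\<bar> + 5 * L) / norm (z + \<i> * of_real Y)"
    and "norm (model_map \<beta> s Y A L z - z) \<le> (\<bar>s\<bar> + 5 * L + A) / norm (z + \<i> * of_real Y)"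
proof -
  define w where "w = z + \<i> * of_real Y"
  have w: "0 < Im w" "1 \<le> norm w" using z by (auto simp: w_def)
  have m: "model_map \<beta> s Y A L z - z + of_real A / w = \<i> * of_real s / w + of_real L * power_kernel \<beta> w"
    unfolding model_map_def w_def[symmetric] by (simp add: diff_divide_distrib)
  have "norm (\<i> * of_real s / w + of_real L * power_kernel \<beta> w) \<le> \<bar>s\<bar> / norm w + L * (5 / norm w)"
  proof (rule norm_triangle_le, rule add_mono)
    show "norm (of_real L * power_kernel \<beta> w) \<le> L * (5 / norm w)"
      unfolding norm_mult using L norm_power_kernel_le[OF \<beta> w(2,1)] by (intro mult_mono) auto
  qed (simp add: norm_divide norm_mult)
  also have "\<dots> = (\<bar>s\<bar> + 5 * L) / norm w" by (simp add: add_divide_distrib)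
  finally show 1: "norm (model_map \<beta> s Y A L z - z + of_real A / (z + \<i> * of_real Y)) \<le> (\<bar>s\<bar> + 5 * L) / norm (z + \<i> * of_real Y)"
    unfolding m[symmetric] by (simp add: w_def)
  have "norm (model_map \<beta> s Y A L z - z) \<le> norm (model_map \<beta> s Y A L z - z + of_real A / w) + norm (of_real A / w)"
    using norm_triangle_ineq4[of "model_map \<beta> s Y A L z - z + of_real A / w" "of_real A / w"] by simp
  also have "norm (of_real A / w) = A / norm w" using A by (simp add: norm_divide)
  finally show "norm (model_map \<beta> s Y A L z - z) \<le> (\<bar>s\<bar> + 5 * L + A) / norm (z + \<i> * of_real Y)"
    using 1 by (simp add: w_def add_divide_distrib)
qed

lemma Im_model_map_ge:
  assumes \<beta>: "1 < \<beta>" "\<beta> < 2" and L: "0 \<le> L" and z: "- Y < Im z" "1 \<le> norm (z + \<i> * of_real Y)"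
  shows "Im z + s * Re (1 / (z + \<i> * of_real Y)) + A * (Im z + Y) / (norm (z + \<i> * of_real Y))\<^sup>2
      + L * (- cos (\<beta> * pi / 2) * norm (z + \<i> * of_real Y) powr (- \<beta>)) \<le> Im (model_map \<beta> s Y A L z)"
proof -
  define w where "w = z + \<i> * of_real Y"
  have w: "0 < Im w" "1 \<le> norm w" "Im w = Im z + Y" using z by (auto simp: w_def)
  have "L * (- cos (\<beta> * pi / 2) * norm w powr (- \<beta>)) \<le> L * Im (power_kernel \<beta> w)"
    using Im_power_kernel_ge[OF \<beta> w(1,2)] L by (intro mult_left_mono) auto
  moreover have "Im ((\<i> * of_real s - of_real A) / w) = s * Re (1 / w) + A * Im w / (norm w)\<^sup>2"
  proof -
    have "(\<i> * of_real s - of_real A) / w = \<i> * (of_real s * (1 / w)) + of_real A * (- 1 / w)"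
      by (simp add: diff_divide_distrib)
    moreover have "Im (- 1 / w) = Im w / (norm w)\<^sup>2" by (simp add: Im_divide cmod_power2)
    moreover have "Im (\<i> * (of_real s * u) + of_real A * v) = s * Re u + A * Im v" for u v by simp
    ultimately show ?thesis by (metis times_divide_eq_right)
  qed
  ultimately show ?thesis unfolding model_map_def w_def[symmetric] w(3)[symmetric] by simp
qed

text \<open>
  With \<open>A = Y\<^sup>2\<close> the image avoids a disk of radius proportional to \<open>Y\<close> about the origin, and the gain
  \<open>Y\<^sup>3 / \<bar>z + \<i>Y\<bar>\<^sup>2\<close> in the imaginary part exceeds the error, of order \<open>Y / \<bar>z + \<i>Y\<bar>\<^sup>2\<close>, made in replacing
  \<open>1 / (z + \<i>Y)\<close> by \<open>1 / f z\<close>.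
\<close>

lemma inner_model_map:
  fixes c K R \<beta> :: real
  assumes \<beta>: "1 < \<beta>" "\<beta> < 2" and K: "0 \<le> K"
  obtains f C where "f holomorphic_on upper_half_plane"
    "\<And>z. 0 < Im z \<Longrightarrow> R < norm (f z)"
    "\<And>z. 0 < Im z \<Longrightarrow> - c * Re (1 / f z) + K * norm (f z) powr (- \<beta>) < Im (f z)"
    "\<And>z. 0 < Im z \<Longrightarrow> norm (f z - z) \<le> C / Im z"
proof -
  define c0 where "c0 = - cos (\<beta> * pi / 2)"
  have c0: "0 < c0" unfolding c0_def by (rule neg_cos_half_pi_pos[OF \<beta>])
  define L where "L = 128\<^sup>2 * K / c0"
  have L: "0 \<le> L" using K c0 by (simp add: L_def)
  define B where "B = \<bar>c\<bar> + 5 * L"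
  have B: "0 \<le> B" using L by (simp add: B_def)
  define Y where "Y = 1 + 128 * \<bar>R\<bar> + 384 * B"
  have Y: "1 \<le> Y" "128 * \<bar>R\<bar> < Y" "384 * B < Y" using B by (auto simp: Y_def)
  define f where "f = model_map \<beta> (- c) Y (Y\<^sup>2) L"
  show thesis
  proof (rule that[of f "B + Y\<^sup>2"])
    show "f holomorphic_on upper_half_plane" unfolding f_def
      by (rule holomorphic_on_subset[OF model_map_holomorphic]) (use Y in auto)
    fix z assume z: "0 < Im z"
    define w where "w = z + \<i> * of_real Y"
    define N where "N = norm w"
    have Imw: "Im w = Im z + Y" by (simp add: w_def)
    have N: "Im z + Y \<le> N" using abs_Im_le_cmod[of w] z Y Imw unfolding N_def by linarith
    then have N1: "1 \<le> N" "Y \<le> N" "Im z \<le> N" using z Y by linarith+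
    have zY: "- Y < Im z" using z Y by simp
    have w1: "1 \<le> norm (z + \<i> * of_real Y)" using N1(1) by (simp add: N_def w_def)
    have up: "norm (f z - z + of_real (Y\<^sup>2) / w) \<le> B / N"
      using norm_model_map_diff(1)[OF \<beta>(1) L _ zY w1, of "Y\<^sup>2" "- c"] by (simp add: f_def w_def N_def B_def)
    have "norm (f z - z) \<le> (B + Y\<^sup>2) / N"
      using norm_model_map_diff(2)[OF \<beta>(1) L _ zY w1, of "Y\<^sup>2" "- c"] by (simp add: f_def w_def N_def B_def)
    also have "\<dots> \<le> (B + Y\<^sup>2) / Im z" using N1 z B by (intro divide_left_mono) auto
    finally show "norm (f z - z) \<le> (B + Y\<^sup>2) / Im z" .
    have Imf: "Im z - c * Re (1 / w) + Y\<^sup>2 * (Im z + Y) / N\<^sup>2 + L * (c0 * N powr (- \<beta>)) \<le> Im (f z)"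
      using Im_model_map_ge[OF \<beta> L zY w1, of "- c" "Y\<^sup>2"] by (simp add: f_def w_def N_def c0_def)
    have Y3: "Y ^ 3 / N\<^sup>2 \<le> Y\<^sup>2 * (Im z + Y) / N\<^sup>2"
      using z Y by (intro divide_right_mono) (auto simp: power2_eq_square power3_eq_cube mult_left_mono)
    have BN: "B / N \<le> N / 384"
    proof -
      have "384 * B \<le> N * 1" using Y N1 by simp
      also have "\<dots> \<le> N * N" using N1 by (intro mult_left_mono) auto
      finally show ?thesis using N1 by (simp add: field_simps)
    qed
    \<comment> \<open>for large \<open>N\<close> the map is a small perturbation of \<open>w\<close>; for the other \<open>N\<close> its imaginary part is at least of order \<open>Y\<close>\<close>
    have low: "N / 128 \<le> norm (f z)"
    proof (cases "4 * Y \<le> N")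
      case True
      have "N = norm ((f z + \<i> * of_real Y + of_real (Y\<^sup>2) / w) - (f z - z + of_real (Y\<^sup>2) / w))"
        by (simp add: N_def w_def add.commute)
      also have "\<dots> \<le> norm (f z + \<i> * of_real Y + of_real (Y\<^sup>2) / w) + B / N"
        using norm_triangle_ineq4 up by (rule order_trans[OF _ add_left_mono])
      also have "norm (f z + \<i> * of_real Y + of_real (Y\<^sup>2) / w) \<le> norm (f z) + Y + Y\<^sup>2 / N"
        by (intro norm_triangle_le add_mono) (use Y in \<open>auto simp: norm_mult norm_divide N_def norm_power\<close>)
      also have "Y\<^sup>2 / N \<le> N / 16"
      proof -
        have "(4 * Y)\<^sup>2 \<le> N\<^sup>2" using True Y by (intro power_mono) auto
        then show ?thesis using N1 by (simp add: field_simps power2_eq_square)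
      qed
      finally have "N \<le> norm (f z) + Y + N / 16 + B / N" by simp
      then show ?thesis using True BN N1 by linarith
    next
      case False
      have "- c * Re (1 / w) \<ge> - (B / N)"
      proof -
        have "\<bar>c * Re (1 / w)\<bar> \<le> B * (1 / N)"
          unfolding abs_mult using abs_Re_le_cmod[of "1 / w"] L
          by (intro mult_mono) (auto simp: B_def N_def norm_divide)
        then show ?thesis by simp
      qed
      moreover have "0 \<le> L * (c0 * N powr (- \<beta>))" using L c0 by simp
      ultimately have I: "Y ^ 3 / N\<^sup>2 - B / N \<le> Im (f z)" using Imf Y3 z by linarith
      have "Y / 16 \<le> Y ^ 3 / N\<^sup>2"
      proof -
        have "N\<^sup>2 \<le> (4 * Y)\<^sup>2" using False N1 by (intro power_mono) auto
        then have "Y * N\<^sup>2 \<le> Y * (4 * Y)\<^sup>2" using Y by (intro mult_left_mono) auto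
        then show ?thesis using N1 by (simp add: field_simps power2_eq_square power3_eq_cube)
      qed
      moreover have "N / 64 \<le> Y / 16" using False by simp
      moreover have "Im (f z) \<le> norm (f z)" using abs_Im_le_cmod[of "f z"] by linarith
      ultimately show ?thesis using I BN N1 by linarith
    qed
    then show "R < norm (f z)" using Y N1 by linarith
    have f0: "0 < norm (f z)" using low N1 by linarith
    have K1: "K * norm (f z) powr (- \<beta>) \<le> L * (c0 * N powr (- \<beta>))"
    proof -
      have "norm (f z) powr (- \<beta>) \<le> (N / 128) powr (- \<beta>)"
        using low N1 \<beta> by (intro powr_mono2') auto
      also have "\<dots> = N powr (- \<beta>) * 128 powr \<beta>" using N1 by (simp add: powr_divide powr_minus field_simps)
      also have "\<dots> \<le> N powr (- \<beta>) * 128 powr 2" using \<beta> by (intro mult_left_mono powr_mono) auto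
      also have "(128::real) powr 2 = 128\<^sup>2" by (simp add: powr_numeral)
      finally have "K * norm (f z) powr (- \<beta>) \<le> K * (N powr (- \<beta>) * 128\<^sup>2)" using K by (intro mult_left_mono)
      then show ?thesis using c0 by (simp add: L_def mult_ac)
    qed
    have inv: "\<bar>c * Re (1 / w) - c * Re (1 / f z)\<bar> < Y ^ 3 / N\<^sup>2"
    proof -
      have w0: "w \<noteq> 0" "f z \<noteq> 0" using N1 f0 by (auto simp: N_def)
      have d: "1 / w - 1 / f z = (f z - w) / (w * f z)" using w0 by (simp add: field_simps)
      have "norm (f z - w) = norm ((f z - z + of_real (Y\<^sup>2) / w) - (\<i> * of_real Y + of_real (Y\<^sup>2) / w))"
        by (simp add: w_def diff_diff_eq)
      also have "\<dots> \<le> B / N + (Y + Y\<^sup>2 / N)"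
        by (rule order_trans[OF norm_triangle_ineq4 add_mono[OF up]], rule norm_triangle_le)
           (use Y in \<open>auto simp: norm_mult norm_divide N_def norm_power\<close>)
      also have "B / N \<le> Y"
      proof -
        have "B / N \<le> B / 1" using B N1 by (intro divide_left_mono) auto
        then show ?thesis using Y B by linarith
      qed
      also have "Y\<^sup>2 / N \<le> Y" using N1 Y by (simp add: field_simps power2_eq_square mult_right_mono)
      finally have n3: "norm (f z - w) \<le> 3 * Y" by simp
      have "\<bar>Re (1 / w) - Re (1 / f z)\<bar> \<le> norm (1 / w - 1 / f z)"
        using abs_Re_le_cmod[of "1 / w - 1 / f z"] by simp
      also have "\<dots> = norm (f z - w) / (N * norm (f z))" unfolding d by (simp add: norm_divide norm_mult N_def)
      also have "\<dots> \<le> 3 * Y / (N * (N / 128))"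
        using n3 low N1 f0 Y by (intro frac_le mult_left_mono) auto
      also have "\<dots> = 384 * Y / N\<^sup>2" by (simp add: power2_eq_square)
      finally have "\<bar>c * Re (1 / w) - c * Re (1 / f z)\<bar> \<le> \<bar>c\<bar> * (384 * Y / N\<^sup>2)"
        unfolding right_diff_distrib[symmetric] abs_mult by (rule mult_left_mono) simp
      also have "\<dots> < Y ^ 3 / N\<^sup>2"
      proof -
        have "\<bar>c\<bar> * 384 < Y" using Y(3) L by (simp add: B_def)
        also have "Y \<le> Y * Y" using Y by simp
        finally have "\<bar>c\<bar> * 384 * Y < Y * Y * Y" using Y by (intro mult_strict_right_mono) auto
        then have "\<bar>c\<bar> * 384 * Y / N\<^sup>2 < Y * Y * Y / N\<^sup>2" using N1 by (intro divide_strict_right_mono) auto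
        then show ?thesis by (simp add: power3_eq_cube)
      qed
      finally show ?thesis .
    qed
    show "- c * Re (1 / f z) + K * norm (f z) powr (- \<beta>) < Im (f z)"
      using Imf Y3 K1 inv z by linarith
  qed
qed

text \<open>
  The region lies above the line \<open>Im z = -S\<close>, hence well above the pole at \<open>-2\<i>S\<close>. On the bounded part the
  Poisson kernel of weight \<open>18 S\<^sup>2\<close> contributes at least \<open>2 S\<close> to the imaginary part; far away and close to the
  real axis the remaining terms cancel the bound that defines the region.
\<close>

lemma outer_model_map:
  fixes c K R \<beta> :: real
  assumes \<beta>: "1 < \<beta>" "\<beta> < 2" and K: "0 \<le> K"
  obtains g C where "g holomorphic_on {z. R < norm z \<longrightarrow> - c * Re (1 / z) - K * norm z powr (- \<beta>) \<le> Im z}"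
    "\<And>z. (R < norm z \<Longrightarrow> - c * Re (1 / z) - K * norm z powr (- \<beta>) \<le> Im z) \<Longrightarrow> 0 < Im (g z)"
    "\<And>z. 0 < Im z \<Longrightarrow> norm (g z - z) \<le> C / Im z"
proof -
  define c0 where "c0 = - cos (\<beta> * pi / 2)"
  have c0: "0 < c0" unfolding c0_def by (rule neg_cos_half_pi_pos[OF \<beta>])
  define L where "L = 9 * K / c0"
  have L: "0 \<le> L" using K c0 by (simp add: L_def)
  define S where "S = 1 + \<bar>R\<bar> + \<bar>c\<bar> + K"
  have S: "1 \<le> S" "R < S" "\<bar>c\<bar> + K < S" using K by (auto simp: S_def)
  define A where "A = 18 * S\<^sup>2"
  define g where "g = model_map \<beta> c (2 * S) A L"
  have A: "0 \<le> A" by (simp add: A_def)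
  have large: "- 1 < Im z" if z: "S < norm z" "- c * Re (1 / z) - K * norm z powr (- \<beta>) \<le> Im z" for z
  proof -
    have n1: "1 < norm z" using z S by linarith
    have "\<bar>c * Re (1 / z)\<bar> \<le> \<bar>c\<bar> * (1 / norm z)"
      unfolding abs_mult using abs_Re_le_cmod[of "1 / z"] by (intro mult_left_mono) (auto simp: norm_divide)
    moreover have "K * norm z powr (- \<beta>) \<le> K * (1 / norm z)"
    proof -
      have "norm z powr (- \<beta>) \<le> norm z powr (- 1)" using n1 \<beta> by (intro powr_mono) auto
      then show ?thesis using K n1 by (intro mult_left_mono) (auto simp: powr_minus_divide)
    qed
    moreover have "\<bar>c\<bar> * (1 / norm z) + K * (1 / norm z) < 1"
    proof -
      have "\<bar>c\<bar> + K < norm z" using S z by linarith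
      then have "(\<bar>c\<bar> + K) / norm z < 1" using n1 by (subst divide_less_eq_1_pos) linarith+
      then show ?thesis by (simp add: add_divide_distrib)
    qed
    ultimately show ?thesis using z(2) by linarith
  qed
  have gen: "- S \<le> Im z" if z: "R < norm z \<Longrightarrow> - c * Re (1 / z) - K * norm z powr (- \<beta>) \<le> Im z" for z
  proof (cases "S < norm z")
    case True
    then show ?thesis using large[OF True] z S by linarith
  next
    case False
    then show ?thesis using abs_Im_le_cmod[of z] by linarith
  qed
  show thesis
  proof (rule that[of g "\<bar>c\<bar> + 5 * L + A"])
    show "g holomorphic_on {z. R < norm z \<longrightarrow> - c * Re (1 / z) - K * norm z powr (- \<beta>) \<le> Im z}"
      unfolding g_def
    proof (rule holomorphic_on_subset[OF model_map_holomorphic], rule subsetI)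
      fix z assume "z \<in> {z. R < norm z \<longrightarrow> - c * Re (1 / z) - K * norm z powr (- \<beta>) \<le> Im z}"
      then have "- S \<le> Im z" using gen by blast
      then show "z \<in> {z. - (2 * S) < Im z}" using S by simp
    qed
  next
    fix z assume z: "R < norm z \<Longrightarrow> - c * Re (1 / z) - K * norm z powr (- \<beta>) \<le> Im z"
    define w where "w = z + \<i> * of_real (2 * S)"
    define N where "N = norm w"
    have ImS: "- S \<le> Im z" by (rule gen[OF z])
    have Imw: "Im w = Im z + 2 * S" by (simp add: w_def)
    have N: "S \<le> N" "Im w \<le> N" using abs_Im_le_cmod[of w] ImS Imw unfolding N_def by linarith+
    have N1: "1 \<le> N" using N S by linarith
    have zY: "- (2 * S) < Im z" using ImS S by linarith
    have w1: "1 \<le> norm (z + \<i> * of_real (2 * S))" using N1 by (simp add: N_def w_def)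
    have Img: "Im z + c * Re (1 / w) + A * (Im z + 2 * S) / N\<^sup>2 + L * (c0 * N powr (- \<beta>)) \<le> Im (g z)"
      using Im_model_map_ge[OF \<beta> L zY w1, of c A] by (simp add: g_def w_def N_def c0_def)
    have A18: "18 * S ^ 3 / N\<^sup>2 \<le> A * (Im z + 2 * S) / N\<^sup>2"
    proof (intro divide_right_mono)
      have "A * S \<le> A * (Im z + 2 * S)" using ImS A by (intro mult_left_mono) auto
      then show "18 * S ^ 3 \<le> A * (Im z + 2 * S)" by (simp add: A_def power2_eq_square power3_eq_cube)
    qed simp
    have Lpos: "0 \<le> L * (c0 * N powr (- \<beta>))" using L c0 by simp
    have cw: "\<bar>c * Re (1 / w)\<bar> \<le> \<bar>c\<bar> / N"
      using mult_left_mono[OF abs_Re_le_cmod[of "1 / w"], of "\<bar>c\<bar>"] by (simp add: abs_mult norm_divide N_def)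
    have cw1: "\<bar>c * Re (1 / w)\<bar> < 1"
    proof -
      have "\<bar>c\<bar> < N" using N S K by linarith
      then have "\<bar>c\<bar> / N < 1" using N1 by simp
      then show ?thesis using cw by linarith
    qed
    have wz: "N \<le> norm z + 2 * S" unfolding N_def w_def
      using norm_triangle_ineq[of z "\<i> * of_real (2 * S)"] S by (simp add: norm_mult)
    consider "norm z \<le> S" | "S < norm z" "1 \<le> Im z" | "S < norm z" "Im z < 1" by linarith
    then show "0 < Im (g z)"
    proof cases
      case 1
      have "2 * S \<le> 18 * S ^ 3 / N\<^sup>2"
      proof -
        have "N\<^sup>2 \<le> (3 * S)\<^sup>2" using wz 1 N1 by (intro power_mono) auto
        then have "2 * S * N\<^sup>2 \<le> 2 * S * (3 * S)\<^sup>2" using S by (intro mult_left_mono) auto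
        then show ?thesis using N1 by (simp add: field_simps power2_eq_square power3_eq_cube)
      qed
      then show ?thesis using Img A18 Lpos cw1 ImS S by linarith
    next
      case 2
      have "0 \<le> 18 * S ^ 3 / N\<^sup>2" using S by simp
      then show ?thesis using Img A18 Lpos cw1 2 by linarith
    next
      case 3
      have lb: "- c * Re (1 / z) - K * norm z powr (- \<beta>) \<le> Im z" using z 3 S by linarith
      have Im1: "- 1 < Im z" by (rule large[OF 3(1) lb])
      have nz1: "1 < norm z" using 3 S by linarith
      have zN: "norm z \<le> N"
      proof -
        have "(norm w)\<^sup>2 = (norm z)\<^sup>2 + 4 * S * (Im z + S)"
          unfolding cmod_power2 w_def by (simp add: power2_eq_square algebra_simps)
        moreover have "0 \<le> 4 * S * (Im z + S)" using Im1 S by (intro mult_nonneg_nonneg) auto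
        ultimately have "(norm z)\<^sup>2 \<le> (norm w)\<^sup>2" by linarith
        then show ?thesis unfolding N_def by (rule power2_le_imp_le) simp
      qed
      have Nz: "N / 3 \<le> norm z" using wz 3 by linarith
      have K9: "K * norm z powr (- \<beta>) \<le> L * (c0 * N powr (- \<beta>))"
      proof -
        have "norm z powr (- \<beta>) \<le> (N / 3) powr (- \<beta>)" using Nz N1 \<beta> by (intro powr_mono2') auto
        also have "\<dots> = N powr (- \<beta>) * 3 powr \<beta>" using N1 by (simp add: powr_divide powr_minus field_simps)
        also have "\<dots> \<le> N powr (- \<beta>) * 3 powr 2" using \<beta> by (intro mult_left_mono powr_mono) auto
        also have "(3::real) powr 2 = 9" by (simp add: powr_numeral)
        finally have "K * norm z powr (- \<beta>) \<le> K * (N powr (- \<beta>) * 9)" using K by (intro mult_left_mono)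
        then show ?thesis using c0 by (simp add: L_def mult_ac)
      qed
      have inv: "\<bar>c * Re (1 / w) - c * Re (1 / z)\<bar> \<le> 6 * S * S / N\<^sup>2"
      proof -
        have w0: "w \<noteq> 0" "z \<noteq> 0" using N1 nz1 by (auto simp: N_def)
        have d: "1 / w - 1 / z = - (\<i> * of_real (2 * S)) / (w * z)" using w0 by (simp add: w_def field_simps)
        have "\<bar>Re (1 / w) - Re (1 / z)\<bar> \<le> norm (1 / w - 1 / z)"
          using abs_Re_le_cmod[of "1 / w - 1 / z"] by simp
        also have "\<dots> = 2 * S / (N * norm z)" unfolding d using S by (simp add: norm_divide norm_mult N_def)
        also have "\<dots> \<le> 2 * S / (N * (N / 3))"
          using Nz N1 S w0 by (intro divide_left_mono mult_left_mono mult_pos_pos) auto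
        also have "\<dots> = 6 * S / N\<^sup>2" by (simp add: power2_eq_square)
        finally have "\<bar>c * Re (1 / w) - c * Re (1 / z)\<bar> \<le> \<bar>c\<bar> * (6 * S / N\<^sup>2)"
          unfolding right_diff_distrib[symmetric] abs_mult by (rule mult_left_mono) simp
        also have "\<dots> \<le> S * (6 * S / N\<^sup>2)" using S K by (intro mult_right_mono) auto
        finally show ?thesis by (simp add: mult_ac)
      qed
      moreover have "6 * S * S / N\<^sup>2 < 18 * S ^ 3 / N\<^sup>2"
      proof (intro divide_strict_right_mono)
        have "6 * (S * S) < 18 * (S * S)" using S by simp
        also have "\<dots> \<le> 18 * (S * S * S)" using S by simp
        finally show "6 * S * S < 18 * S ^ 3" by (simp add: power3_eq_cube mult.assoc)
      qed (use N1 in simp)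
      ultimately show ?thesis using Img A18 K9 lb by linarith
    qed
  next
    fix z :: complex assume z: "0 < Im z"
    have zY: "- (2 * S) < Im z" using z S by simp
    have le: "Im z + 2 * S \<le> norm (z + \<i> * of_real (2 * S))"
      using abs_Im_le_cmod[of "z + \<i> * of_real (2 * S)"] by simp
    then have w1: "1 \<le> norm (z + \<i> * of_real (2 * S))" using z S by linarith
    have "norm (g z - z) \<le> (\<bar>c\<bar> + 5 * L + A) / norm (z + \<i> * of_real (2 * S))"
      unfolding g_def by (rule norm_model_map_diff(2)[OF \<beta>(1) L A zY w1])
    also have "\<dots> \<le> (\<bar>c\<bar> + 5 * L + A) / Im z"
    proof (rule divide_left_mono)
      show "Im z \<le> norm (z + \<i> * of_real (2 * S))" using le S by linarith
      show "0 < norm (z + \<i> * of_real (2 * S)) * Im z" using w1 z by (intro mult_pos_pos) linarith+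
    qed (use L A in simp)
    finally show "norm (g z - z) \<le> (\<bar>c\<bar> + 5 * L + A) / Im z" .
  qed
qed

section \<open>Moebius transformations of the Riemann sphere\<close>

text \<open>
  Composition corresponds to the product of coefficient matrices, also at the poles.
\<close>

lemma moebius_ext_compose:
  assumes "a * d - b * c \<noteq> 0" "a' * d' - b' * c' \<noteq> 0"
  shows "moebius_ext a b c d (moebius_ext a' b' c' d' x) =
    moebius_ext (a * a' + b * c') (a * b' + b * d') (c * a' + d * c') (c * b' + d * d') x"
proof (cases x)
  case None
  show ?thesis
  proof (cases "c' = 0")
    case True
    then have "a' \<noteq> 0" using assms(2) by auto
    then show ?thesis using None True by (auto simp: moebius_ext_def)
  next
    case False
    have "c * (a' / c') + d = (c * a' + d * c') / c'" "a * (a' / c') + b = (a * a' + b * c') / c'"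
      using False by (simp_all add: field_simps)
    then show ?thesis using None False by (simp add: moebius_ext_def moebius_def)
  qed
next
  case (Some z)
  define u v where "u = a' * z + b'" and "v = c' * z + d'"
  have e: "(a * a' + b * c') * z + (a * b' + b * d') = a * u + b * v"
    "(c * a' + d * c') * z + (c * b' + d * d') = c * u + d * v"
    by (simp_all add: u_def v_def algebra_simps)
  show ?thesis
  proof (cases "v = 0")
    case True
    have "u \<noteq> 0"
    proof
      assume "u = 0"
      then have "(a' * d' - b' * c') * z = 0" "a' * d' - b' * c' = 0 \<or> z \<noteq> 0 \<or> True"
        using True by (simp_all add: u_def v_def) algebra
      moreover have "a' * d' - b' * c' = a' * v - c' * u" by (simp add: u_def v_def algebra_simps)
      ultimately show False using True \<open>u = 0\<close> assms(2) by simp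
    qed
    then show ?thesis using Some True e by (simp add: moebius_ext_def moebius_def u_def[symmetric] v_def[symmetric])
  next
    case False
    have "c * (u / v) + d = (c * u + d * v) / v" "a * (u / v) + b = (a * u + b * v) / v"
      using False by (simp_all add: field_simps)
    then show ?thesis using Some False e
      by (simp add: moebius_ext_def moebius_def u_def[symmetric] v_def[symmetric])
  qed
qed

lemma moebius_ext_scale:
  assumes "k \<noteq> 0" shows "moebius_ext (k * a) (k * b) (k * c) (k * d) = moebius_ext a b c d"
proof (rule ext)
  fix x
  have "k * a * z + k * b = k * (a * z + b)" "k * c * z + k * d = k * (c * z + d)" for z
    by (simp_all add: algebra_simps)
  then show "moebius_ext (k * a) (k * b) (k * c) (k * d) x = moebius_ext a b c d x"
    using assms by (cases x) (simp_all add: moebius_ext_def moebius_def)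
qed

lemma moebius_ext_id: "moebius_ext 1 0 0 1 x = x"
  by (cases x) (auto simp: moebius_ext_def moebius_def)

lemma moebius_ext_inverse:
  assumes "a * d - b * c \<noteq> 0"
  shows "moebius_ext d (- b) (- c) a (moebius_ext a b c d x) = x"
    "moebius_ext a b c d (moebius_ext d (- b) (- c) a x) = x"
proof -
  define D where "D = a * d - b * c"
  have "moebius_ext d (- b) (- c) a (moebius_ext a b c d x) = moebius_ext (D * 1) (D * 0) (D * 0) (D * 1) x"
    by (subst moebius_ext_compose) (use assms in \<open>simp_all add: D_def algebra_simps\<close>)
  also have "\<dots> = x" using assms by (subst moebius_ext_scale) (simp_all add: D_def moebius_ext_id)
  finally show "moebius_ext d (- b) (- c) a (moebius_ext a b c d x) = x" .
  have "moebius_ext a b c d (moebius_ext d (- b) (- c) a x) = moebius_ext (D * 1) (D * 0) (D * 0) (D * 1) x"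
    by (subst moebius_ext_compose) (use assms in \<open>simp_all add: D_def algebra_simps\<close>)
  also have "\<dots> = x" using assms by (subst moebius_ext_scale) (simp_all add: D_def moebius_ext_id)
  finally show "moebius_ext a b c d (moebius_ext d (- b) (- c) a x) = x" .
qed

lemma moebius_transformation_compose:
  assumes "moebius_transformation S" "moebius_transformation T"
  shows "moebius_transformation (\<lambda>x. S (T x))"
proof -
  obtain a b c d where S: "a * d - b * c \<noteq> 0" "S = moebius_ext a b c d"
    using assms(1) by (auto simp: moebius_transformation_def)
  obtain a' b' c' d' where T: "a' * d' - b' * c' \<noteq> 0" "T = moebius_ext a' b' c' d'"
    using assms(2) by (auto simp: moebius_transformation_def)
  have "(a * a' + b * c') * (c * b' + d * d') - (a * b' + b * d') * (c * a' + d * c')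
      = (a * d - b * c) * (a' * d' - b' * c')" by (simp add: algebra_simps)
  then have "(a * a' + b * c') * (c * b' + d * d') - (a * b' + b * d') * (c * a' + d * c') \<noteq> 0"
    using S(1) T(1) by simp
  then show ?thesis unfolding moebius_transformation_def S(2) T(2)
    using moebius_ext_compose[OF S(1) T(1)] by blast
qed

lemma moebius_transformation_inverse:
  assumes "moebius_transformation T"
  obtains T' where "moebius_transformation T'" "\<And>x. T' (T x) = x" "\<And>x. T (T' x) = x"
proof -
  obtain a b c d where T: "a * d - b * c \<noteq> 0" "T = moebius_ext a b c d"
    using assms by (auto simp: moebius_transformation_def)
  show thesis
  proof (rule that[of "moebius_ext d (- b) (- c) a"])
    show "moebius_transformation (moebius_ext d (- b) (- c) a)"
      unfolding moebius_transformation_def using T(1)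
      by (intro exI[of _ d] exI[of _ "- b"] exI[of _ "- c"] exI[of _ a]) (simp add: mult.commute)
  qed (use moebius_ext_inverse[OF T(1)] T(2) in auto)
qed

lemma moebius_transformation_eq_iff:
  "moebius_transformation T \<Longrightarrow> T x = T y \<longleftrightarrow> x = y"
  by (metis moebius_transformation_inverse)

text \<open>
  Away from the pole this is continuity of a rational function. The preimage of a compact set
  bounded by \<open>R\<close> is contained in \<open>{z. \<bar>a z + b\<bar> \<le> R \<bar>c z + d\<bar>}\<close>, a closed set without the pole, which
  gives continuity at the pole.
\<close>

lemma continuous_map_moebius:
  assumes "moebius_transformation M"
  shows "continuous_map euclidean Riemann_sphere (\<lambda>z. M (Some z))"
proof -
  obtain a b c d where M: "a * d - b * c \<noteq> 0" "M = moebius_ext a b c d"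
    using assms by (auto simp: moebius_transformation_def)
  define m where "m = (\<lambda>z. (a * z + b) / (c * z + d))"
  have Meq: "M (Some z) = (if c * z + d = 0 then None else Some (m z))" for z
    by (simp add: M(2) moebius_ext_def moebius_def m_def)
  have op: "open {z. c * z + d \<noteq> 0}" by (intro open_Collect_neq continuous_intros)
  have cont: "continuous_on {z. c * z + d \<noteq> 0} m" unfolding m_def by (intro continuous_intros) auto
  have pre: "open {z. M (Some z) \<in> S}" if S: "openin Riemann_sphere S" for S
  proof -
    from S consider U where "open U" "S = Some ` U" |
      C where "compact C" "S = insert None (Some ` (UNIV - C))"
      by (auto simp: openin_Alexandroff_compactification)
    then show ?thesis
    proof cases
      case 1
      have "{z. M (Some z) \<in> S} = {z. c * z + d \<noteq> 0} \<inter> m -` U" by (auto simp: Meq 1)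
      then show ?thesis using continuous_open_preimage[OF cont op 1(1)] by simp
    next
      case 2
      obtain R where R: "\<And>w. w \<in> C \<Longrightarrow> norm w \<le> R"
        using compact_imp_bounded[OF 2(1)] by (auto simp: bounded_iff)
      define A where "A = {z. norm (a * z + b) \<le> R * norm (c * z + d)}"
      have clA: "closed A" unfolding A_def by (intro closed_Collect_le continuous_intros)
      have An: "c * z + d \<noteq> 0" if "z \<in> A" for z
      proof
        assume z: "c * z + d = 0"
        then have "a * z + b = 0" using that by (simp add: A_def)
        moreover have "a * d - b * c = a * (c * z + d) - c * (a * z + b)" by (simp add: algebra_simps)
        ultimately show False using z M(1) by simp
      qed
      have "A \<inter> m -` C = - {z. M (Some z) \<in> S}"
      proof -
        have "z \<in> A" if "c * z + d \<noteq> 0" "m z \<in> C" for z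
          using R[OF that(2)] that(1) by (simp add: A_def m_def norm_divide field_simps)
        then show ?thesis using An by (auto simp: Meq 2)
      qed
      moreover have "closed (A \<inter> m -` C)"
        by (rule continuous_closed_preimage[OF continuous_on_subset[OF cont] clA])
           (use An 2(1) compact_imp_closed in auto)
      ultimately show ?thesis by (simp add: open_closed)
    qed
  qed
  show ?thesis unfolding continuous_map_def using pre by (auto simp: image_iff)
qed

lemma moebius_transformation_finite:
  assumes "moebius_transformation M" "M (Some q) = Some r"
  obtains a b c d where "a * d - b * c \<noteq> 0" "c * q + d \<noteq> 0" "r = (a * q + b) / (c * q + d)"
    "\<And>z. c * z + d \<noteq> 0 \<Longrightarrow> M (Some z) = Some ((a * z + b) / (c * z + d))"
    "\<And>z. c * z + d = 0 \<Longrightarrow> M (Some z) = None"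
  using assms by (auto simp: moebius_transformation_def moebius_ext_def moebius_def split: if_splits)

section \<open>The two sides of a Jordan curve that is locally a graph\<close>

definition above :: "real \<Rightarrow> complex set \<Rightarrow> complex set" where
  "above \<eta> Y = {w. \<bar>Re w\<bar> < \<eta> \<and> \<bar>Im w\<bar> < \<eta> \<and> (\<forall>y\<in>Y. Re y = Re w \<longrightarrow> Im y < Im w)}"

definition below :: "real \<Rightarrow> complex set \<Rightarrow> complex set" where
  "below \<eta> Y = {w. \<bar>Re w\<bar> < \<eta> \<and> \<bar>Im w\<bar> < \<eta> \<and> (\<forall>y\<in>Y. Re y = Re w \<longrightarrow> Im w < Im y)}"

lemma below_eq_cnj_above: "below \<eta> Y = cnj ` above \<eta> (cnj ` Y)"
proof (intro equalityI subsetI)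
  fix w assume "w \<in> below \<eta> Y"
  then have "cnj w \<in> above \<eta> (cnj ` Y)" by (auto simp: above_def below_def)
  then show "w \<in> cnj ` above \<eta> (cnj ` Y)" by (metis complex_cnj_cnj imageI)
qed (auto simp: above_def below_def)

text \<open>
  Every point of the set can be moved up to the height \<open>3 \<eta> / 4\<close>, which is above the curve, and then
  horizontally.
\<close>

lemma connected_above:
  assumes Y: "\<And>y. y \<in> Y \<Longrightarrow> \<bar>Im y\<bar> < \<eta> / 2"
  shows "connected (above \<eta> Y)"
proof -
  define a where "a = Complex 0 (3 / 4 * \<eta>)"
  have seg: "connected_component (above \<eta> Y) v w" if "closed_segment v w \<subseteq> above \<eta> Y" for v w
    unfolding connected_component_def using that by (intro exI[of _ "closed_segment v w"]) auto
  have "connected_component (above \<eta> Y) w a" if w: "w \<in> above \<eta> Y" for w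
  proof -
    have wB: "\<bar>Re w\<bar> < \<eta>" "\<bar>Im w\<bar> < \<eta>" "\<And>y. y \<in> Y \<Longrightarrow> Re y = Re w \<Longrightarrow> Im y < Im w"
      using w by (auto simp: above_def)
    define b where "b = Complex (Re w) (3 / 4 * \<eta>)"
    have 1: "closed_segment w b \<subseteq> above \<eta> Y"
    proof
      fix v assume "v \<in> closed_segment w b"
      then obtain u where u: "0 \<le> u" "u \<le> 1" "v = (1 - u) *\<^sub>R w + u *\<^sub>R b" by (auto simp: closed_segment_def)
      have "Re v = (1 - u) * Re w + u * Re w" using u(3) by (simp add: b_def)
      then have Rv: "Re v = Re w" by (simp add: algebra_simps)
      have Iv: "Im v = (1 - u) * Im w + u * (3 / 4 * \<eta>)" using u(3) by (simp add: b_def)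
      have lo: "min (Im w) (3 / 4 * \<eta>) \<le> Im v"
      proof -
        have "(1 - u) * min (Im w) (3 / 4 * \<eta>) + u * min (Im w) (3 / 4 * \<eta>) \<le> Im v"
          unfolding Iv using u by (intro add_mono mult_left_mono) auto
        then show ?thesis by (simp add: algebra_simps)
      qed
      have hi: "Im v \<le> max (Im w) (3 / 4 * \<eta>)"
      proof -
        have "Im v \<le> (1 - u) * max (Im w) (3 / 4 * \<eta>) + u * max (Im w) (3 / 4 * \<eta>)"
          unfolding Iv using u by (intro add_mono mult_left_mono) auto
        then show ?thesis by (simp add: algebra_simps)
      qed
      have "Im y < Im v" if "y \<in> Y" "Re y = Re v" for y
        using wB(3)[OF that(1)] that(2) Rv Y[OF that(1)] lo by linarith
      then show "v \<in> above \<eta> Y" using Rv wB lo hi by (auto simp: above_def)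
    qed
    have 2: "closed_segment b a \<subseteq> above \<eta> Y"
    proof
      fix v assume "v \<in> closed_segment b a"
      then obtain u where u: "0 \<le> u" "u \<le> 1" "v = (1 - u) *\<^sub>R b + u *\<^sub>R a" by (auto simp: closed_segment_def)
      have Rv: "Re v = (1 - u) * Re w" and "Im v = (1 - u) * (3 / 4 * \<eta>) + u * (3 / 4 * \<eta>)"
        using u(3) by (simp_all add: a_def b_def)
      moreover have "(1 - u) * k + u * k = k" for k :: real by (simp add: algebra_simps)
      ultimately have Iv: "Im v = 3 / 4 * \<eta>" by (simp only:)
      have "\<bar>Re v\<bar> \<le> 1 * \<bar>Re w\<bar>" unfolding Rv abs_mult using u by (intro mult_right_mono) auto
      moreover have "\<bar>Im v\<bar> < \<eta>" using Iv wB by linarith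
      moreover have "\<forall>y\<in>Y. Re y = Re v \<longrightarrow> Im y < Im v"
      proof (intro ballI impI)
        fix y assume "y \<in> Y"
        then show "Im y < Im v" using Y[of y] wB Iv by linarith
      qed
      ultimately show "v \<in> above \<eta> Y" using wB(1) unfolding above_def by simp
    qed
    show ?thesis using connected_component_trans[OF seg[OF 1] seg[OF 2]] .
  qed
  then show ?thesis unfolding connected_iff_connected_component
    by (meson connected_component_sym connected_component_trans)
qed

lemma connected_below:
  assumes Y: "\<And>y. y \<in> Y \<Longrightarrow> \<bar>Im y\<bar> < \<eta> / 2"
  shows "connected (below \<eta> Y)"
  unfolding below_eq_cnj_above
  by (intro connected_continuous_image continuous_intros connected_above) (use Y in auto)

text \<open>
  The map \<^term>\<open>E\<close> is a chart of the plane around a point of the Jordan curve \<^term>\<open>X\<close> in which the part \<^term>\<open>Y\<close> of the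
  curve in a square meets every vertical line at most once and stays away from the horizontal edges.
\<close>

locale local_graph =
  fixes X :: "complex set" and E :: "complex \<Rightarrow> complex" and \<eta> :: real and Y :: "complex set"
  assumes curve: "X homeomorphic sphere (0::complex) 1"
    and \<eta>: "0 < \<eta>"
    and cont: "continuous_on {w. \<bar>Re w\<bar> < \<eta> \<and> \<bar>Im w\<bar> < \<eta>} E"
    and open_image: "open (E ` {w. \<bar>Re w\<bar> < \<eta> \<and> \<bar>Im w\<bar> < \<eta>})"
    and base: "E 0 \<in> X"
    and Y_def: "Y = {w. \<bar>Re w\<bar> < \<eta> \<and> \<bar>Im w\<bar> < \<eta> \<and> E w \<in> X}"
    and flat: "\<And>y. y \<in> Y \<Longrightarrow> \<bar>Im y\<bar> < \<eta> / 2"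
    and graph: "\<And>y y'. y \<in> Y \<Longrightarrow> y' \<in> Y \<Longrightarrow> Re y = Re y' \<Longrightarrow> y = y'"
begin

lemma sides_in_complement:
  "connected (E ` above \<eta> Y)" "E ` above \<eta> Y \<subseteq> - X" "E ` above \<eta> Y \<noteq> {}"
  "connected (E ` below \<eta> Y)" "E ` below \<eta> Y \<subseteq> - X" "E ` below \<eta> Y \<noteq> {}"
proof -
  have sub: "above \<eta> Y \<subseteq> {w. \<bar>Re w\<bar> < \<eta> \<and> \<bar>Im w\<bar> < \<eta>}" "below \<eta> Y \<subseteq> {w. \<bar>Re w\<bar> < \<eta> \<and> \<bar>Im w\<bar> < \<eta>}"
    by (auto simp: above_def below_def)
  show "connected (E ` above \<eta> Y)" "connected (E ` below \<eta> Y)"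
    using connected_above[of Y \<eta>] connected_below[of Y \<eta>] flat
    by (auto intro!: connected_continuous_image continuous_on_subset[OF cont] sub)
  show "E ` above \<eta> Y \<subseteq> - X" "E ` below \<eta> Y \<subseteq> - X"
    by (auto simp: above_def below_def Y_def)
  have "Complex 0 (3 / 4 * \<eta>) \<in> above \<eta> Y" "Complex 0 (- 3 / 4 * \<eta>) \<in> below \<eta> Y"
    using \<eta> by (fastforce simp: above_def below_def dest: flat)+
  then show "E ` above \<eta> Y \<noteq> {}" "E ` below \<eta> Y \<noteq> {}" by blast+
qed

text \<open>
  The frontier of \<^term>\<open>V\<close> is the whole curve, so \<^term>\<open>V\<close> meets the square. A point of the square off the curve
  lies above or below it, and each side is connected.
\<close>

lemma component_contains_side:
  assumes V: "V \<in> components (- X)"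
  shows "E ` above \<eta> Y \<subseteq> V \<or> E ` below \<eta> Y \<subseteq> V"
proof -
  have "frontier V = X" by (rule Jordan_Brouwer_frontier[OF curve V]) simp
  then have "E 0 \<in> closure V" using base by (auto simp: frontier_def)
  moreover have "E 0 \<in> E ` {w. \<bar>Re w\<bar> < \<eta> \<and> \<bar>Im w\<bar> < \<eta>}" using \<eta> by auto
  ultimately have "V \<inter> E ` {w. \<bar>Re w\<bar> < \<eta> \<and> \<bar>Im w\<bar> < \<eta>} \<noteq> {}"
    using open_image by (metis disjoint_iff open_Int_closure_eq_empty inf_commute)
  then obtain w where w: "\<bar>Re w\<bar> < \<eta>" "\<bar>Im w\<bar> < \<eta>" "E w \<in> V" by blast
  have "E w \<notin> X" using in_components_subset[OF V] w by auto
  then have wY: "w \<notin> Y" by (simp add: Y_def)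
  have "w \<in> above \<eta> Y \<or> w \<in> below \<eta> Y"
  proof (cases "\<exists>y\<in>Y. Re y = Re w")
    case True
    then obtain y where y: "y \<in> Y" "Re y = Re w" by blast
    have "Im y \<noteq> Im w" using y wY by (metis complex_eqI)
    moreover have "y' = y" if "y' \<in> Y" "Re y' = Re w" for y' using graph that y by metis
    ultimately show ?thesis using w by (cases "Im y < Im w") (auto simp: above_def below_def)
  qed (use w in \<open>auto simp: above_def\<close>)
  then show ?thesis using components_maximal[OF V] sides_in_complement w(3) by (metis disjoint_iff image_eqI)
qed

text \<open>
  Otherwise both sides would lie in one component; every component contains one of the sides, so
  there would be only one component, against the Jordan--Brouwer separation theorem.
\<close>

lemma sides_separated:
  assumes A: "connected A" "A \<subseteq> - X" and w: "w \<in> above \<eta> Y" "E w \<in> A" and v: "v \<in> below \<eta> Y"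
  shows "E v \<notin> A"
proof
  assume vA: "E v \<in> A"
  have sub: "E ` above \<eta> Y \<subseteq> V \<and> E ` below \<eta> Y \<subseteq> V" if V: "V \<in> components (- X)" for V
  proof -
    have "A \<inter> V \<noteq> {}" using component_contains_side[OF V] w v vA by blast
    then have "A \<subseteq> V" using components_maximal[OF V A] by (simp add: inf_commute)
    then show ?thesis using components_maximal[OF V] sides_in_complement w v vA
      by (metis disjoint_iff image_eqI subsetD)
  qed
  have "V = V'" if "V \<in> components (- X)" "V' \<in> components (- X)" for V V'
    using sub[OF that(1)] sub[OF that(2)] w components_eq[OF that] by blast
  then have "connected (- X)" using connected_eq_components_subset_sing_exists by blast
  then show False using Jordan_Brouwer_separation[OF curve] by simp
qed

end

text \<open>
  The components of the complement in the sphere and in the plane differ only at the point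
  \<^term>\<open>M None\<close>. A component that contains this point contains a neighbourhood of it, which is seen in the
  coordinate \<open>1 / z\<close>.
\<close>

lemma sphere_component_contains_plane_component:
  assumes M: "moebius_transformation M" and X: "bounded X"
    and U: "U \<in> connected_components_of (subtopology Riemann_sphere (- (M ` Some ` X)))"
  obtains V where "V \<in> components (- X)" "\<And>z. z \<in> V \<Longrightarrow> M (Some z) \<in> U"
proof -
  have top: "topspace Riemann_sphere = UNIV" by auto (metis option.exhaust rangeI)
  have inj: "M x = M y \<longleftrightarrow> x = y" for x y by (rule moebius_transformation_eq_iff[OF M])
  have ext: "N (Some z) \<in> U" if N: "moebius_transformation N" and A: "connected A"
    "\<And>z. z \<in> A \<Longrightarrow> N (Some z) \<notin> M ` Some ` X" and a: "a \<in> A" "N (Some a) \<in> U" and z: "z \<in> A" for N A a z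
  proof -
    have "connectedin Riemann_sphere ((\<lambda>z. N (Some z)) ` A)"
      by (rule connectedin_continuous_map_image[OF continuous_map_moebius[OF N]]) (use A in simp)
    then have "connectedin (subtopology Riemann_sphere (- (M ` Some ` X))) ((\<lambda>z. N (Some z)) ` A)"
      using A(2) by (auto simp: connectedin_subtopology)
    then have "(\<lambda>z. N (Some z)) ` A \<subseteq> U"
      by (rule connected_components_of_maximal[OF U]) (use a in \<open>auto simp: disjnt_iff\<close>)
    then show ?thesis using z by blast
  qed
  have Usub: "U \<subseteq> - (M ` Some ` X)" using connected_components_of_subset[OF U] by auto
  have "U \<noteq> {}" using nonempty_connected_components_of[OF U] .
  then obtain x where x: "x \<in> U" by blast
  obtain M' where M': "moebius_transformation M'" "\<And>x. M' (M x) = x" "\<And>x. M (M' x) = x"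
    using moebius_transformation_inverse[OF M] by metis
  have "\<exists>z. M (Some z) \<in> U"
  proof (cases "M' x")
    case (Some z)
    then show ?thesis using x M'(3)[of x] by metis
  next
    case None
    then have xN: "x = M None" using M'(3)[of x] by simp
    obtain r where r: "0 < r" "\<And>z. z \<in> X \<Longrightarrow> norm z \<le> r" using X by (auto simp: bounded_pos)
    define \<iota> where "\<iota> = moebius_ext 0 1 1 0"
    have \<iota>: "moebius_transformation \<iota>" unfolding \<iota>_def moebius_transformation_def
      by (intro exI[of _ 0] exI[of _ 1]) auto
    have \<iota>0: "\<iota> (Some 0) = None" "\<And>z. z \<noteq> 0 \<Longrightarrow> \<iota> (Some z) = Some (1 / z)"
      by (simp_all add: \<iota>_def moebius_ext_def moebius_def)
    have "M (\<iota> (Some (of_real (1 / (2 * r))))) \<in> U"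
    proof (rule ext[OF moebius_transformation_compose[OF M \<iota>], of "ball 0 (1 / r)" 0])
      show "M (\<iota> (Some z)) \<notin> M ` Some ` X" if "z \<in> ball 0 (1 / r)" for z
      proof (cases "z = 0")
        case False
        have "norm (1 / z) > r" using that False r by (simp add: norm_divide field_simps)
        then have "1 / z \<notin> X" using r(2) by force
        then show ?thesis using \<iota>0(2)[OF False] inj by auto
      qed (use \<iota>0 inj in auto)
      show "M (\<iota> (Some 0)) \<in> U" using \<iota>0 xN x by simp
    qed (use r in \<open>auto simp: norm_divide field_simps\<close>)
    moreover have "complex_of_real (1 / (2 * r)) \<noteq> 0" using r by simp
    ultimately show ?thesis using \<iota>0(2) by metis
  qed
  then obtain z where z: "M (Some z) \<in> U" by blast
  have zX: "z \<in> - X" using z Usub by auto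
  show thesis
  proof (rule that[of "connected_component_set (- X) z"])
    show "connected_component_set (- X) z \<in> components (- X)" using zX by (auto simp: components_def)
    have sub: "connected_component_set (- X) z \<subseteq> - X" by (rule connected_component_subset)
    show "M (Some v) \<in> U" if v: "v \<in> connected_component_set (- X) z" for v
    proof (rule ext[OF M connected_connected_component, of "- X" z z])
      show "M (Some y) \<notin> M ` Some ` X" if "y \<in> connected_component_set (- X) z" for y
        using sub that inj by auto
      show "z \<in> connected_component_set (- X) z" using zX by simp
    qed (use z v in auto)
  qed
qed

section \<open>Cubic expansions of smooth curves\<close>

definition cubic :: "complex \<Rightarrow> complex \<Rightarrow> complex \<Rightarrow> complex \<Rightarrow> real \<Rightarrow> complex" where
  "cubic a0 a1 a2 a3 \<tau> = a0 + a1 * of_real \<tau> + a2 * of_real \<tau> ^ 2 + a3 * of_real \<tau> ^ 3"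

text \<open>
  A remainder of order \<open>s > 3\<close> is what a Hoelder continuous third derivative provides.
\<close>

definition jet3 :: "real \<Rightarrow> (real \<Rightarrow> complex) \<Rightarrow> complex \<Rightarrow> complex \<Rightarrow> complex \<Rightarrow> complex \<Rightarrow> bool" where
  "jet3 s f a0 a1 a2 a3 \<longleftrightarrow>
     (\<exists>B \<delta>. 0 < \<delta> \<and> 0 \<le> B \<and> (\<forall>\<tau>. \<bar>\<tau>\<bar> < \<delta> \<longrightarrow> norm (f \<tau> - cubic a0 a1 a2 a3 \<tau>) \<le> B * \<bar>\<tau>\<bar> powr s))"

lemma jet3_0: assumes "jet3 s f a0 a1 a2 a3" shows "f 0 = a0"
proof -
  obtain B \<delta> where "0 < \<delta>" "\<And>\<tau>. \<bar>\<tau>\<bar> < \<delta> \<Longrightarrow> norm (f \<tau> - cubic a0 a1 a2 a3 \<tau>) \<le> B * \<bar>\<tau>\<bar> powr s"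
    using assms by (auto simp: jet3_def)
  from this(2)[of 0] this(1) show ?thesis by (simp add: cubic_def)
qed

lemma jet3_affine:
  assumes "jet3 s f a0 a1 a2 a3"
  shows "jet3 s (\<lambda>\<tau>. k * f \<tau> + l) (k * a0 + l) (k * a1) (k * a2) (k * a3)"
proof -
  obtain B \<delta> where B: "0 < \<delta>" "0 \<le> B" "\<And>\<tau>. \<bar>\<tau>\<bar> < \<delta> \<Longrightarrow> norm (f \<tau> - cubic a0 a1 a2 a3 \<tau>) \<le> B * \<bar>\<tau>\<bar> powr s"
    using assms by (auto simp: jet3_def)
  have "k * f \<tau> + l - cubic (k * a0 + l) (k * a1) (k * a2) (k * a3) \<tau> = k * (f \<tau> - cubic a0 a1 a2 a3 \<tau>)" for \<tau>
    by (simp add: cubic_def algebra_simps)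
  then have "norm (k * f \<tau> + l - cubic (k * a0 + l) (k * a1) (k * a2) (k * a3) \<tau>) \<le> (norm k * B) * \<bar>\<tau>\<bar> powr s"
    if "\<bar>\<tau>\<bar> < \<delta>" for \<tau>
    using mult_left_mono[OF B(3)[OF that], of "norm k"] by (simp add: norm_mult mult.assoc)
  then show ?thesis unfolding jet3_def using B by (intro exI[of _ "norm k * B"] exI[of _ \<delta>]) auto
qed

lemma jet3_bounded:
  assumes f: "jet3 s f a0 a1 a2 a3" and s: "3 < s"
  obtains A \<delta> where "0 < \<delta>" "0 \<le> A" "\<delta> \<le> 1" "\<And>\<tau>. \<bar>\<tau>\<bar> < \<delta> \<Longrightarrow> norm (f \<tau> - a0 - a1 * of_real \<tau> - a2 * of_real \<tau> ^ 2) \<le> A * \<bar>\<tau>\<bar> ^ 3"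
proof -
  obtain B \<delta> where B: "0 < \<delta>" "0 \<le> B" "\<And>\<tau>. \<bar>\<tau>\<bar> < \<delta> \<Longrightarrow> norm (f \<tau> - cubic a0 a1 a2 a3 \<tau>) \<le> B * \<bar>\<tau>\<bar> powr s"
    using f by (auto simp: jet3_def)
  show thesis
  proof (rule that[of "min \<delta> 1" "B + norm a3"])
    fix \<tau> assume \<tau>: "\<bar>\<tau>\<bar> < min \<delta> 1"
    have "\<bar>\<tau>\<bar> powr s \<le> \<bar>\<tau>\<bar> powr 3" using \<tau> s by (intro powr_mono') auto
    also have "\<bar>\<tau>\<bar> powr 3 = \<bar>\<tau>\<bar> ^ 3" by simp
    finally have p: "B * \<bar>\<tau>\<bar> powr s \<le> B * \<bar>\<tau>\<bar> ^ 3" using B by (intro mult_left_mono)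
    have "f \<tau> - a0 - a1 * of_real \<tau> - a2 * of_real \<tau> ^ 2 = (f \<tau> - cubic a0 a1 a2 a3 \<tau>) + a3 * of_real \<tau> ^ 3"
      by (simp add: cubic_def)
    also have "norm \<dots> \<le> B * \<bar>\<tau>\<bar> powr s + norm a3 * \<bar>\<tau>\<bar> ^ 3"
      using B(3)[of \<tau>] \<tau> by (intro norm_triangle_le add_mono) (auto simp: norm_mult norm_power)
    finally show "norm (f \<tau> - a0 - a1 * of_real \<tau> - a2 * of_real \<tau> ^ 2) \<le> (B + norm a3) * \<bar>\<tau>\<bar> ^ 3"
      using p by (simp add: distrib_right)
  qed (use B in auto)
qed

text \<open>
  The hypotheses on \<open>q0, \<dots>, q3\<close> say that the cubic polynomial with these coefficients is the quotient of the
  jets. Affine maps and quotients suffice for Moebius transformations.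
\<close>

lemma jet3_divide:
  assumes f: "jet3 s f f0 f1 f2 f3" and g: "jet3 s g g0 g1 g2 g3" and g0: "g0 \<noteq> 0" and s: "3 < s" "s \<le> 4"
    and q: "f0 = q0 * g0" "f1 = q0 * g1 + q1 * g0" "f2 = q0 * g2 + q1 * g1 + q2 * g0"
      "f3 = q0 * g3 + q1 * g2 + q2 * g1 + q3 * g0"
  shows "jet3 s (\<lambda>\<tau>. f \<tau> / g \<tau>) q0 q1 q2 q3"
proof -
  obtain B \<delta> where B: "0 < \<delta>" "0 \<le> B" "\<And>\<tau>. \<bar>\<tau>\<bar> < \<delta> \<Longrightarrow> norm (f \<tau> - cubic f0 f1 f2 f3 \<tau>) \<le> B * \<bar>\<tau>\<bar> powr s"
    using f by (auto simp: jet3_def)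
  obtain B' \<delta>' where B': "0 < \<delta>'" "0 \<le> B'" "\<And>\<tau>. \<bar>\<tau>\<bar> < \<delta>' \<Longrightarrow> norm (g \<tau> - cubic g0 g1 g2 g3 \<tau>) \<le> B' * \<bar>\<tau>\<bar> powr s"
    using g by (auto simp: jet3_def)
  obtain A \<delta>'' where A: "0 < \<delta>''" "0 \<le> A" "\<delta>'' \<le> 1"
      "\<And>\<tau>. \<bar>\<tau>\<bar> < \<delta>'' \<Longrightarrow> norm (g \<tau> - g0 - g1 * of_real \<tau> - g2 * of_real \<tau> ^ 2) \<le> A * \<bar>\<tau>\<bar> ^ 3"
    using jet3_bounded[OF g s(1)] by blast
  define G where "G = norm g1 + norm g2 + A"
  define k where "k = norm g0 / (2 * (G + 1))"
  have G: "0 \<le> G" using A by (simp add: G_def)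
  have k: "0 < k" using g0 G by (simp add: k_def)
  define Q where "Q = norm q0 + norm q1 + norm q2 + norm q3"
  define c4 c5 c6 where "c4 = q1 * g3 + q2 * g2 + q3 * g1" and "c5 = q2 * g3 + q3 * g2" and "c6 = q3 * g3"
  define d where "d = min (min \<delta> \<delta>') (min \<delta>'' k)"
  have d: "0 < d" using B B' A k by (simp add: d_def)
  have pow: "\<bar>\<tau>\<bar> ^ n \<le> \<bar>\<tau>\<bar>" if "\<bar>\<tau>\<bar> < d" "1 \<le> n" for \<tau> :: real and n
    using power_decreasing[of 1 n "\<bar>\<tau>\<bar>"] that A by (simp add: d_def)
  have glow: "norm g0 / 2 \<le> norm (g \<tau>)" if \<tau>: "\<bar>\<tau>\<bar> < d" for \<tau>
  proof -
    have "g \<tau> - g0 = (g \<tau> - g0 - g1 * of_real \<tau> - g2 * of_real \<tau> ^ 2) + (g1 * of_real \<tau> + g2 * of_real \<tau> ^ 2)" by simp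
    also have "norm \<dots> \<le> A * \<bar>\<tau>\<bar> ^ 3 + (norm g1 * \<bar>\<tau>\<bar> + norm g2 * \<bar>\<tau>\<bar> ^ 2)"
      using A(4)[of \<tau>] \<tau> by (intro norm_triangle_le add_mono) (auto simp: norm_mult norm_power d_def)
    also have "\<dots> \<le> A * \<bar>\<tau>\<bar> + (norm g1 * \<bar>\<tau>\<bar> + norm g2 * \<bar>\<tau>\<bar>)"
      using pow[OF \<tau>, of 3] pow[OF \<tau>, of 2] A by (intro add_mono mult_left_mono) auto
    also have "\<dots> = G * \<bar>\<tau>\<bar>" by (simp add: G_def algebra_simps)
    also have "\<dots> \<le> G * k" using \<tau> G by (intro mult_left_mono) (auto simp: d_def)
    also have "\<dots> \<le> norm g0 / 2" using G by (simp add: k_def field_simps)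
    finally have "norm (g \<tau> - g0) \<le> norm g0 / 2" .
    then show ?thesis using norm_triangle_ineq2[of g0 "g0 - g \<tau>"] by (simp add: norm_minus_commute)
  qed
  define E where "E = B + Q * B' + (norm c4 + norm c5 + norm c6)"
  have "norm (f \<tau> / g \<tau> - cubic q0 q1 q2 q3 \<tau>) \<le> (E * 2 / norm g0) * \<bar>\<tau>\<bar> powr s" if \<tau>: "\<bar>\<tau>\<bar> < d" for \<tau>
  proof -
    define t where "t = complex_of_real \<tau>"
    have t1: "\<bar>\<tau>\<bar> \<le> 1" using \<tau> A by (simp add: d_def)
    have gn: "g \<tau> \<noteq> 0" using glow[OF \<tau>] g0 by auto
    have pd: "cubic f0 f1 f2 f3 \<tau> - cubic q0 q1 q2 q3 \<tau> * cubic g0 g1 g2 g3 \<tau> = - (t ^ 4 * (c4 + c5 * t + c6 * t ^ 2))"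
      unfolding cubic_def t_def[symmetric] q c4_def c5_def c6_def
      by (simp add: algebra_simps eval_nat_numeral)
    have "f \<tau> - cubic q0 q1 q2 q3 \<tau> * g \<tau> = (f \<tau> - cubic f0 f1 f2 f3 \<tau>)
        - cubic q0 q1 q2 q3 \<tau> * (g \<tau> - cubic g0 g1 g2 g3 \<tau>) - t ^ 4 * (c4 + c5 * t + c6 * t ^ 2)"
      using pd by (simp add: algebra_simps)
    also have "norm \<dots> \<le> B * \<bar>\<tau>\<bar> powr s + Q * (B' * \<bar>\<tau>\<bar> powr s) + \<bar>\<tau>\<bar> powr s * (norm c4 + norm c5 + norm c6)"
    proof (rule order_trans[OF norm_triangle_ineq4 add_mono[OF order_trans[OF norm_triangle_ineq4 add_mono]]])
      show "norm (f \<tau> - cubic f0 f1 f2 f3 \<tau>) \<le> B * \<bar>\<tau>\<bar> powr s" using B(3) \<tau> by (simp add: d_def)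
      have "norm (cubic q0 q1 q2 q3 \<tau>) \<le> norm q0 + norm q1 * 1 + norm q2 * 1 + norm q3 * 1"
        unfolding cubic_def using t1
        by (intro norm_triangle_le add_mono) (auto simp: norm_mult norm_power power_le_one abs_square_le_1 intro!: mult_left_le)
      then show "norm (cubic q0 q1 q2 q3 \<tau> * (g \<tau> - cubic g0 g1 g2 g3 \<tau>)) \<le> Q * (B' * \<bar>\<tau>\<bar> powr s)"
        unfolding norm_mult using B'(3)[of \<tau>] \<tau> by (intro mult_mono) (auto simp: d_def Q_def)
      have "\<bar>\<tau>\<bar> ^ 4 = \<bar>\<tau>\<bar> powr 4" by simp
      also have "\<dots> \<le> \<bar>\<tau>\<bar> powr s" using t1 s by (intro powr_mono') auto
      finally have "norm (t ^ 4) \<le> \<bar>\<tau>\<bar> powr s" by (simp add: t_def norm_power)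
      moreover have "norm (c4 + c5 * t + c6 * t ^ 2) \<le> norm c4 + norm c5 * 1 + norm c6 * 1"
        unfolding t_def using t1
        by (intro norm_triangle_le add_mono) (auto simp: norm_mult norm_power power_le_one abs_square_le_1 intro!: mult_left_le)
      ultimately show "norm (t ^ 4 * (c4 + c5 * t + c6 * t ^ 2)) \<le> \<bar>\<tau>\<bar> powr s * (norm c4 + norm c5 + norm c6)"
        unfolding norm_mult by (intro mult_mono) auto
    qed
    also have "\<dots> = E * \<bar>\<tau>\<bar> powr s" by (simp add: E_def algebra_simps)
    finally have n: "norm (f \<tau> - cubic q0 q1 q2 q3 \<tau> * g \<tau>) \<le> E * \<bar>\<tau>\<bar> powr s" .
    have "f \<tau> / g \<tau> - cubic q0 q1 q2 q3 \<tau> = (f \<tau> - cubic q0 q1 q2 q3 \<tau> * g \<tau>) / g \<tau>"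
      using gn by (simp add: diff_divide_distrib)
    then have "norm (f \<tau> / g \<tau> - cubic q0 q1 q2 q3 \<tau>) = norm (f \<tau> - cubic q0 q1 q2 q3 \<tau> * g \<tau>) / norm (g \<tau>)"
      by (simp add: norm_divide)
    also have "\<dots> \<le> E * \<bar>\<tau>\<bar> powr s / (norm g0 / 2)"
      by (rule frac_le[OF _ n _ glow[OF \<tau>]]) (use g0 B B' in \<open>auto simp: E_def Q_def\<close>)
    finally show ?thesis by (simp add: mult.commute mult.left_commute)
  qed
  moreover have "0 \<le> E * 2 / norm g0" using B B' by (simp add: E_def Q_def)
  ultimately show ?thesis unfolding jet3_def using d by blast
qed

lemma integrate_power_bound:
  fixes g g' :: "real \<Rightarrow> complex"
  assumes d: "\<And>\<tau>. (g has_vector_derivative g' \<tau>) (at \<tau>)" and g0: "g 0 = 0" and r: "0 \<le> r" and M: "0 \<le> M"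
    and b: "\<And>\<tau>. norm (g' \<tau>) \<le> M * \<bar>\<tau>\<bar> powr r"
  shows "norm (g \<tau>) \<le> M * \<bar>\<tau>\<bar> powr (r + 1)"
proof -
  have "norm (g \<tau> - g 0) \<le> (M * \<bar>\<tau>\<bar> powr r) * norm (\<tau> - 0)"
  proof (rule differentiable_bound[where S = "closed_segment 0 \<tau>" and f' = "\<lambda>x h. h *\<^sub>R g' x"])
    show "(g has_derivative (\<lambda>h. h *\<^sub>R g' x)) (at x within closed_segment 0 \<tau>)" for x
      using d[of x] unfolding has_vector_derivative_def by (rule has_derivative_at_withinI)
    show "onorm (\<lambda>h. h *\<^sub>R g' x) \<le> M * \<bar>\<tau>\<bar> powr r" if x: "x \<in> closed_segment 0 \<tau>" for x
    proof (rule onorm_le)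
      fix h :: real
      have "\<bar>x\<bar> \<le> \<bar>\<tau>\<bar>" using x by (auto simp: closed_segment_eq_real_ivl split: if_splits)
      then have "\<bar>x\<bar> powr r \<le> \<bar>\<tau>\<bar> powr r" using r by (intro powr_mono2) auto
      then have "norm (g' x) \<le> M * \<bar>\<tau>\<bar> powr r" using b[of x] M by (meson mult_left_mono order_trans)
      then have "\<bar>h\<bar> * norm (g' x) \<le> \<bar>h\<bar> * (M * \<bar>\<tau>\<bar> powr r)" by (rule mult_left_mono) simp
      then show "norm (h *\<^sub>R g' x) \<le> M * \<bar>\<tau>\<bar> powr r * norm h" by (simp add: mult.commute)
    qed
  qed auto
  also have "\<dots> = M * \<bar>\<tau>\<bar> powr (r + 1)" by (cases "\<tau> = 0") (auto simp: powr_add)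
  finally show ?thesis using g0 by simp
qed

text \<open>
  The Hoelder bound for the third derivative is integrated three times.
\<close>

lemma Taylor_jet3:
  fixes D :: "nat \<Rightarrow> real \<Rightarrow> complex"
  assumes d: "\<And>k \<theta>. k < 3 \<Longrightarrow> (D k has_vector_derivative D (Suc k) \<theta>) (at \<theta>)"
    and \<alpha>: "0 < \<alpha>" and H: "\<And>x y. norm (D 3 x - D 3 y) \<le> M * \<bar>x - y\<bar> powr \<alpha>"
  shows "jet3 (3 + \<alpha>) (\<lambda>\<tau>. D 0 (\<theta> + \<tau>)) (D 0 \<theta>) (D 1 \<theta>) (D 2 \<theta> / 2) (D 3 \<theta> / 6)"
proof -
  have M: "0 \<le> M" using H[of 1 0] norm_ge_zero[of "D 3 1 - D 3 0"] by (simp del: norm_ge_zero)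
  have sh: "((\<lambda>\<tau>. D k (\<theta> + \<tau>)) has_vector_derivative D (Suc k) (\<theta> + \<tau>)) (at \<tau>)" if "k < 3" for k \<tau>
  proof -
    have "((\<lambda>\<tau>. \<theta> + \<tau>) has_vector_derivative 1) (at \<tau>)" by (auto intro!: derivative_eq_intros)
    from vector_diff_chain_at[OF this d[OF that]] show ?thesis by (simp add: o_def)
  qed
  have p1: "((\<lambda>\<tau>. c * of_real \<tau>) has_vector_derivative c) (at \<tau>)" for c :: complex and \<tau> :: real
    by (auto intro!: derivative_eq_intros)
  have p2: "((\<lambda>\<tau>. c / 2 * of_real \<tau> ^ 2) has_vector_derivative c * of_real \<tau>) (at \<tau>)" for c :: complex and \<tau> :: real
  proof -
    have "((\<lambda>z. c / 2 * z ^ 2) has_field_derivative c * of_real \<tau>) (at (of_real \<tau>))"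
      by (auto intro!: derivative_eq_intros)
    from has_vector_derivative_real_field[OF this] show ?thesis .
  qed
  have p3: "((\<lambda>\<tau>. c / 6 * of_real \<tau> ^ 3) has_vector_derivative c / 2 * of_real \<tau> ^ 2) (at \<tau>)" for c :: complex and \<tau> :: real
  proof -
    have "((\<lambda>z. c / 6 * z ^ 3) has_field_derivative c / 2 * of_real \<tau> ^ 2) (at (of_real \<tau>))"
      by (auto intro!: derivative_eq_intros)
    from has_vector_derivative_real_field[OF this] show ?thesis .
  qed
  have pc: "((\<lambda>\<tau>. c) has_vector_derivative 0) (at \<tau>)" for c :: complex and \<tau> :: real by simp
  define r0 where "r0 = (\<lambda>\<tau>. D 3 (\<theta> + \<tau>) - D 3 \<theta>)"
  define r1 where "r1 = (\<lambda>\<tau>. D 2 (\<theta> + \<tau>) - D 2 \<theta> - D 3 \<theta> * of_real \<tau>)"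
  define r2 where "r2 = (\<lambda>\<tau>. D 1 (\<theta> + \<tau>) - D 1 \<theta> - D 2 \<theta> * of_real \<tau> - D 3 \<theta> / 2 * of_real \<tau> ^ 2)"
  define r3 where "r3 = (\<lambda>\<tau>. D 0 (\<theta> + \<tau>) - D 0 \<theta> - D 1 \<theta> * of_real \<tau> - D 2 \<theta> / 2 * of_real \<tau> ^ 2 - D 3 \<theta> / 6 * of_real \<tau> ^ 3)"
  have b0: "norm (r0 \<tau>) \<le> M * \<bar>\<tau>\<bar> powr \<alpha>" for \<tau> using H[of "\<theta> + \<tau>" \<theta>] by (simp add: r0_def)
  have "(r1 has_vector_derivative (D 3 (\<theta> + \<tau>) - 0 - D 3 \<theta>)) (at \<tau>)" for \<tau>
    unfolding r1_def using sh[of 2 \<tau>] by (intro has_vector_derivative_diff pc p1) (simp add: eval_nat_numeral)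
  then have d1: "(r1 has_vector_derivative r0 \<tau>) (at \<tau>)" for \<tau> by (simp add: r0_def)
  have b1: "norm (r1 \<tau>) \<le> M * \<bar>\<tau>\<bar> powr (\<alpha> + 1)" for \<tau>
    by (rule integrate_power_bound[OF d1 _ _ M b0]) (use \<alpha> in \<open>auto simp: r1_def\<close>)
  have "(r2 has_vector_derivative (D 2 (\<theta> + \<tau>) - 0 - D 2 \<theta> - D 3 \<theta> * of_real \<tau>)) (at \<tau>)" for \<tau>
    unfolding r2_def using sh[of 1 \<tau>] by (intro has_vector_derivative_diff pc p1 p2) (simp add: eval_nat_numeral)
  then have d2: "(r2 has_vector_derivative r1 \<tau>) (at \<tau>)" for \<tau> by (simp add: r1_def)
  have b2: "norm (r2 \<tau>) \<le> M * \<bar>\<tau>\<bar> powr (\<alpha> + 1 + 1)" for \<tau>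
    by (rule integrate_power_bound[OF d2 _ _ M b1]) (use \<alpha> in \<open>auto simp: r2_def\<close>)
  have "(r3 has_vector_derivative (D 1 (\<theta> + \<tau>) - 0 - D 1 \<theta> - D 2 \<theta> * of_real \<tau> - D 3 \<theta> / 2 * of_real \<tau> ^ 2)) (at \<tau>)" for \<tau>
    unfolding r3_def using sh[of 0 \<tau>] by (intro has_vector_derivative_diff pc p1 p2 p3) simp
  then have d3: "(r3 has_vector_derivative r2 \<tau>) (at \<tau>)" for \<tau> by (simp add: r2_def)
  have b3: "norm (r3 \<tau>) \<le> M * \<bar>\<tau>\<bar> powr (\<alpha> + 1 + 1 + 1)" for \<tau>
    by (rule integrate_power_bound[OF d3 _ _ M b2]) (use \<alpha> in \<open>auto simp: r3_def\<close>)
  have "D 0 (\<theta> + \<tau>) - cubic (D 0 \<theta>) (D 1 \<theta>) (D 2 \<theta> / 2) (D 3 \<theta> / 6) \<tau> = r3 \<tau>" for \<tau>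
    by (simp add: cubic_def r3_def)
  then show ?thesis unfolding jet3_def using b3 M by (intro exI[of _ M] exI[of _ 1]) (auto simp: add.commute)
qed

lemma jet3_weaken:
  assumes "jet3 s f a0 a1 a2 a3" "s' \<le> s" "0 \<le> s'" shows "jet3 s' f a0 a1 a2 a3"
proof -
  obtain B \<delta> where B: "0 < \<delta>" "0 \<le> B" "\<And>\<tau>. \<bar>\<tau>\<bar> < \<delta> \<Longrightarrow> norm (f \<tau> - cubic a0 a1 a2 a3 \<tau>) \<le> B * \<bar>\<tau>\<bar> powr s"
    using assms by (auto simp: jet3_def)
  have "norm (f \<tau> - cubic a0 a1 a2 a3 \<tau>) \<le> B * \<bar>\<tau>\<bar> powr s'" if "\<bar>\<tau>\<bar> < min \<delta> 1" for \<tau>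
  proof -
    have "\<bar>\<tau>\<bar> powr s \<le> \<bar>\<tau>\<bar> powr s'" using that assms by (intro powr_mono') auto
    then show ?thesis using B(3)[of \<tau>] that B(2) by (meson min_less_iff_conj mult_left_mono order_trans)
  qed
  then show ?thesis unfolding jet3_def using B by (intro exI[of _ B] exI[of _ "min \<delta> 1"]) auto
qed

text \<open>
  The parameters at distance at least \<open>\<eta>\<close> from \<open>0\<close> form a compact set, whose image misses \<open>w 0\<close>.
\<close>

lemma near_point_has_near_parameter:
  fixes w :: "real \<Rightarrow> complex"
  assumes K: "compact K" and cont: "continuous_on K w" and inj: "\<And>\<tau>. \<tau> \<in> K \<Longrightarrow> w \<tau> = w 0 \<Longrightarrow> \<tau> = 0"
    and \<eta>: "0 < \<eta>"
  shows "\<forall>\<^sub>F z in nhds (w 0). z \<in> w ` K \<longrightarrow> (\<exists>\<tau>\<in>K. \<bar>\<tau>\<bar> < \<eta> \<and> z = w \<tau>)"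
proof -
  have "compact (w ` (K - ball 0 \<eta>))"
    by (intro compact_continuous_image continuous_on_subset[OF cont] compact_diff K) auto
  then have "open (- w ` (K - ball 0 \<eta>))" by (intro open_Compl compact_imp_closed)
  moreover have "w 0 \<in> - w ` (K - ball 0 \<eta>)" using inj \<eta> by force
  ultimately have "\<forall>\<^sub>F z in nhds (w 0). z \<in> - w ` (K - ball 0 \<eta>)" by (rule eventually_nhds_in_open)
  then show ?thesis
  proof eventually_elim
    case (elim z)
    show ?case
    proof
      assume "z \<in> w ` K"
      then obtain \<tau> where \<tau>: "\<tau> \<in> K" "z = w \<tau>" by blast
      then have "\<tau> \<in> ball 0 \<eta>" using elim by blast
      then show "\<exists>\<tau>\<in>K. \<bar>\<tau>\<bar> < \<eta> \<and> z = w \<tau>" using \<tau> by (auto simp: dist_real_def)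
    qed
  qed
qed

text \<open>
  Near \<^term>\<open>a0\<close> the set \<^term>\<open>X\<close> is the arc \<^term>\<open>w\<close> and nothing else; this is the last clause. Continuity of the
  derivative makes the arc a graph over its tangent.
\<close>

definition local_arc :: "real \<Rightarrow> complex set \<Rightarrow> (real \<Rightarrow> complex) \<Rightarrow> complex \<Rightarrow> complex \<Rightarrow> complex \<Rightarrow> complex \<Rightarrow> bool" where
  "local_arc s X w a0 a1 a2 a3 \<longleftrightarrow> jet3 s w a0 a1 a2 a3 \<and> a1 \<noteq> 0 \<and>
     (\<exists>w'. (\<forall>\<^sub>F \<tau> in nhds 0. (w has_vector_derivative w' \<tau>) (at \<tau>)) \<and> isCont w' 0 \<and> w' 0 = a1) \<and>
     (\<forall>\<^sub>F \<tau> in nhds 0. w \<tau> \<in> X) \<and>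
     (\<forall>\<eta>>0. \<forall>\<^sub>F z in nhds a0. z \<in> X \<longrightarrow> (\<exists>\<tau>. \<bar>\<tau>\<bar> < \<eta> \<and> z = w \<tau>))"

lemma smooth_plane_curve_local_arc:
  assumes X: "smooth_plane_curve 3 X" and q: "q \<in> X"
  obtains s w a1 a2 a3 where "3 < s" "s < 4" "local_arc s X w q a1 a2 a3"
proof -
  obtain h D \<alpha> M where h: "bij_betw h (sphere 0 1) X" and D0: "D 0 = (\<lambda>\<theta>. h (cis \<theta>))"
    and d: "\<And>k \<theta>. k < 3 \<Longrightarrow> (D k has_vector_derivative D (Suc k) \<theta>) (at \<theta>)"
    and D1: "\<And>\<theta>. D 1 \<theta> \<noteq> 0" and \<alpha>: "0 < \<alpha>"
    and H: "\<And>x y. norm (D 3 x - D 3 y) \<le> M * \<bar>x - y\<bar> powr \<alpha>"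
    using X unfolding smooth_plane_curve_def by blast
  obtain u where u: "norm u = 1" "h u = q" using h q by (auto simp: bij_betw_def)
  define \<theta> where "\<theta> = Arg u"
  have cu: "cis \<theta> = u" using cis_Arg_unique u by (metis \<theta>_def cis_Arg norm_zero sgn_eq zero_neq_one div_by_1 of_real_1 scaleR_one inverse_1 sgn_div_norm)
  define w where "w = (\<lambda>\<tau>. D 0 (\<theta> + \<tau>))"
  have wh: "w \<tau> = h (cis (\<theta> + \<tau>))" for \<tau> by (simp add: w_def D0)
  have sh: "((\<lambda>\<tau>. D k (\<theta> + \<tau>)) has_vector_derivative D (Suc k) (\<theta> + \<tau>)) (at \<tau>)" if "k < 3" for k \<tau>
  proof -
    have "((\<lambda>\<tau>. \<theta> + \<tau>) has_vector_derivative 1) (at \<tau>)" by (auto intro!: derivative_eq_intros)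
    from vector_diff_chain_at[OF this d[OF that]] show ?thesis by (simp add: o_def)
  qed
  have wX: "w \<tau> \<in> X" for \<tau> using h by (auto simp: wh bij_betw_def)
  have img: "X = w ` {- pi..pi}"
  proof (intro equalityI subsetI)
    fix x assume "x \<in> X"
    then obtain v where v: "norm v = 1" "h v = x" using h by (auto simp: bij_betw_def)
    have "v / u \<noteq> 0" "norm (v / u) = 1" using v u by (auto simp: norm_divide)
    then have "v / u = cis (Arg (v / u))" by (simp add: cis_Arg sgn_eq)
    then have "v = cis (\<theta> + Arg (v / u))" using u cu by (auto simp: cis_mult[symmetric] field_simps)
    then have "x = w (Arg (v / u))" using v wh by simp
    then show "x \<in> w ` {- pi..pi}" using Arg_bounded[of "v / u"] by (intro image_eqI) auto
  qed (use wX in auto)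
  \<comment> \<open>a smaller Hoelder exponent keeps the order of the remainder below \<open>4\<close>\<close>
  define s where "s = 3 + min \<alpha> (1 / 2)"
  have s: "3 < s" "s < 4" "s \<le> 3 + \<alpha>" using \<alpha> by (auto simp: s_def)
  have near: "\<forall>\<^sub>F z in nhds (w 0). z \<in> w ` {- pi..pi} \<longrightarrow> (\<exists>\<tau>\<in>{- pi..pi}. \<bar>\<tau>\<bar> < \<eta> \<and> z = w \<tau>)" if "0 < \<eta>" for \<eta>
  proof (rule near_point_has_near_parameter[OF _ _ _ that])
    show "continuous_on {- pi..pi} w" unfolding w_def
      using sh[of 0] by (auto intro!: continuous_at_imp_continuous_on has_vector_derivative_continuous)
    fix \<tau> assume \<tau>: "\<tau> \<in> {- pi..pi}" "w \<tau> = w 0"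
    then have "cis (\<theta> + \<tau>) = cis \<theta>" using h unfolding wh by (auto simp: bij_betw_def inj_on_def)
    then have "cis \<tau> = 1" by (simp add: cis_mult[symmetric])
    then have "cos \<tau> = 1" by (simp add: complex_eq_iff)
    then obtain n :: int where n: "\<tau> = of_int n * 2 * pi" using cos_one_2pi_int by metis
    have "\<bar>\<tau>\<bar> \<le> 1 * pi" using \<tau>(1) by auto
    then have "\<bar>of_int n * 2 * pi\<bar> \<le> 1 * pi" unfolding n .
    then have "\<bar>real_of_int n\<bar> * 2 \<le> 1" by (simp add: abs_mult)
    then have "n = 0" by linarith
    then show "\<tau> = 0" using n by simp
  qed auto
  have w0: "w 0 = q" using u cu by (simp add: wh)
  have "local_arc s X w q (D 1 \<theta>) (D 2 \<theta> / 2) (D 3 \<theta> / 6)"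
    unfolding local_arc_def
  proof (intro conjI allI impI)
    have "jet3 s w (D 0 \<theta>) (D 1 \<theta>) (D 2 \<theta> / 2) (D 3 \<theta> / 6)"
      unfolding w_def by (rule jet3_weaken[OF Taylor_jet3[OF d \<alpha> H]]) (use s in auto)
    then show "jet3 s w q (D 1 \<theta>) (D 2 \<theta> / 2) (D 3 \<theta> / 6)" using w0 by (simp add: w_def)
    show "D 1 \<theta> \<noteq> 0" by (rule D1)
    show "\<exists>w'. (\<forall>\<^sub>F \<tau> in nhds 0. (w has_vector_derivative w' \<tau>) (at \<tau>)) \<and> isCont w' 0 \<and> w' 0 = D 1 \<theta>"
    proof (intro exI[of _ "\<lambda>\<tau>. D 1 (\<theta> + \<tau>)"] conjI)
      show "isCont (\<lambda>\<tau>. D 1 (\<theta> + \<tau>)) 0" using has_vector_derivative_continuous[OF sh[of 1 0]] by simp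
    qed (use sh[of 0] in \<open>auto simp: w_def\<close>)
    show "\<forall>\<^sub>F \<tau> in nhds 0. w \<tau> \<in> X" using wX by simp
    fix \<eta> :: real assume "0 < \<eta>"
    from near[OF this] show "\<forall>\<^sub>F z in nhds q. z \<in> X \<longrightarrow> (\<exists>\<tau>. \<bar>\<tau>\<bar> < \<eta> \<and> z = w \<tau>)"
      unfolding w0 img[symmetric] by eventually_elim blast
  qed
  then show thesis using that s by blast
qed

section \<open>Change of chart, flatness and second order contact\<close>

text \<open>
  The equations for \<open>q0\<close>, \<open>q1\<close>, \<open>q2\<close> say that the new \<open>2\<close>-jet is the quotient of those of the numerator and
  the denominator. The last clause of \<open>local_arc\<close> is pulled back by the inverse transformation.
\<close>

lemma local_arc_transport:
  assumes arc: "local_arc s X w q a1 a2 a3" and s: "3 < s" "s \<le> 4"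
    and nz: "c * q + d \<noteq> 0" and det: "a * d - b * c \<noteq> 0"
    and X': "\<And>z. c * z + d \<noteq> 0 \<Longrightarrow> z \<in> X \<longleftrightarrow> (a * z + b) / (c * z + d) \<in> X'"
    and q0: "a * q + b = q0 * (c * q + d)" and q1: "a * a1 = q0 * (c * a1) + q1 * (c * q + d)"
    and q2: "a * a2 = q0 * (c * a2) + q1 * (c * a1) + q2 * (c * q + d)"
  obtains q3 where "local_arc s X' (\<lambda>\<tau>. (a * w \<tau> + b) / (c * w \<tau> + d)) q0 q1 q2 q3"
proof -
  define v where "v = (\<lambda>\<tau>. (a * w \<tau> + b) / (c * w \<tau> + d))"
  define q3 where "q3 = (a * a3 - q0 * (c * a3) - q1 * (c * a2) - q2 * (c * a1)) / (c * q + d)"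
  have jet: "jet3 s w q a1 a2 a3" and a1: "a1 \<noteq> 0" using arc by (auto simp: local_arc_def)
  obtain w' where w': "\<forall>\<^sub>F \<tau> in nhds 0. (w has_vector_derivative w' \<tau>) (at \<tau>)" "isCont w' 0" "w' 0 = a1"
    using arc by (auto simp: local_arc_def)
  have w0: "w 0 = q" by (rule jet3_0[OF jet])
  have jetv: "jet3 s v q0 q1 q2 q3"
    unfolding v_def
    by (rule jet3_divide[OF jet3_affine[OF jet] jet3_affine[OF jet] nz s q0 q1 q2])
       (use nz in \<open>simp add: q3_def\<close>)
  have e1: "(q1 * (c * q + d)) * (c * q + d) = (a * d - b * c) * a1"
  proof -
    have "(q1 * (c * q + d)) * (c * q + d) = (a * a1) * (c * q + d) - (q0 * (c * q + d)) * (c * a1)"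
      using q1 by (simp add: algebra_simps)
    also have "\<dots> = (a * d - b * c) * a1" unfolding q0[symmetric] by (simp add: algebra_simps)
    finally show ?thesis .
  qed
  then have q1nz: "q1 \<noteq> 0" using det a1 by auto
  have contw: "isCont w 0" using eventually_nhds_x_imp_x[OF w'(1)] by (rule has_vector_derivative_continuous)
  have ev_nz: "\<forall>\<^sub>F \<tau> in nhds 0. c * w \<tau> + d \<noteq> 0"
  proof -
    have "isCont (\<lambda>\<tau>. c * w \<tau> + d) 0" using contw by (intro continuous_intros)
    then have "((\<lambda>\<tau>. c * w \<tau> + d) \<longlongrightarrow> c * q + d) (nhds 0)" by (simp add: isCont_def w0 tendsto_nhds_iff)
    then show ?thesis using nz by (rule tendsto_imp_eventually_ne)
  qed
  define v' where "v' = (\<lambda>\<tau>. w' \<tau> * ((a * d - b * c) / (c * w \<tau> + d)\<^sup>2))"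
  have der: "\<forall>\<^sub>F \<tau> in nhds 0. (v has_vector_derivative v' \<tau>) (at \<tau>)"
    using w'(1) ev_nz
  proof eventually_elim
    case (elim \<tau>)
    have "((\<lambda>z. (a * z + b) / (c * z + d)) has_field_derivative (a * d - b * c) / (c * w \<tau> + d)\<^sup>2) (at (w \<tau>))"
      using elim(2) by (auto intro!: derivative_eq_intros simp: power2_eq_square algebra_simps)
    from field_vector_diff_chain_at[OF elim(1) this] show ?case by (simp add: v_def v'_def o_def)
  qed
  have contv': "isCont v' 0" unfolding v'_def using w'(2) contw nz w0 by (intro continuous_intros) auto
  have "q1 = (a * d - b * c) * a1 / (c * q + d)\<^sup>2"
    using e1 nz by (simp add: eq_divide_eq power2_eq_square mult.assoc)
  then have v'0: "v' 0 = q1" by (simp add: v'_def w'(3) w0)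
  have inX: "\<forall>\<^sub>F \<tau> in nhds 0. v \<tau> \<in> X'"
  proof -
    have "\<forall>\<^sub>F \<tau> in nhds 0. w \<tau> \<in> X" using arc by (auto simp: local_arc_def)
    with ev_nz show ?thesis by eventually_elim (use X' in \<open>auto simp: v_def\<close>)
  qed
  \<comment> \<open>the inverse transformation; it shows that the new arc covers \<open>X'\<close> near the image point\<close>
  define \<mu> where "\<mu> = (\<lambda>y. (d * y - b) / (a - c * y))"
  have den: "(a - c * q0) * (c * q + d) = a * d - b * c"
  proof -
    have "(a - c * q0) * (c * q + d) = a * (c * q + d) - c * (q0 * (c * q + d))" by (simp add: algebra_simps)
    also have "\<dots> = a * d - b * c" unfolding q0[symmetric] by (simp add: algebra_simps)
    finally show ?thesis .
  qed
  have den0: "a - c * q0 \<noteq> 0" using den det by auto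
  have \<mu>0: "\<mu> q0 = q"
  proof -
    have "d * q0 - b = q * (a - c * q0)" using q0 by (simp add: algebra_simps)
    then show ?thesis using den0 by (simp add: \<mu>_def)
  qed
  have \<mu>: "c * \<mu> y + d \<noteq> 0 \<and> (a * \<mu> y + b) / (c * \<mu> y + d) = y" if "a - c * y \<noteq> 0" for y
  proof -
    have "c * \<mu> y + d = (a * d - b * c) / (a - c * y)" "a * \<mu> y + b = y * (a * d - b * c) / (a - c * y)"
      unfolding \<mu>_def using that by (simp_all add: field_simps)
    then show ?thesis using det that by simp
  qed
  have \<mu>cont: "filterlim \<mu> (nhds q) (nhds q0)"
  proof -
    have "isCont \<mu> q0" unfolding \<mu>_def using den0 by (intro continuous_intros) auto
    then show ?thesis by (simp add: isCont_def \<mu>0 tendsto_nhds_iff)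
  qed
  have ev_den: "\<forall>\<^sub>F y in nhds q0. a - c * y \<noteq> 0"
  proof -
    have "isCont (\<lambda>y. a - c * y) q0" by (intro continuous_intros)
    then have "((\<lambda>y. a - c * y) \<longlongrightarrow> a - c * q0) (nhds q0)" by (simp add: isCont_def tendsto_nhds_iff)
    then show ?thesis using den0 by (rule tendsto_imp_eventually_ne)
  qed
  have cover: "\<forall>\<^sub>F y in nhds q0. y \<in> X' \<longrightarrow> (\<exists>\<tau>. \<bar>\<tau>\<bar> < \<eta> \<and> y = v \<tau>)" if "0 < \<eta>" for \<eta>
  proof -
    have "\<forall>\<^sub>F z in nhds q. z \<in> X \<longrightarrow> (\<exists>\<tau>. \<bar>\<tau>\<bar> < \<eta> \<and> z = w \<tau>)" using arc that by (auto simp: local_arc_def)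
    then have "\<forall>\<^sub>F y in nhds q0. \<mu> y \<in> X \<longrightarrow> (\<exists>\<tau>. \<bar>\<tau>\<bar> < \<eta> \<and> \<mu> y = w \<tau>)"
      by (rule eventually_compose_filterlim[OF _ \<mu>cont])
    with ev_den show ?thesis
    proof eventually_elim
      case (elim y)
      show ?case
      proof
        assume "y \<in> X'"
        then have "\<mu> y \<in> X" using \<mu>[OF elim(1)] X'[of "\<mu> y"] by simp
        then show "\<exists>\<tau>. \<bar>\<tau>\<bar> < \<eta> \<and> y = v \<tau>" using elim(2) \<mu>[OF elim(1)] by (metis v_def)
      qed
    qed
  qed
  have "local_arc s X' v q0 q1 q2 q3"
    unfolding local_arc_def using jetv q1nz der contv' v'0 inX cover by blast
  then show thesis using that by (simp add: v_def)
qed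

text \<open>
  Here \<open>c\<close> is \<open>Im a3 / a1\<^sup>3\<close>. As \<open>a1\<close> and \<open>a2\<close> are real, \<open>Im w\<close> starts with \<open>Im a3 \<tau>\<^sup>3\<close>, while
  \<open>Re w \<bar>w\<bar>\<^sup>2\<close> is \<open>a1\<^sup>3 \<tau>\<^sup>3\<close> up to fourth order. The second claim holds because \<open>Re w\<close> is strictly monotone near \<open>0\<close>.
  The term \<open>Re z \<bar>z\<bar>\<^sup>2\<close> is preferred to \<open>(Re z)\<^sup>3\<close> because for \<open>z = -1 / \<zeta>\<close> it becomes
  \<open>- Re (1 / \<zeta>) / \<bar>\<zeta>\<bar>\<^sup>2\<close>, where \<open>Re (1 / \<zeta>)\<close> is harmonic, while \<open>Im z = Im \<zeta> / \<bar>\<zeta>\<bar>\<^sup>2\<close>.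
\<close>

lemma local_arc_flat:
  assumes arc: "local_arc s X w 0 a1 a2 a3" and s: "3 < s" "s \<le> 4" and real: "Im a1 = 0" "Im a2 = 0"
  obtains c K \<eta> where "0 < \<eta>" "0 \<le> K"
    "\<And>z. z \<in> X \<Longrightarrow> norm z < \<eta> \<Longrightarrow> \<bar>Im z - c * Re z * (norm z)\<^sup>2\<bar> \<le> K * \<bar>Re z\<bar> powr s"
    "\<And>z z'. z \<in> X \<Longrightarrow> z' \<in> X \<Longrightarrow> norm z < \<eta> \<Longrightarrow> norm z' < \<eta> \<Longrightarrow> Re z = Re z' \<Longrightarrow> z = z'"
proof -
  define r where "r = Re a1"
  have jet: "jet3 s w 0 a1 a2 a3" using arc by (auto simp: local_arc_def)
  have a1: "a1 = of_real r" "r \<noteq> 0" using arc real by (auto simp: local_arc_def r_def complex_eq_iff)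
  obtain w' where w': "\<forall>\<^sub>F \<tau> in nhds 0. (w has_vector_derivative w' \<tau>) (at \<tau>)" "isCont w' 0" "w' 0 = a1"
    using arc by (auto simp: local_arc_def)
  obtain A \<delta>1 where A: "0 < \<delta>1" "0 \<le> A" "\<delta>1 \<le> 1"
      "\<And>\<tau>. \<bar>\<tau>\<bar> < \<delta>1 \<Longrightarrow> norm (w \<tau> - 0 - a1 * of_real \<tau> - a2 * of_real \<tau> ^ 2) \<le> A * \<bar>\<tau>\<bar> ^ 3"
    using jet3_bounded[OF jet s(1)] by blast
  obtain B \<delta>2 where B: "0 < \<delta>2" "0 \<le> B" "\<And>\<tau>. \<bar>\<tau>\<bar> < \<delta>2 \<Longrightarrow> norm (w \<tau> - cubic 0 a1 a2 a3 \<tau>) \<le> B * \<bar>\<tau>\<bar> powr s"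
    using jet by (auto simp: jet3_def)
  have "\<forall>\<^sub>F \<tau> in nhds 0. \<bar>Re (w' \<tau>) - r\<bar> < \<bar>r\<bar>"
  proof -
    have "(w' \<longlongrightarrow> a1) (nhds 0)" using w'(2,3) by (simp add: isCont_def tendsto_nhds_iff)
    then have "((\<lambda>\<tau>. Re (w' \<tau>)) \<longlongrightarrow> r) (nhds 0)" unfolding r_def by (rule tendsto_Re)
    from tendstoD[OF this, of "\<bar>r\<bar>"] show ?thesis using a1 by (simp add: dist_real_def)
  qed
  with w'(1) have "\<forall>\<^sub>F \<tau> in nhds 0. (w has_vector_derivative w' \<tau>) (at \<tau>) \<and> Re (w' \<tau>) \<noteq> 0"
    by eventually_elim auto
  then obtain \<delta>3 where d3: "0 < \<delta>3" "\<And>\<tau>. \<bar>\<tau>\<bar> < \<delta>3 \<Longrightarrow> (w has_vector_derivative w' \<tau>) (at \<tau>) \<and> Re (w' \<tau>) \<noteq> 0"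
    by (auto simp: eventually_nhds_metric dist_real_def)
  define D where "D = norm a2 + A"
  have D: "0 \<le> D" using A by (simp add: D_def)
  define \<delta> where "\<delta> = min (min \<delta>1 \<delta>2) (min \<delta>3 (\<bar>r\<bar> / (2 * (D + 1))))"
  have \<delta>: "0 < \<delta>" using A B d3 a1 D by (simp add: \<delta>_def)
  obtain \<eta> where \<eta>: "0 < \<eta>" "\<And>z. z \<in> X \<Longrightarrow> norm z < \<eta> \<Longrightarrow> \<exists>\<tau>. \<bar>\<tau>\<bar> < \<delta> \<and> z = w \<tau>"
  proof -
    have "\<forall>\<^sub>F z in nhds 0. z \<in> X \<longrightarrow> (\<exists>\<tau>. \<bar>\<tau>\<bar> < \<delta> \<and> z = w \<tau>)" using arc \<delta> by (auto simp: local_arc_def)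
    then show thesis using that by (auto simp: eventually_nhds_metric)
  qed
  define c where "c = Im a3 / r ^ 3"
  define E where "E = D * (\<bar>r\<bar> + D)\<^sup>2 + \<bar>r\<bar> * (D * (2 * \<bar>r\<bar> + D))"
  have E: "0 \<le> E" using D by (simp add: E_def)
  define K where "K = (B + \<bar>c\<bar> * E) * (2 / \<bar>r\<bar>) powr s"
  have flat: "\<bar>Im (w \<tau>) - c * Re (w \<tau>) * (norm (w \<tau>))\<^sup>2\<bar> \<le> K * \<bar>Re (w \<tau>)\<bar> powr s" if \<tau>: "\<bar>\<tau>\<bar> < \<delta>" for \<tau>
  proof -
    define e where "e = w \<tau> - of_real (r * \<tau>)"
    have t1: "\<bar>\<tau>\<bar> \<le> 1" using \<tau> A by (simp add: \<delta>_def)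
    have p32: "\<bar>\<tau>\<bar> ^ 3 \<le> \<bar>\<tau>\<bar>\<^sup>2" using t1 by (intro power_decreasing) auto
    have "e = (w \<tau> - 0 - a1 * of_real \<tau> - a2 * of_real \<tau> ^ 2) + a2 * of_real \<tau> ^ 2" by (simp add: e_def a1)
    also have "norm \<dots> \<le> A * \<bar>\<tau>\<bar> ^ 3 + norm a2 * \<bar>\<tau>\<bar>\<^sup>2"
      using A(4)[of \<tau>] \<tau> by (intro norm_triangle_le add_mono) (auto simp: norm_mult norm_power \<delta>_def)
    also have "\<dots> \<le> A * \<bar>\<tau>\<bar>\<^sup>2 + norm a2 * \<bar>\<tau>\<bar>\<^sup>2" using p32 A by (intro add_mono mult_left_mono) auto
    finally have e: "norm e \<le> D * \<bar>\<tau>\<bar>\<^sup>2" by (simp add: D_def algebra_simps)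
    have e1: "norm e \<le> D * \<bar>\<tau>\<bar>"
    proof -
      have "\<bar>\<tau>\<bar>\<^sup>2 \<le> \<bar>\<tau>\<bar>" using power_decreasing[of 1 2 "\<bar>\<tau>\<bar>"] t1 by simp
      then show ?thesis using e D by (meson mult_left_mono order_trans)
    qed
    have we: "w \<tau> = of_real (r * \<tau>) + e" by (simp add: e_def)
    have nrt: "norm (complex_of_real (r * \<tau>)) = \<bar>r\<bar> * \<bar>\<tau>\<bar>" by (simp add: norm_mult)
    have nw: "norm (w \<tau>) \<le> (\<bar>r\<bar> + D) * \<bar>\<tau>\<bar>"
    proof -
      have "norm (w \<tau>) \<le> norm (complex_of_real (r * \<tau>)) + norm e" unfolding we by (rule norm_triangle_ineq)
      then show ?thesis using e1 unfolding nrt by (simp add: distrib_right)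
    qed
    have Rew: "Re (w \<tau>) = r * \<tau> + Re e" by (simp add: we)
    have lowRe: "\<bar>r\<bar> / 2 * \<bar>\<tau>\<bar> \<le> \<bar>Re (w \<tau>)\<bar>"
    proof -
      have "\<bar>\<tau>\<bar> \<le> \<bar>r\<bar> / (2 * (D + 1))" using \<tau> by (simp add: \<delta>_def)
      then have "\<bar>\<tau>\<bar> * (2 * (D + 1)) \<le> \<bar>r\<bar>" using D by (simp add: pos_le_divide_eq)
      then have "D * \<bar>\<tau>\<bar> \<le> \<bar>r\<bar> / 2" using abs_ge_zero[of \<tau>] by (simp add: algebra_simps)
      then have "D * \<bar>\<tau>\<bar> * \<bar>\<tau>\<bar> \<le> \<bar>r\<bar> / 2 * \<bar>\<tau>\<bar>" by (rule mult_right_mono) simp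
      then have "norm e \<le> \<bar>r\<bar> / 2 * \<bar>\<tau>\<bar>" using e by (simp add: power2_eq_square mult.assoc)
      moreover have "\<bar>r * \<tau>\<bar> \<le> \<bar>Re (w \<tau>)\<bar> + norm e" using abs_Re_le_cmod[of e] unfolding Rew by linarith
      ultimately show ?thesis by (simp add: abs_mult)
    qed
    have cub: "\<bar>Re (w \<tau>) * (norm (w \<tau>))\<^sup>2 - r ^ 3 * \<tau> ^ 3\<bar> \<le> E * \<bar>\<tau>\<bar> ^ 4"
    proof -
      have "Re (w \<tau>) * (norm (w \<tau>))\<^sup>2 - r ^ 3 * \<tau> ^ 3 = Re e * (norm (w \<tau>))\<^sup>2 + (r * \<tau>) * ((norm (w \<tau>))\<^sup>2 - (r * \<tau>)\<^sup>2)"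
        unfolding Rew by (simp add: algebra_simps power2_eq_square power3_eq_cube)
      also have "\<bar>\<dots>\<bar> \<le> (D * \<bar>\<tau>\<bar>\<^sup>2) * ((\<bar>r\<bar> + D) * \<bar>\<tau>\<bar>)\<^sup>2 + (\<bar>r\<bar> * \<bar>\<tau>\<bar>) * ((D * \<bar>\<tau>\<bar>\<^sup>2) * ((2 * \<bar>r\<bar> + D) * \<bar>\<tau>\<bar>))"
      proof (rule order_trans[OF abs_triangle_ineq add_mono])
        have "\<bar>Re e\<bar> \<le> D * \<bar>\<tau>\<bar>\<^sup>2" using abs_Re_le_cmod[of e] e by linarith
        then show "\<bar>Re e * (norm (w \<tau>))\<^sup>2\<bar> \<le> (D * \<bar>\<tau>\<bar>\<^sup>2) * ((\<bar>r\<bar> + D) * \<bar>\<tau>\<bar>)\<^sup>2"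
          unfolding abs_mult using nw D by (intro mult_mono) (auto intro!: power_mono)
        have "(norm (w \<tau>))\<^sup>2 - (r * \<tau>)\<^sup>2 = (norm (w \<tau>) - \<bar>r * \<tau>\<bar>) * (norm (w \<tau>) + \<bar>r * \<tau>\<bar>)"
          by (simp add: algebra_simps power2_eq_square)
        also have "\<bar>\<dots>\<bar> \<le> (D * \<bar>\<tau>\<bar>\<^sup>2) * ((2 * \<bar>r\<bar> + D) * \<bar>\<tau>\<bar>)"
          unfolding abs_mult
        proof (rule mult_mono)
          show "\<bar>norm (w \<tau>) - \<bar>r\<bar> * \<bar>\<tau>\<bar>\<bar> \<le> D * \<bar>\<tau>\<bar>\<^sup>2"
            using norm_triangle_ineq3[of "w \<tau>" "of_real (r * \<tau>)"] e unfolding nrt e_def by linarith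
          show "\<bar>norm (w \<tau>) + \<bar>r\<bar> * \<bar>\<tau>\<bar>\<bar> \<le> (2 * \<bar>r\<bar> + D) * \<bar>\<tau>\<bar>" using nw by (simp add: algebra_simps)
        qed (use D in auto)
        finally show "\<bar>r * \<tau> * ((norm (w \<tau>))\<^sup>2 - (r * \<tau>)\<^sup>2)\<bar> \<le> (\<bar>r\<bar> * \<bar>\<tau>\<bar>) * ((D * \<bar>\<tau>\<bar>\<^sup>2) * ((2 * \<bar>r\<bar> + D) * \<bar>\<tau>\<bar>))"
          unfolding abs_mult by (intro mult_mono) auto
      qed
      also have "\<dots> = E * \<bar>\<tau>\<bar> ^ 4"
      proof -
        have "(D * T\<^sup>2) * ((\<bar>r\<bar> + D) * T)\<^sup>2 + (\<bar>r\<bar> * T) * ((D * T\<^sup>2) * ((2 * \<bar>r\<bar> + D) * T)) = E * T ^ 4" for T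
          by (simp add: E_def algebra_simps eval_nat_numeral)
        then show ?thesis .
      qed
      finally show ?thesis .
    qed
    have p4: "\<bar>\<tau>\<bar> ^ 4 \<le> \<bar>\<tau>\<bar> powr s"
    proof -
      have "\<bar>\<tau>\<bar> powr 4 \<le> \<bar>\<tau>\<bar> powr s" using t1 s by (intro powr_mono') auto
      then show ?thesis by simp
    qed
    have "Im (cubic 0 a1 a2 a3 \<tau>) = Im a3 * \<tau> ^ 3"
      unfolding cubic_def of_real_power[symmetric] using real by simp
    then have I: "\<bar>Im (w \<tau>) - Im a3 * \<tau> ^ 3\<bar> \<le> B * \<bar>\<tau>\<bar> powr s"
      using B(3)[of \<tau>] \<tau> abs_Im_le_cmod[of "w \<tau> - cubic 0 a1 a2 a3 \<tau>"] by (simp add: \<delta>_def)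
    have cr: "c * (r ^ 3 * \<tau> ^ 3) = Im a3 * \<tau> ^ 3" using a1 by (simp add: c_def)
    have "\<bar>Im (w \<tau>) - c * Re (w \<tau>) * (norm (w \<tau>))\<^sup>2\<bar>
       = \<bar>(Im (w \<tau>) - Im a3 * \<tau> ^ 3) - c * (Re (w \<tau>) * (norm (w \<tau>))\<^sup>2 - r ^ 3 * \<tau> ^ 3)\<bar>"
      unfolding right_diff_distrib cr by (simp add: mult.assoc)
    also have "\<dots> \<le> B * \<bar>\<tau>\<bar> powr s + \<bar>c\<bar> * (E * \<bar>\<tau>\<bar> powr s)"
    proof (rule order_trans[OF abs_triangle_ineq4 add_mono[OF I]])
      have "\<bar>Re (w \<tau>) * (norm (w \<tau>))\<^sup>2 - r ^ 3 * \<tau> ^ 3\<bar> \<le> E * \<bar>\<tau>\<bar> powr s"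
        using cub mult_left_mono[OF p4 E] by linarith
      then show "\<bar>c * (Re (w \<tau>) * (norm (w \<tau>))\<^sup>2 - r ^ 3 * \<tau> ^ 3)\<bar> \<le> \<bar>c\<bar> * (E * \<bar>\<tau>\<bar> powr s)"
        unfolding abs_mult by (rule mult_left_mono) simp
    qed
    also have "\<dots> = (B + \<bar>c\<bar> * E) * \<bar>\<tau>\<bar> powr s" by (simp add: algebra_simps)
    also have "\<dots> \<le> (B + \<bar>c\<bar> * E) * ((2 / \<bar>r\<bar>) powr s * \<bar>Re (w \<tau>)\<bar> powr s)"
    proof (rule mult_left_mono)
      have "\<bar>\<tau>\<bar> \<le> 2 / \<bar>r\<bar> * \<bar>Re (w \<tau>)\<bar>" using lowRe a1 by (simp add: field_simps)
      then have "\<bar>\<tau>\<bar> powr s \<le> (2 / \<bar>r\<bar> * \<bar>Re (w \<tau>)\<bar>) powr s" using s by (intro powr_mono2) auto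
      then show "\<bar>\<tau>\<bar> powr s \<le> (2 / \<bar>r\<bar>) powr s * \<bar>Re (w \<tau>)\<bar> powr s"
        by (subst (asm) powr_mult) auto
      show "0 \<le> B + \<bar>c\<bar> * E" using B E by simp
    qed
    finally show ?thesis by (simp add: K_def mult.assoc)
  qed
  have inj: "\<tau> = \<tau>'" if t: "\<bar>\<tau>\<bar> < \<delta>" "\<bar>\<tau>'\<bar> < \<delta>" "Re (w \<tau>) = Re (w \<tau>')" for \<tau> \<tau>'
  proof -
    have *: False if t: "\<bar>\<tau>\<bar> < \<delta>" "\<bar>\<tau>'\<bar> < \<delta>" "Re (w \<tau>) = Re (w \<tau>')" "\<tau> < \<tau>'" for \<tau> \<tau>'
    proof -
      have b: "\<bar>\<tau>\<bar> < \<delta>3" "\<bar>\<tau>'\<bar> < \<delta>3" using t by (auto simp: \<delta>_def)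
      have "\<exists>\<xi>>\<tau>. \<xi> < \<tau>' \<and> Re (w \<tau>') - Re (w \<tau>) = (\<tau>' - \<tau>) * Re (w' \<xi>)"
      proof (rule MVT2[OF t(4)])
        fix x assume "\<tau> \<le> x" "x \<le> \<tau>'"
        then have "\<bar>x\<bar> < \<delta>3" using b by linarith
        then have "(w has_vector_derivative w' x) (at x)" using d3 by blast
        then show "((\<lambda>x. Re (w x)) has_real_derivative Re (w' x)) (at x)"
          using bounded_linear.has_vector_derivative[OF bounded_linear_Re]
          by (simp add: has_real_derivative_iff_has_vector_derivative)
      qed
      then obtain \<xi> where "\<tau> < \<xi>" "\<xi> < \<tau>'" "Re (w' \<xi>) = 0" using t by auto
      moreover from this b have "\<bar>\<xi>\<bar> < \<delta>3" by linarith
      ultimately show False using d3(2)[of \<xi>] by blast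
    qed
    show ?thesis using *[of \<tau> \<tau>'] *[of \<tau>' \<tau>] t by (cases \<tau> \<tau>' rule: linorder_cases) auto
  qed
  show thesis
  proof (rule that[of \<eta> K c])
    show "0 \<le> K" using B E by (simp add: K_def)
    show "\<bar>Im z - c * Re z * (norm z)\<^sup>2\<bar> \<le> K * \<bar>Re z\<bar> powr s" if "z \<in> X" "norm z < \<eta>" for z
      using \<eta>(2)[OF that] flat by auto
    show "z = z'" if "z \<in> X" "z' \<in> X" "norm z < \<eta>" "norm z' < \<eta>" "Re z = Re z'" for z z'
      using \<eta>(2)[OF that(1,3)] \<eta>(2)[OF that(2,4)] inj that(5) by auto
  qed (rule \<eta>(1))
qed

text \<open>
  A consequence of second order contact that refers to the point sets alone, and is therefore
  easily transported by Moebius transformations.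
\<close>

definition second_order_close :: "complex set \<Rightarrow> complex set \<Rightarrow> complex \<Rightarrow> bool" where
  "second_order_close X Y p \<longleftrightarrow>
     (\<forall>\<epsilon>>0. \<forall>\<^sub>F y in nhds p. y \<in> Y \<longrightarrow> (\<exists>x\<in>X. norm (x - y) \<le> \<epsilon> * (norm (y - p))\<^sup>2))"

lemma plane_contact_second_order_close:
  assumes "plane_contact 2 X Y p"
  shows "second_order_close X Y p"
  unfolding second_order_close_def
proof (intro allI impI)
  fix \<epsilon> :: real assume \<epsilon>: "0 < \<epsilon>"
  obtain w1 w2 where w1: "C1_parameterization w1 X" and w2: "C1_parameterization w2 Y"
    and p: "w1 0 = p" "w2 0 = p" and v: "vector_derivative w2 (at 0) \<noteq> 0"
    and o: "(\<lambda>t. norm (w1 t - w2 t)) \<in> o[at 0](\<lambda>t. t ^ 2)"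
    using assms unfolding plane_contact_def by blast
  define v where "v = vector_derivative w2 (at 0)"
  have v0: "0 < norm v" using v by (simp add: v_def)
  have diff: "w2 C1_differentiable_on {- 1..1}" using w2 by (simp add: C1_parameterization_def)
  have dw: "(w2 has_vector_derivative v) (at 0)"
    using diff unfolding C1_differentiable_on_eq v_def by (simp add: vector_derivative_works[symmetric])
  then have "\<forall>e>0. \<exists>d>0. \<forall>t. norm (t - 0) < d \<longrightarrow> norm (w2 t - w2 0 - (t - 0) *\<^sub>R v) \<le> e * norm (t - 0)"
    unfolding has_vector_derivative_def has_derivative_at_alt by blast
  then have "\<exists>d>0. \<forall>t. norm (t - 0) < d \<longrightarrow> norm (w2 t - w2 0 - (t - 0) *\<^sub>R v) \<le> norm v / 2 * norm (t - 0)"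
    using v0 by (metis half_gt_zero)
  then obtain d1 where d1: "0 < d1" "\<And>t. \<bar>t\<bar> < d1 \<Longrightarrow> norm (w2 t - p - t *\<^sub>R v) \<le> norm v / 2 * \<bar>t\<bar>"
    unfolding p by auto
  have low: "norm v / 2 * \<bar>t\<bar> \<le> norm (w2 t - p)" if "\<bar>t\<bar> < d1" for t
    using d1(2)[OF that] norm_triangle_ineq2[of "t *\<^sub>R v" "t *\<^sub>R v - (w2 t - p)"]
    by (simp add: norm_minus_commute mult.commute)
  have "\<forall>\<^sub>F t in at 0. norm (norm (w1 t - w2 t)) \<le> (\<epsilon> * (norm v / 2)\<^sup>2) * norm (t ^ 2)"
    using landau_o.smallD[OF o] \<epsilon> v0 by simp
  then obtain d2 where d2: "0 < d2" "\<And>t. t \<noteq> 0 \<Longrightarrow> \<bar>t\<bar> < d2 \<Longrightarrow> norm (w1 t - w2 t) \<le> \<epsilon> * (norm v / 2)\<^sup>2 * t\<^sup>2"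
    by (auto simp: eventually_at dist_real_def)
  have img: "Y = w2 ` {- 1..1}" using w2 by (simp add: C1_parameterization_def)
  have near: "\<forall>\<^sub>F y in nhds (w2 0). y \<in> w2 ` {- 1..1} \<longrightarrow> (\<exists>t\<in>{- 1..1}. \<bar>t\<bar> < min d1 d2 \<and> y = w2 t)"
  proof (rule near_point_has_near_parameter)
    show "continuous_on {- 1..1} w2" by (rule C1_differentiable_imp_continuous_on[OF diff])
    fix \<tau> :: real assume \<tau>: "\<tau> \<in> {- 1..1}" "w2 \<tau> = w2 0"
    have inj: "inj_on w2 {- 1..<1}" and e: "w2 (- 1) = w2 1" using w2 by (auto simp: C1_parameterization_def)
    have "\<tau> \<noteq> 1" using \<tau>(2) e inj_onD[OF inj, of "- 1" 0] by auto
    then show "\<tau> = 0" using \<tau> inj_onD[OF inj, of \<tau> 0] by auto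
  qed (use d1 d2 in auto)
  then show "\<forall>\<^sub>F y in nhds p. y \<in> Y \<longrightarrow> (\<exists>x\<in>X. norm (x - y) \<le> \<epsilon> * (norm (y - p))\<^sup>2)"
    unfolding img[symmetric] p
  proof eventually_elim
    case (elim y)
    show ?case
    proof
      assume "y \<in> Y"
      then obtain t where t: "t \<in> {- 1..1}" "\<bar>t\<bar> < d1" "\<bar>t\<bar> < d2" "y = w2 t" using elim by auto
      have x: "w1 t \<in> X" using w1 t by (auto simp: C1_parameterization_def)
      have "norm (w1 t - w2 t) \<le> \<epsilon> * (norm v / 2)\<^sup>2 * t\<^sup>2" using d2(2)[of t] t p by (cases "t = 0") auto
      also have "\<dots> = \<epsilon> * (norm v / 2 * \<bar>t\<bar>)\<^sup>2" by (simp add: power_mult_distrib power_divide)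
      also have "\<dots> \<le> \<epsilon> * (norm (y - p))\<^sup>2"
        using low[OF t(2)] \<epsilon> v0 unfolding t(4) by (intro mult_left_mono power_mono) auto
      finally show "\<exists>x\<in>X. norm (x - y) \<le> \<epsilon> * (norm (y - p))\<^sup>2" using x t(4) by blast
    qed
  qed
qed

text \<open>
  Moebius transformations are bi-Lipschitz near points where they are finite.
\<close>

lemma second_order_close_transport:
  assumes close: "second_order_close X Y p"
    and nz: "c * p + d \<noteq> 0" and det: "a * d - b * c \<noteq> 0" and p0: "a * p + b = 0"
    and X': "\<And>z. c * z + d \<noteq> 0 \<Longrightarrow> z \<in> X \<longleftrightarrow> (a * z + b) / (c * z + d) \<in> X'"
    and Y': "\<And>z. c * z + d \<noteq> 0 \<Longrightarrow> z \<in> Y \<longleftrightarrow> (a * z + b) / (c * z + d) \<in> Y'"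
  shows "second_order_close X' Y' 0"
  unfolding second_order_close_def
proof (intro allI impI)
  fix \<epsilon> :: real assume \<epsilon>: "0 < \<epsilon>"
  define \<Delta> where "\<Delta> = a * d - b * c"
  have a0: "a \<noteq> 0" using det p0 by auto
  define \<mu> where "\<mu> = (\<lambda>y. (d * y - b) / (a - c * y))"
  have "b = - (a * p)" using p0 by (simp add: eq_neg_iff_add_eq_0 add.commute)
  then have \<mu>0: "\<mu> 0 = p" using a0 by (simp add: \<mu>_def)
  have \<mu>: "c * \<mu> y + d \<noteq> 0" "(a * \<mu> y + b) / (c * \<mu> y + d) = y" "\<mu> y - p = \<Delta> * y / (a * (a - c * y))"
    if "a - c * y \<noteq> 0" for y
  proof -
    have e: "c * \<mu> y + d = \<Delta> / (a - c * y)" "a * \<mu> y + b = y * \<Delta> / (a - c * y)"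
      unfolding \<mu>_def \<Delta>_def using that by (simp_all add: field_simps)
    then show "c * \<mu> y + d \<noteq> 0" "(a * \<mu> y + b) / (c * \<mu> y + d) = y" using det that by (auto simp: \<Delta>_def)
    have "a * (\<mu> y - p) = a * \<mu> y + b" using p0 by (simp add: algebra_simps add_eq_0_iff)
    then have "a * (\<mu> y - p) = y * \<Delta> / (a - c * y)" using e by simp
    then show "\<mu> y - p = \<Delta> * y / (a * (a - c * y))" using a0 that by (simp add: field_simps)
  qed
  define m where "m = norm (c * p + d)"
  define L where "L = 2 * norm \<Delta> / (norm a)\<^sup>2"
  define \<epsilon>' where "\<epsilon>' = \<epsilon> * m\<^sup>2 / (4 * norm \<Delta> * (L\<^sup>2 + 1))"
  have m: "0 < m" using nz by (simp add: m_def)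
  have \<Delta>: "0 < norm \<Delta>" using det by (simp add: \<Delta>_def)
  have L2: "0 < L\<^sup>2 + 1" by (simp add: add_nonneg_pos)
  have \<epsilon>': "0 < \<epsilon>'" using \<epsilon> m \<Delta> L2 by (simp add: \<epsilon>'_def)
  have lim\<mu>: "filterlim \<mu> (nhds p) (nhds 0)"
  proof -
    have "isCont \<mu> 0" unfolding \<mu>_def using a0 by (intro continuous_intros) auto
    then show ?thesis by (simp add: isCont_def \<mu>0 tendsto_nhds_iff)
  qed
  have ev_far: "\<forall>\<^sub>F z in nhds p. norm (c * z + d) > m / 2"
  proof -
    have "isCont (\<lambda>z. norm (c * z + d)) p" by (intro continuous_intros)
    then have "((\<lambda>z. norm (c * z + d)) \<longlongrightarrow> m) (nhds p)" by (simp add: isCont_def tendsto_nhds_iff m_def)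
    then show ?thesis using m by (intro order_tendstoD) auto
  qed
  then obtain \<rho> where \<rho>: "0 < \<rho>" "\<And>z. norm (z - p) < \<rho> \<Longrightarrow> norm (c * z + d) > m / 2"
    by (auto simp: eventually_nhds_metric dist_norm)
  have "\<forall>\<^sub>F y in nhds 0. norm (a - c * y) > norm a / 2"
  proof -
    have "isCont (\<lambda>y. norm (a - c * y)) 0" by (intro continuous_intros)
    then have "((\<lambda>y. norm (a - c * y)) \<longlongrightarrow> norm a) (nhds 0)" by (simp add: isCont_def tendsto_nhds_iff)
    then show ?thesis using a0 by (intro order_tendstoD) auto
  qed
  moreover have "\<forall>\<^sub>F y in nhds 0. \<mu> y \<in> Y \<longrightarrow> (\<exists>x\<in>X. norm (x - \<mu> y) \<le> \<epsilon>' * (norm (\<mu> y - p))\<^sup>2)"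
    using close \<epsilon>' unfolding second_order_close_def by (intro eventually_compose_filterlim[OF _ lim\<mu>]) blast
  moreover have "\<forall>\<^sub>F y in nhds 0. norm (\<mu> y - p) < min (\<rho> / 2) (\<rho> / (2 * \<epsilon>' * \<rho> + 1))"
    using tendstoD[OF lim\<mu>, of "min (\<rho> / 2) (\<rho> / (2 * \<epsilon>' * \<rho> + 1))"] \<rho>(1) \<epsilon>' by (simp add: dist_norm add_pos_pos)
  ultimately show "\<forall>\<^sub>F y in nhds 0. y \<in> Y' \<longrightarrow> (\<exists>x\<in>X'. norm (x - y) \<le> \<epsilon> * (norm (y - 0))\<^sup>2)"
  proof eventually_elim
    case (elim y)
    show ?case
    proof
      assume y: "y \<in> Y'"
      have ny: "a - c * y \<noteq> 0" using elim(1) a0 by (metis norm_zero not_less zero_le_divide_iff norm_ge_zero zero_le_numeral)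
      define u where "u = norm (\<mu> y - p)"
      have "\<mu> y \<in> Y" using Y'[OF \<mu>(1)[OF ny]] \<mu>(2)[OF ny] y by simp
      then obtain x where x: "x \<in> X" "norm (x - \<mu> y) \<le> \<epsilon>' * u\<^sup>2" using elim(2) by (auto simp: u_def)
      have u: "0 \<le> u" "u < \<rho> / 2" "u < \<rho> / (2 * \<epsilon>' * \<rho> + 1)" using elim(3) by (auto simp: u_def)
      have "\<epsilon>' * u\<^sup>2 \<le> \<rho> / 2"
      proof -
        have "u * (2 * \<epsilon>' * \<rho> + 1) \<le> \<rho>" using u(3) \<rho>(1) \<epsilon>' by (simp add: pos_less_divide_eq add_pos_pos less_imp_le)
        then have "u * (2 * \<epsilon>' * \<rho>) \<le> \<rho>" using u(1) by (simp add: distrib_left)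
        then have "\<epsilon>' * u \<le> 1 / 2" using \<rho>(1) by (simp add: mult_ac)
        then have "\<epsilon>' * u * u \<le> 1 / 2 * u" using u(1) by (rule mult_right_mono)
        then show ?thesis using u(2) \<rho>(1) by (simp add: power2_eq_square)
      qed
      then have "norm (x - p) < \<rho>"
        using norm_triangle_ineq[of "x - \<mu> y" "\<mu> y - p"] x(2) u(2) by (simp add: u_def)
      then have cx: "norm (c * x + d) > m / 2" by (rule \<rho>(2))
      have cy: "norm (c * \<mu> y + d) > m / 2" using u(2) \<rho> by (intro \<rho>(2)) (simp add: u_def)
      have cx0: "c * x + d \<noteq> 0" using cx m by auto
      have cy0: "c * \<mu> y + d \<noteq> 0" using cy m by auto
      have "u \<le> L * norm y"
      proof -
        have "u = norm \<Delta> * norm y / (norm a * norm (a - c * y))"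
          unfolding u_def \<mu>(3)[OF ny] by (simp add: norm_divide norm_mult)
        also have "\<dots> \<le> norm \<Delta> * norm y / (norm a * (norm a / 2))"
          using elim(1) a0 ny by (intro divide_left_mono mult_left_mono mult_pos_pos) auto
        also have "\<dots> = L * norm y" by (simp add: L_def power2_eq_square)
        finally show ?thesis .
      qed
      then have uL: "u\<^sup>2 \<le> L\<^sup>2 * (norm y)\<^sup>2" using u(1) by (metis power_mono power_mult_distrib)
      define x' where "x' = (a * x + b) / (c * x + d)"
      have "x' - y = \<Delta> * (x - \<mu> y) / ((c * x + d) * (c * \<mu> y + d))"
      proof -
        have "x' - y = (a * x + b) / (c * x + d) - (a * \<mu> y + b) / (c * \<mu> y + d)"
          using \<mu>(2)[OF ny] by (simp add: x'_def)
        also have "\<dots> = ((a * x + b) * (c * \<mu> y + d) - (a * \<mu> y + b) * (c * x + d)) / ((c * x + d) * (c * \<mu> y + d))"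
          using cx0 cy0 by (simp add: diff_frac_eq)
        also have "(a * x + b) * (c * \<mu> y + d) - (a * \<mu> y + b) * (c * x + d) = \<Delta> * (x - \<mu> y)"
          by (simp add: \<Delta>_def algebra_simps)
        finally show ?thesis .
      qed
      then have "norm (x' - y) = norm \<Delta> * norm (x - \<mu> y) / (norm (c * x + d) * norm (c * \<mu> y + d))"
        by (simp add: norm_divide norm_mult)
      also have "\<dots> \<le> norm \<Delta> * (\<epsilon>' * u\<^sup>2) / (m / 2 * (m / 2))"
        using x(2) cx cy m \<epsilon>' by (intro frac_le mult_mono mult_left_mono) auto
      also have "\<dots> \<le> norm \<Delta> * (\<epsilon>' * ((L\<^sup>2 + 1) * (norm y)\<^sup>2)) / (m / 2 * (m / 2))"
      proof -
        have "u\<^sup>2 \<le> (L\<^sup>2 + 1) * (norm y)\<^sup>2" using uL by (simp add: distrib_right add_increasing2)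
        then show ?thesis using \<epsilon>' m by (intro divide_right_mono mult_left_mono) auto
      qed
      also have "\<dots> = \<epsilon> * (norm y)\<^sup>2"
        using m \<Delta> L2 by (simp add: \<epsilon>'_def power2_eq_square)
      finally have "norm (x' - y) \<le> \<epsilon> * (norm (y - 0))\<^sup>2" by simp
      moreover have "x' \<in> X'" using X'[OF cx0] x(1) by (simp add: x'_def)
      ultimately show "\<exists>x\<in>X'. norm (x - y) \<le> \<epsilon> * (norm (y - 0))\<^sup>2" by blast
    qed
  qed
qed

text \<open>
  Points \<open>y\<close> of \<open>Y\<close> near \<open>0\<close> are within \<open>o(\<bar>y\<bar>\<^sup>2)\<close> of points of \<open>X\<close>, where the imaginary part is \<open>O(\<bar>y\<bar>\<^sup>3)\<close>. Hence
  \<open>Im (w \<tau>) = o(\<tau>\<^sup>2)\<close>, and evaluation at \<open>\<tau>\<close> and \<open>-\<tau>\<close> separates the two coefficients.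
\<close>

lemma second_order_close_imp_real_2_jet:
  assumes flat: "\<And>z. z \<in> X \<Longrightarrow> norm z < \<eta> \<Longrightarrow> \<bar>Im z - c * Re z * (norm z)\<^sup>2\<bar> \<le> K * \<bar>Re z\<bar> powr s"
    and \<eta>: "0 < \<eta>" and K: "0 \<le> K" and s: "3 < s"
    and arc: "local_arc s' Y w 0 a1 a2 a3" and s': "3 < s'"
    and close: "second_order_close X Y 0"
  shows "Im a1 = 0" "Im a2 = 0"
proof -
  have jet: "jet3 s' w 0 a1 a2 a3" using arc by (auto simp: local_arc_def)
  obtain A \<delta> where A: "0 < \<delta>" "0 \<le> A" "\<delta> \<le> 1"
      "\<And>\<tau>. \<bar>\<tau>\<bar> < \<delta> \<Longrightarrow> norm (w \<tau> - 0 - a1 * of_real \<tau> - a2 * of_real \<tau> ^ 2) \<le> A * \<bar>\<tau>\<bar> ^ 3"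
    using jet3_bounded[OF jet s'] by blast
  define L where "L = norm a1 + norm a2 + A"
  have L: "0 \<le> L" using A by (simp add: L_def)
  have wL: "norm (w \<tau>) \<le> L * \<bar>\<tau>\<bar>" if \<tau>: "\<bar>\<tau>\<bar> < \<delta>" for \<tau>
  proof -
    have pw: "\<bar>\<tau>\<bar> ^ n \<le> \<bar>\<tau>\<bar>" if "1 \<le> n" for n
      using power_decreasing[of 1 n "\<bar>\<tau>\<bar>"] that \<tau> A by simp
    have "w \<tau> = (w \<tau> - 0 - a1 * of_real \<tau> - a2 * of_real \<tau> ^ 2) + (a1 * of_real \<tau> + a2 * of_real \<tau> ^ 2)" by simp
    also have "norm \<dots> \<le> A * \<bar>\<tau>\<bar> ^ 3 + (norm a1 * \<bar>\<tau>\<bar> + norm a2 * \<bar>\<tau>\<bar> ^ 2)"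
      using A(4)[OF \<tau>] by (intro norm_triangle_le add_mono) (auto simp: norm_mult norm_power)
    also have "\<dots> \<le> A * \<bar>\<tau>\<bar> + (norm a1 * \<bar>\<tau>\<bar> + norm a2 * \<bar>\<tau>\<bar>)"
      using pw[of 3] pw[of 2] A by (intro add_mono mult_left_mono) auto
    also have "\<dots> = L * \<bar>\<tau>\<bar>" by (simp add: L_def algebra_simps)
    finally show ?thesis .
  qed
  have w0: "w 0 = 0" by (rule jet3_0[OF jet])
  have limw: "filterlim w (nhds 0) (nhds 0)"
  proof -
    have "\<exists>w'. (w has_vector_derivative w') (at 0)" using arc by (auto simp: local_arc_def dest: eventually_nhds_x_imp_x)
    then have "isCont w 0" using has_vector_derivative_continuous by blast
    then show ?thesis by (simp add: isCont_def w0 tendsto_nhds_iff)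
  qed
  have small: "\<forall>\<^sub>F \<tau> in nhds 0. \<bar>Im (w \<tau>)\<bar> \<le> \<epsilon> * \<tau>\<^sup>2" if \<epsilon>: "0 < \<epsilon>" for \<epsilon>
  proof -
    define \<epsilon>' where "\<epsilon>' = \<epsilon> / (2 * (L\<^sup>2 + 1))"
    have L2: "0 < L\<^sup>2 + 1" by (simp add: add_nonneg_pos)
    have \<epsilon>': "0 < \<epsilon>'" using \<epsilon> L2 by (simp add: \<epsilon>'_def)
    define B where "B = \<bar>c\<bar> + K"
    have B: "0 \<le> B" using K by (simp add: B_def)
    define m where "m = min (min (\<eta> / 2) (1 / 2)) (min (1 / \<epsilon>') (\<epsilon>' / (8 * B + 1)))"
    have m: "0 < m" using \<eta> \<epsilon>' B by (simp add: m_def add_nonneg_pos)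
    have "\<forall>\<^sub>F \<tau> in nhds 0. w \<tau> \<in> Y \<longrightarrow> (\<exists>x\<in>X. norm (x - w \<tau>) \<le> \<epsilon>' * (norm (w \<tau> - 0))\<^sup>2)"
      using close \<epsilon>' unfolding second_order_close_def by (intro eventually_compose_filterlim[OF _ limw]) blast
    moreover have "\<forall>\<^sub>F \<tau> in nhds 0. w \<tau> \<in> Y" using arc by (auto simp: local_arc_def)
    moreover have "\<forall>\<^sub>F \<tau> in nhds 0. norm (w \<tau>) < m" using tendstoD[OF limw m] by simp
    moreover have "\<forall>\<^sub>F \<tau> in nhds (0::real). \<bar>\<tau>\<bar> < \<delta>" using A(1) by (auto simp: eventually_nhds_metric dist_real_def)
    ultimately show ?thesis
    proof eventually_elim
      case (elim \<tau>)
      define y where "y = w \<tau>"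
      obtain x where x: "x \<in> X" "norm (x - y) \<le> \<epsilon>' * (norm y)\<^sup>2" using elim(1,2) by (auto simp: y_def)
      have y: "norm y < \<eta> / 2" "norm y < 1 / 2" "norm y < 1 / \<epsilon>'" "norm y < \<epsilon>' / (8 * B + 1)"
        using elim(3) by (auto simp: y_def m_def)
      have "\<epsilon>' * norm y \<le> 1" using y(3) \<epsilon>' by (simp add: field_simps)
      then have "\<epsilon>' * norm y * norm y \<le> 1 * norm y" by (rule mult_right_mono) simp
      then have "norm (x - y) \<le> norm y" using x(2) by (simp add: power2_eq_square mult.assoc)
      then have x2: "norm x \<le> 2 * norm y" using norm_triangle_ineq[of "x - y" y] by simp
      have "\<bar>Im x\<bar> \<le> B * (norm x) ^ 3"
      proof -
        have "\<bar>Re x\<bar> powr s \<le> (norm x) powr s" using s abs_Re_le_cmod by (intro powr_mono2) auto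
        also have "\<dots> \<le> (norm x) powr 3" using x2 y(2) s by (intro powr_mono') auto
        finally have "K * \<bar>Re x\<bar> powr s \<le> K * (norm x) ^ 3" using K by (intro mult_left_mono) auto
        moreover have "\<bar>c * Re x * (norm x)\<^sup>2\<bar> \<le> \<bar>c\<bar> * (norm x) ^ 3"
        proof -
          have "\<bar>c\<bar> * \<bar>Re x\<bar> * (norm x)\<^sup>2 \<le> \<bar>c\<bar> * norm x * (norm x)\<^sup>2"
            using abs_Re_le_cmod by (intro mult_right_mono mult_left_mono) auto
          then show ?thesis by (simp add: abs_mult power2_eq_square power3_eq_cube mult.assoc)
        qed
        moreover have "\<bar>Im x - c * Re x * (norm x)\<^sup>2\<bar> \<le> K * \<bar>Re x\<bar> powr s"
          using flat[OF x(1)] x2 y(1) by linarith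
        moreover have "B * (norm x) ^ 3 = \<bar>c\<bar> * (norm x) ^ 3 + K * (norm x) ^ 3" by (simp add: B_def distrib_right)
        ultimately show ?thesis by linarith
      qed
      also have "\<dots> \<le> B * (2 * norm y) ^ 3" using x2 B by (intro mult_left_mono power_mono) auto
      also have "\<dots> = (8 * B * norm y) * (norm y)\<^sup>2" by (simp add: power2_eq_square power3_eq_cube)
      also have "\<dots> \<le> \<epsilon>' * (norm y)\<^sup>2"
      proof (rule mult_right_mono)
        have "norm y * (8 * B + 1) \<le> \<epsilon>'" using y(4) B by (simp add: pos_less_divide_eq less_imp_le)
        moreover have "norm y * (8 * B + 1) = 8 * B * norm y + norm y" by (simp add: algebra_simps)
        ultimately show "8 * B * norm y \<le> \<epsilon>'" using norm_ge_zero[of y] by linarith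
      qed simp
      finally have "\<bar>Im x\<bar> \<le> \<epsilon>' * (norm y)\<^sup>2" .
      then have "\<bar>Im y\<bar> \<le> 2 * \<epsilon>' * (norm y)\<^sup>2" using x(2) abs_Im_le_cmod[of "x - y"] by simp
      also have "\<dots> \<le> 2 * \<epsilon>' * (L * \<bar>\<tau>\<bar>)\<^sup>2"
        using wL[OF elim(4)] \<epsilon>' by (intro mult_left_mono power_mono) (auto simp: y_def)
      also have "\<dots> \<le> 2 * \<epsilon>' * ((L\<^sup>2 + 1) * \<tau>\<^sup>2)"
        using \<epsilon>' by (intro mult_left_mono) (auto simp: power_mult_distrib distrib_right)
      also have "\<dots> = \<epsilon> * \<tau>\<^sup>2"
      proof -
        have "2 * (\<epsilon> / (2 * N)) * (N * T) = \<epsilon> * T" if "0 < N" for N T :: real using that by simp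
        then show ?thesis using L2 unfolding \<epsilon>'_def by blast
      qed
      finally show ?case by (simp add: y_def)
    qed
  qed
  have ineq: "\<exists>\<tau>>0. \<tau> < \<epsilon> \<and> \<bar>Im a1\<bar> \<le> \<epsilon> * \<tau> + A * \<tau>\<^sup>2 \<and> \<bar>Im a2\<bar> \<le> \<epsilon> + A * \<tau>" if \<epsilon>: "0 < \<epsilon>" for \<epsilon>
  proof -
    obtain d where d: "0 < d" "\<And>\<tau>. \<bar>\<tau>\<bar> < d \<Longrightarrow> \<bar>Im (w \<tau>)\<bar> \<le> \<epsilon> * \<tau>\<^sup>2"
      using small[OF \<epsilon>] by (auto simp: eventually_nhds_metric dist_real_def)
    define \<tau> where "\<tau> = min (min d \<delta>) \<epsilon> / 2"
    have \<tau>: "0 < \<tau>" "\<tau> < d" "\<tau> < \<delta>" "\<tau> < \<epsilon>" using d A \<epsilon> by (auto simp: \<tau>_def)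
    have 1: "\<bar>Im a1 * t + Im a2 * t\<^sup>2\<bar> \<le> \<epsilon> * t\<^sup>2 + A * \<bar>t\<bar> ^ 3" if "\<bar>t\<bar> = \<tau>" for t
    proof -
      have "\<bar>Im (w t - 0 - a1 * of_real t - a2 * of_real t ^ 2)\<bar> \<le> A * \<bar>t\<bar> ^ 3"
        using A(4)[of t] that \<tau> abs_Im_le_cmod[of "w t - 0 - a1 * of_real t - a2 * of_real t ^ 2"] by simp
      moreover have "Im (w t - 0 - a1 * of_real t - a2 * of_real t ^ 2) = Im (w t) - (Im a1 * t + Im a2 * t\<^sup>2)"
        unfolding of_real_power[symmetric] by simp
      ultimately show ?thesis using d(2)[of t] that \<tau> by linarith
    qed
    have p: "\<bar>Im a1 * \<tau> + Im a2 * \<tau>\<^sup>2\<bar> \<le> \<epsilon> * \<tau>\<^sup>2 + A * \<tau> ^ 3" using 1[of \<tau>] \<tau> by simp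
    have n: "\<bar>- (Im a1 * \<tau>) + Im a2 * \<tau>\<^sup>2\<bar> \<le> \<epsilon> * \<tau>\<^sup>2 + A * \<tau> ^ 3" using 1[of "- \<tau>"] \<tau> by simp
    have "\<bar>Im a1 * \<tau>\<bar> \<le> \<epsilon> * \<tau>\<^sup>2 + A * \<tau> ^ 3" "\<bar>Im a2 * \<tau>\<^sup>2\<bar> \<le> \<epsilon> * \<tau>\<^sup>2 + A * \<tau> ^ 3"
      using p n by linarith+
    then have "\<bar>Im a1\<bar> * \<tau> \<le> (\<epsilon> * \<tau> + A * \<tau>\<^sup>2) * \<tau>" "\<bar>Im a2\<bar> * \<tau>\<^sup>2 \<le> (\<epsilon> + A * \<tau>) * \<tau>\<^sup>2"
      using \<tau> by (simp_all add: abs_mult power2_eq_square power3_eq_cube algebra_simps)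
    then show ?thesis using \<tau> by (intro exI[of _ \<tau>]) auto
  qed
  have "\<bar>Im a1\<bar> \<le> e \<and> \<bar>Im a2\<bar> \<le> e" if e: "0 < e" for e
  proof -
    define \<epsilon> where "\<epsilon> = min 1 (e / (1 + A))"
    have \<epsilon>: "0 < \<epsilon>" "\<epsilon> \<le> 1" "\<epsilon> \<le> e / (1 + A)" using e A by (auto simp: \<epsilon>_def)
    have \<epsilon>A: "(1 + A) * \<epsilon> \<le> e" using \<epsilon>(3) A by (subst (asm) pos_le_divide_eq) (auto simp: mult.commute)
    obtain \<tau> where \<tau>: "0 < \<tau>" "\<tau> < \<epsilon>" "\<bar>Im a1\<bar> \<le> \<epsilon> * \<tau> + A * \<tau>\<^sup>2" "\<bar>Im a2\<bar> \<le> \<epsilon> + A * \<tau>"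
      using ineq[OF \<epsilon>(1)] by blast
    have "A * \<tau> \<le> A * \<epsilon>" using \<tau> A by (intro mult_left_mono) auto
    moreover have "\<epsilon> * \<tau> \<le> \<epsilon> * 1" using \<tau> \<epsilon> by (intro mult_left_mono) auto
    moreover have "A * \<tau>\<^sup>2 \<le> A * \<tau>" using \<tau> \<epsilon> A by (intro mult_left_mono) (auto simp: power2_eq_square mult_left_le)
    ultimately show ?thesis using \<tau> \<epsilon>A unfolding distrib_right by linarith
  qed
  then have "\<bar>Im a1\<bar> \<le> 0" "\<bar>Im a2\<bar> \<le> 0" by (meson field_le_epsilon dense_ge linorder_not_le)+
  then show "Im a1 = 0" "Im a2 = 0" by simp_all
qed

abbreviation chart_set :: "(ecomplex \<Rightarrow> ecomplex) \<Rightarrow> ecomplex set \<Rightarrow> complex set" where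
  "chart_set M S \<equiv> {w. M (Some w) \<in> S}"

text \<open>
  The coefficients belong to the transition from the chart \<^term>\<open>T\<close> to the inverse chart \<^term>\<open>M\<close>; they are the
  same for all sets.
\<close>

lemma chart_transition:
  assumes M: "moebius_transformation M" and T: "moebius_transformation T"
    and q: "M (Some 0) = P" "T P = Some q"
  obtains a b c d where "a * d - b * c \<noteq> 0" "c * q + d \<noteq> 0" "a * q + b = 0"
    "\<And>S X z. T ` S = Some ` X \<Longrightarrow> c * z + d \<noteq> 0 \<Longrightarrow>
       z \<in> X \<longleftrightarrow> (a * z + b) / (c * z + d) \<in> chart_set M S"
proof -
  obtain M' where M': "moebius_transformation M'" "\<And>x. M' (M x) = x" "\<And>x. M (M' x) = x"
    using moebius_transformation_inverse[OF M] by metis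
  obtain T' where T': "moebius_transformation T'" "\<And>x. T' (T x) = x" "\<And>x. T (T' x) = x"
    using moebius_transformation_inverse[OF T] by metis
  have N: "moebius_transformation (\<lambda>x. M' (T' x))" by (rule moebius_transformation_compose[OF M'(1) T'(1)])
  have N0: "M' (T' (Some q)) = Some 0" using q T'(2) M'(2) by metis
  obtain a b c d where abcd: "a * d - b * c \<noteq> 0" "c * q + d \<noteq> 0" "0 = (a * q + b) / (c * q + d)"
    "\<And>z. c * z + d \<noteq> 0 \<Longrightarrow> M' (T' (Some z)) = Some ((a * z + b) / (c * z + d))"
    using moebius_transformation_finite[OF N N0] by metis
  show thesis
  proof (rule that[OF abcd(1,2)])
    show "a * q + b = 0" using abcd(2,3) by simp
    fix S X z assume TS: "T ` S = Some ` X" and z: "c * z + d \<noteq> 0"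
    have "M (Some ((a * z + b) / (c * z + d))) = T' (Some z)" using abcd(4)[OF z] M'(3) by metis
    moreover have "z \<in> X \<longleftrightarrow> T' (Some z) \<in> S"
    proof
      assume "z \<in> X"
      then have "Some z \<in> T ` S" using TS by simp
      then show "T' (Some z) \<in> S" using T'(2) by auto
    next
      assume "T' (Some z) \<in> S"
      then have "Some z \<in> T ` S" using T'(3) by (metis imageI)
      then show "z \<in> X" using TS by auto
    qed
    ultimately show "z \<in> X \<longleftrightarrow> (a * z + b) / (c * z + d) \<in> chart_set M S" by simp
  qed
qed

lemma smooth_curve_arc_in_chart:
  assumes S: "smooth_curve 3 S" "P \<in> S" and M: "moebius_transformation M" "M (Some 0) = P"
  obtains s w a1 a2 a3 where "3 < s" "s < 4" "local_arc s (chart_set M S) w 0 a1 a2 a3"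
proof -
  obtain T X where T: "moebius_transformation T" "T ` S = Some ` X" "smooth_plane_curve 3 X"
    using S by (auto simp: smooth_curve_def)
  obtain q where q: "T P = Some q" "q \<in> X" using S T by blast
  obtain s w a1 a2 a3 where arc: "3 < s" "s < 4" "local_arc s X w q a1 a2 a3"
    using smooth_plane_curve_local_arc[OF T(3) q(2)] by blast
  obtain a b c d where t: "a * d - b * c \<noteq> 0" "c * q + d \<noteq> 0" "a * q + b = 0"
    "\<And>z. c * z + d \<noteq> 0 \<Longrightarrow> z \<in> X \<longleftrightarrow> (a * z + b) / (c * z + d) \<in> chart_set M S"
    using chart_transition[OF M(1) T(1) M(2) q(1)] T(2) by metis
  define q1 where "q1 = a * a1 / (c * q + d)"
  define q2 where "q2 = (a * a2 - q1 * (c * a1)) / (c * q + d)"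
  obtain q3 where "local_arc s (chart_set M S) (\<lambda>\<tau>. (a * w \<tau> + b) / (c * w \<tau> + d)) 0 q1 q2 q3"
    by (rule local_arc_transport[OF arc(3,1) _ t(2,1,4), of 0 q1 q2])
       (use arc(2) t in \<open>simp_all add: q1_def q2_def\<close>)
  then show thesis using that arc by blast
qed

text \<open>
  The Moebius transformation \<open>(z - q) / (a1 + (a2 / a1) (z - q))\<close> inverts the \<open>2\<close>-jet \<open>q + a1 \<tau> + a2 \<tau>\<^sup>2\<close> of
  the curve.
\<close>

lemma osculating_chart:
  assumes S: "smooth_curve 3 S" "P \<in> S"
  obtains M s w a3 where "moebius_transformation M" "M (Some 0) = P" "3 < s" "s < 4"
    "local_arc s (chart_set M S) w 0 1 0 a3"
proof -
  obtain T X where T: "moebius_transformation T" "T ` S = Some ` X" "smooth_plane_curve 3 X"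
    using S by (auto simp: smooth_curve_def)
  obtain q where q: "T P = Some q" "q \<in> X" using S T by blast
  obtain s w a1 a2 a3 where arc: "3 < s" "s < 4" "local_arc s X w q a1 a2 a3"
    using smooth_plane_curve_local_arc[OF T(3) q(2)] by blast
  have a1: "a1 \<noteq> 0" using arc by (simp add: local_arc_def)
  define c where "c = a2 / a1"
  define d where "d = a1 - c * q"
  have det: "1 * d - (- q) * c \<noteq> 0" using a1 by (simp add: d_def)
  have nz: "c * q + d \<noteq> 0" using a1 by (simp add: d_def)
  obtain T' where T': "moebius_transformation T'" "\<And>x. T' (T x) = x" "\<And>x. T (T' x) = x"
    using moebius_transformation_inverse[OF T(1)] by metis
  define E where "E = moebius_ext 1 (- q) c d"
  have "moebius_transformation E" unfolding E_def moebius_transformation_def using det by blast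
  then obtain E' where E': "moebius_transformation E'" "\<And>x. E' (E x) = x" "\<And>x. E (E' x) = x"
    using moebius_transformation_inverse by metis
  define M where "M = (\<lambda>x. T' (E' x))"
  have M: "moebius_transformation M" unfolding M_def by (rule moebius_transformation_compose[OF T'(1) E'(1)])
  have EE: "E (Some z) = Some ((1 * z + - q) / (c * z + d))" if "c * z + d \<noteq> 0" for z
    using that by (simp add: E_def moebius_ext_def moebius_def)
  have Mz: "M (Some ((1 * z + - q) / (c * z + d))) = T' (Some z)" if "c * z + d \<noteq> 0" for z
    using EE[OF that] E'(2) unfolding M_def by metis
  have M0: "M (Some 0) = P" using Mz[OF nz] q T'(2) by (metis add.right_inverse div_0 mult_1)
  have X: "z \<in> X \<longleftrightarrow> (1 * z + - q) / (c * z + d) \<in> chart_set M S" if "c * z + d \<noteq> 0" for z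
  proof -
    have "z \<in> X \<longleftrightarrow> T' (Some z) \<in> S"
    proof
      assume "z \<in> X"
      then have "Some z \<in> T ` S" using T(2) by simp
      then show "T' (Some z) \<in> S" using T'(2) by auto
    next
      assume "T' (Some z) \<in> S"
      then have "Some z \<in> T ` S" using T'(3) by (metis imageI)
      then show "z \<in> X" using T(2) by auto
    qed
    then show ?thesis using Mz[OF that] by simp
  qed
  obtain q3 where "local_arc s (chart_set M S) (\<lambda>\<tau>. (1 * w \<tau> + - q) / (c * w \<tau> + d)) 0 1 0 q3"
    by (rule local_arc_transport[OF arc(3,1) _ nz det X, of 0 1 0])
       (use arc(2) a1 in \<open>simp_all add: c_def d_def\<close>)
  then show thesis using that M M0 arc by blast
qed

lemma contact_second_order_close:
  assumes con: "contact 2 S S' P" and M: "moebius_transformation M" "M (Some 0) = P"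
  shows "second_order_close (chart_set M S) (chart_set M S') 0"
proof -
  obtain T X Y q where T: "moebius_transformation T" "T ` S = Some ` X" "T ` S' = Some ` Y" "T P = Some q"
    and pc: "plane_contact 2 X Y q" using con unfolding contact_def by (elim exE conjE) (rule that)
  obtain a b c d where t: "a * d - b * c \<noteq> 0" "c * q + d \<noteq> 0" "a * q + b = 0"
    "\<And>S X z. T ` S = Some ` X \<Longrightarrow> c * z + d \<noteq> 0 \<Longrightarrow>
       z \<in> X \<longleftrightarrow> (a * z + b) / (c * z + d) \<in> chart_set M S"
    using chart_transition[OF M(1) T(1) M(2) T(4)] by metis
  show ?thesis
    by (rule second_order_close_transport[OF plane_contact_second_order_close[OF pc] t(2,1,3) t(4)[OF T(2)] t(4)[OF T(3)]])
qed

section \<open>Flat curves and the domains beside them\<close>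

text \<open>
  The last clause says that the set is a graph over the real axis near \<open>0\<close>.
\<close>

definition flat_at_0 :: "complex set \<Rightarrow> real \<Rightarrow> real \<Rightarrow> real \<Rightarrow> real \<Rightarrow> bool" where
  "flat_at_0 X c K s \<eta> \<longleftrightarrow> 0 < \<eta> \<and> 0 \<le> K \<and> 3 < s \<and> s < 4 \<and>
     (\<forall>z\<in>X. norm z < \<eta> \<longrightarrow> \<bar>Im z - c * Re z * (norm z)\<^sup>2\<bar> \<le> K * \<bar>Re z\<bar> powr s) \<and>
     (\<forall>z\<in>X. \<forall>z'\<in>X. norm z < \<eta> \<longrightarrow> norm z' < \<eta> \<longrightarrow> Re z = Re z' \<longrightarrow> z = z')"

definition upper_side :: "real \<Rightarrow> real \<Rightarrow> real \<Rightarrow> complex set" where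
  "upper_side c K s = {w. c * Re w * (norm w)\<^sup>2 + K * \<bar>Re w\<bar> powr s < Im w}"

definition lower_side :: "real \<Rightarrow> real \<Rightarrow> real \<Rightarrow> complex set" where
  "lower_side c K s = {w. Im w < c * Re w * (norm w)\<^sup>2 - K * \<bar>Re w\<bar> powr s}"

text \<open>
  On a small square the height above the model curve increases along vertical lines, so that it
  decides which of two points on such a line is the upper one.
\<close>

lemma height_above_cubic_strict_mono:
  fixes c \<eta> x y1 y2 :: real
  assumes "\<bar>c\<bar> * \<eta> * (2 * \<eta>) < 1" "\<bar>x\<bar> < \<eta>" "\<bar>y1\<bar> < \<eta>" "\<bar>y2\<bar> < \<eta>"
    and "y1 - c * x * (x\<^sup>2 + y1\<^sup>2) < y2 - c * x * (x\<^sup>2 + y2\<^sup>2)"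
  shows "y1 < y2"
proof (rule ccontr)
  assume "\<not> y1 < y2"
  then have le: "0 \<le> y1 - y2" by simp
  have "\<bar>c * x * (y1 + y2)\<bar> \<le> \<bar>c\<bar> * \<eta> * (2 * \<eta>)"
    unfolding abs_mult using assms by (intro mult_mono) auto
  then have "0 \<le> 1 - c * x * (y1 + y2)" using assms(1) by linarith
  then have "0 \<le> (y1 - y2) * (1 - c * x * (y1 + y2))" using le by (rule mult_nonneg_nonneg[rotated])
  also have "\<dots> = (y1 - c * x * (x\<^sup>2 + y1\<^sup>2)) - (y2 - c * x * (x\<^sup>2 + y2\<^sup>2))"
    by (simp add: algebra_simps power2_eq_square)
  finally show False using assms(5) by simp
qed

lemma chart_local_graph:
  assumes T: "moebius_transformation T" "T ` S = Some ` X" and X: "X homeomorphic sphere (0::complex) 1"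
    and M: "moebius_transformation M" "M (Some 0) \<in> S" and flat: "flat_at_0 (chart_set M S) c K s \<eta>0"
  obtains \<eta> E Y where "local_graph X E \<eta> Y"
    "\<And>w. \<bar>Re w\<bar> < \<eta> \<Longrightarrow> \<bar>Im w\<bar> < \<eta> \<Longrightarrow> T (M (Some w)) = Some (E w)"
    "\<And>w. \<bar>Re w\<bar> < \<eta> \<Longrightarrow> \<bar>Im w\<bar> < \<eta> \<Longrightarrow> w \<in> upper_side c K s \<Longrightarrow> w \<in> above \<eta> Y"
    "\<And>w. \<bar>Re w\<bar> < \<eta> \<Longrightarrow> \<bar>Im w\<bar> < \<eta> \<Longrightarrow> w \<in> lower_side c K s \<Longrightarrow> w \<in> below \<eta> Y"
proof -
  have \<eta>0: "0 < \<eta>0" and K: "0 \<le> K" and s: "3 < s" "s < 4"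
    and fl: "\<And>z. M (Some z) \<in> S \<Longrightarrow> norm z < \<eta>0 \<Longrightarrow> \<bar>Im z - c * Re z * (norm z)\<^sup>2\<bar> \<le> K * \<bar>Re z\<bar> powr s"
    and gr: "\<And>z z'. M (Some z) \<in> S \<Longrightarrow> M (Some z') \<in> S \<Longrightarrow> norm z < \<eta>0 \<Longrightarrow> norm z' < \<eta>0 \<Longrightarrow> Re z = Re z' \<Longrightarrow> z = z'"
    using flat by (auto simp: flat_at_0_def)
  obtain q where q: "T (M (Some 0)) = Some q" using M(2) T(2) by blast
  have N: "moebius_transformation (\<lambda>x. T (M x))" by (rule moebius_transformation_compose[OF T(1) M(1)])
  obtain a b c' d where N1: "a * d - b * c' \<noteq> 0" "c' * 0 + d \<noteq> 0"
    "\<And>z. c' * z + d \<noteq> 0 \<Longrightarrow> T (M (Some z)) = Some ((a * z + b) / (c' * z + d))"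
    using moebius_transformation_finite[OF N q] by metis
  define E where "E = (\<lambda>z. (a * z + b) / (c' * z + d))"
  \<comment> \<open>small enough for flatness, for finiteness of \<open>E\<close>, and for the cubic terms to be negligible against \<open>\<eta>\<close>\<close>
  define \<eta> where "\<eta> = min (min (\<eta>0 / 2) (1 / 2)) (min (norm d / (2 * (norm c' + 1))) (1 / (16 * (\<bar>c\<bar> + K + 1))))"
  have h: "\<eta> \<le> \<eta>0 / 2" "\<eta> \<le> 1 / 2" "\<eta> \<le> norm d / (2 * (norm c' + 1))" "\<eta> \<le> 1 / (16 * (\<bar>c\<bar> + K + 1))"
    unfolding \<eta>_def by (meson min.cobounded1 min.cobounded2 order_trans)+
  have d0: "d \<noteq> 0" using N1(2) by simp
  have \<eta>: "0 < \<eta>" using \<eta>0 d0 K by (simp add: \<eta>_def add_nonneg_pos)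
  have h4: "16 * (\<bar>c\<bar> + K + 1) * \<eta> \<le> 1" using h(4) K by (simp add: field_simps)
  have n2: "norm w < 2 * \<eta>" if "\<bar>Re w\<bar> < \<eta>" "\<bar>Im w\<bar> < \<eta>" for w using cmod_le[of w] that by linarith
  have nz: "c' * w + d \<noteq> 0" if "norm w < 2 * \<eta>" for w
  proof
    assume "c' * w + d = 0"
    then have "norm d = norm c' * norm w" by (metis add_eq_0_iff norm_minus_cancel norm_mult)
    also have "\<dots> \<le> norm c' * (2 * \<eta>)" using that by (intro mult_left_mono) auto
    also have "\<dots> \<le> norm c' * (norm d / (norm c' + 1))"
    proof (rule mult_left_mono)
      have n1: "0 < norm c' + 1" by (simp add: add_nonneg_pos)
      then have n2: "0 < 2 * (norm c' + 1)" by simp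
      have "\<eta> * (2 * (norm c' + 1)) \<le> norm d" using h(3) unfolding pos_le_divide_eq[OF n2] .
      then show "2 * \<eta> \<le> norm d / (norm c' + 1)" by (subst pos_le_divide_eq[OF n1]) (simp add: mult_ac)
    qed simp
    also have "\<dots> < norm d"
    proof -
      have n1: "0 < norm c' + 1" by (simp add: add_nonneg_pos)
      have "norm c' * norm d < norm d * (norm c' + 1)" using d0 by (simp add: algebra_simps)
      then show ?thesis using n1 by (simp only: times_divide_eq_right pos_divide_less_eq)
    qed
    finally show False by simp
  qed
  have TM: "T (M (Some w)) = Some (E w)" if "\<bar>Re w\<bar> < \<eta>" "\<bar>Im w\<bar> < \<eta>" for w
    using N1(3)[OF nz[OF n2[OF that]]] by (simp add: E_def)
  have inX: "E w \<in> X \<longleftrightarrow> M (Some w) \<in> S" if "\<bar>Re w\<bar> < \<eta>" "\<bar>Im w\<bar> < \<eta>" for w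
  proof -
    have "E w \<in> X \<longleftrightarrow> Some (E w) \<in> T ` S" unfolding T(2) by auto
    also have "\<dots> \<longleftrightarrow> M (Some w) \<in> S" unfolding TM[OF that, symmetric]
      using moebius_transformation_eq_iff[OF T(1)] by auto
    finally show ?thesis .
  qed
  define Q where "Q = {w::complex. \<bar>Re w\<bar> < \<eta> \<and> \<bar>Im w\<bar> < \<eta>}"
  define Y where "Y = {w. \<bar>Re w\<bar> < \<eta> \<and> \<bar>Im w\<bar> < \<eta> \<and> E w \<in> X}"
  have Yfl: "\<bar>Im y - c * Re y * (norm y)\<^sup>2\<bar> \<le> K * \<bar>Re y\<bar> powr s" "\<bar>Re y\<bar> < \<eta>" "\<bar>Im y\<bar> < \<eta>" "M (Some y) \<in> S" "norm y < \<eta>0"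
    if "y \<in> Y" for y
  proof -
    show r: "\<bar>Re y\<bar> < \<eta>" "\<bar>Im y\<bar> < \<eta>" and "M (Some y) \<in> S" using that inX by (auto simp: Y_def)
    moreover show "norm y < \<eta>0" using n2[OF r] h(1) by simp
    ultimately show "\<bar>Im y - c * Re y * (norm y)\<^sup>2\<bar> \<le> K * \<bar>Re y\<bar> powr s" using fl by blast
  qed
  have openQ: "open Q" unfolding Q_def
    by (intro open_Collect_conj open_Collect_less continuous_intros)
  have holE: "E holomorphic_on Q" unfolding E_def
    by (intro holomorphic_intros) (use nz n2 in \<open>auto simp: Q_def\<close>)
  have injE: "inj_on E Q"
  proof (rule inj_onI)
    fix v w assume vw: "v \<in> Q" "w \<in> Q" "E v = E w"
    then have "T (M (Some v)) = T (M (Some w))" using TM by (auto simp: Q_def)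
    then show "v = w" using moebius_transformation_eq_iff[OF T(1)] moebius_transformation_eq_iff[OF M(1)] by auto
  qed
  have lg: "local_graph X E \<eta> Y"
  proof
    show "X homeomorphic sphere (0::complex) 1" by (rule X)
    show "0 < \<eta>" by (rule \<eta>)
    show "continuous_on {w. \<bar>Re w\<bar> < \<eta> \<and> \<bar>Im w\<bar> < \<eta>} E"
      using holomorphic_on_imp_continuous_on[OF holE] by (simp add: Q_def)
    show "open (E ` {w. \<bar>Re w\<bar> < \<eta> \<and> \<bar>Im w\<bar> < \<eta>})"
      using open_mapping_thm3[OF holE openQ injE] by (simp add: Q_def)
    show "E 0 \<in> X" using inX[of 0] \<eta> M(2) by simp
    show "Y = {w. \<bar>Re w\<bar> < \<eta> \<and> \<bar>Im w\<bar> < \<eta> \<and> E w \<in> X}" by (rule Y_def)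
    show "\<bar>Im y\<bar> < \<eta> / 2" if y: "y \<in> Y" for y
    proof -
      have "(norm y)\<^sup>2 \<le> (2 * \<eta>)\<^sup>2"
        using n2[OF Yfl(2)[OF y] Yfl(3)[OF y]] by (intro power_mono) auto
      then have "\<bar>c * Re y * (norm y)\<^sup>2\<bar> \<le> \<bar>c\<bar> * \<eta> * (2 * \<eta>)\<^sup>2"
        unfolding abs_mult using Yfl(2)[OF y] \<eta> by (intro mult_mono) auto
      also have "\<dots> = 4 * (\<bar>c\<bar> * \<eta>) * (\<eta> * \<eta>)" by (simp add: power2_eq_square)
      also have "\<dots> \<le> 4 * (\<bar>c\<bar> * \<eta>) * (\<eta> * 1)" using h(2) \<eta> by (intro mult_left_mono) auto
      finally have 1: "\<bar>c * Re y * (norm y)\<^sup>2\<bar> \<le> 4 * \<bar>c\<bar> * \<eta> * \<eta>" by (simp add: mult_ac)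
      have "\<bar>Re y\<bar> powr s \<le> \<eta> powr s" using Yfl[OF y] s by (intro powr_mono2) auto
      also have "\<dots> \<le> \<eta> powr 2" using h(2) \<eta> s by (intro powr_mono') auto
      also have "\<dots> = \<eta> * \<eta>" using \<eta> by (simp add: power2_eq_square)
      finally have "K * \<bar>Re y\<bar> powr s \<le> K * (\<eta> * \<eta>)" using K by (intro mult_left_mono)
      then have "\<bar>Im y\<bar> \<le> 4 * \<bar>c\<bar> * \<eta> * \<eta> + K * (\<eta> * \<eta>)" using Yfl(1)[OF y] 1 by linarith
      also have "\<dots> \<le> (4 * (\<bar>c\<bar> + K + 1) * \<eta>) * \<eta>"
        using K \<eta> by (simp add: algebra_simps mult_nonneg_nonneg add_nonneg_nonneg)
      also have "\<dots> \<le> (1 / 4) * \<eta>" 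
      proof (rule mult_right_mono)
        have "16 * (\<bar>c\<bar> + K + 1) * \<eta> = 4 * (4 * (\<bar>c\<bar> + K + 1) * \<eta>)" by simp
        then show "4 * (\<bar>c\<bar> + K + 1) * \<eta> \<le> 1 / 4" using h4 by linarith
      qed (use \<eta> in simp)
      also have "\<dots> < \<eta> / 2" using \<eta> by simp
      finally show ?thesis .
    qed
    show "y = y'" if "y \<in> Y" "y' \<in> Y" "Re y = Re y'" for y y'
      using gr[OF Yfl(4)[OF that(1)] Yfl(4)[OF that(2)] Yfl(5)[OF that(1)] Yfl(5)[OF that(2)] that(3)] .
  qed
  have c1: "\<bar>c\<bar> * \<eta> * (2 * \<eta>) < 1"
  proof -
    have "\<bar>c\<bar> * \<eta> * (2 * \<eta>) \<le> \<bar>c\<bar> * \<eta> * 1" using h(2) \<eta> by (intro mult_left_mono) auto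
    also have "\<dots> \<le> (\<bar>c\<bar> + K + 1) * \<eta>" using K \<eta> by (simp add: algebra_simps)
    also have "\<dots> < 1" using h4 \<eta> K by (simp add: algebra_simps)
    finally show ?thesis .
  qed
  have nsq: "(norm w)\<^sup>2 = (Re w)\<^sup>2 + (Im w)\<^sup>2" for w by (rule cmod_power2)
  show thesis
  proof (rule that[OF lg TM])
    fix w assume w: "\<bar>Re w\<bar> < \<eta>" "\<bar>Im w\<bar> < \<eta>" "w \<in> upper_side c K s"
    have "Im y < Im w" if y: "y \<in> Y" "Re y = Re w" for y
    proof (rule height_above_cubic_strict_mono[OF c1 w(1)])
      show "Im y - c * Re w * ((Re w)\<^sup>2 + (Im y)\<^sup>2) < Im w - c * Re w * ((Re w)\<^sup>2 + (Im w)\<^sup>2)"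
        using Yfl(1)[OF y(1)] w(3) y(2) by (simp add: upper_side_def nsq)
    qed (use Yfl[OF y(1)] w in auto)
    then show "w \<in> above \<eta> Y" using w by (auto simp: above_def)
  next
    fix w assume w: "\<bar>Re w\<bar> < \<eta>" "\<bar>Im w\<bar> < \<eta>" "w \<in> lower_side c K s"
    have "Im w < Im y" if y: "y \<in> Y" "Re y = Re w" for y
    proof (rule height_above_cubic_strict_mono[OF c1 w(1)])
      show "Im w - c * Re w * ((Re w)\<^sup>2 + (Im w)\<^sup>2) < Im y - c * Re w * ((Re w)\<^sup>2 + (Im y)\<^sup>2)"
        using Yfl(1)[OF y(1)] w(3) y(2) by (simp add: lower_side_def nsq)
    qed (use Yfl[OF y(1)] w in auto)
    then show "w \<in> below \<eta> Y" using w by (auto simp: below_def)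
  qed
qed


text \<open>
  The local statement about plane components, read in the inverse chart \<^term>\<open>M\<close> of the sphere.
\<close>

lemma component_contains_side_in_chart:
  assumes S: "smooth_curve 3 S" and M: "moebius_transformation M" "M (Some 0) \<in> S"
    and flat: "flat_at_0 (chart_set M S) c K s \<eta>0"
    and U: "U \<in> connected_components_of (subtopology Riemann_sphere (- S))"
  obtains \<eta> where "0 < \<eta>"
    "(\<forall>w. norm w < \<eta> \<longrightarrow> w \<in> upper_side c K s \<longrightarrow> M (Some w) \<in> U) \<or>
     (\<forall>w. norm w < \<eta> \<longrightarrow> w \<in> lower_side c K s \<longrightarrow> M (Some w) \<in> U)"
proof -
  obtain T X where T: "moebius_transformation T" "T ` S = Some ` X" "smooth_plane_curve 3 X"
    using S by (auto simp: smooth_curve_def)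
  have X: "X homeomorphic sphere (0::complex) 1" using T(3) by (simp add: smooth_plane_curve_def)
  obtain T' where T': "moebius_transformation T'" "\<And>x. T' (T x) = x" "\<And>x. T (T' x) = x"
    using moebius_transformation_inverse[OF T(1)] by metis
  obtain \<eta> E Y where lg: "local_graph X E \<eta> Y"
    and TM: "\<And>w. \<bar>Re w\<bar> < \<eta> \<Longrightarrow> \<bar>Im w\<bar> < \<eta> \<Longrightarrow> T (M (Some w)) = Some (E w)"
    and up: "\<And>w. \<bar>Re w\<bar> < \<eta> \<Longrightarrow> \<bar>Im w\<bar> < \<eta> \<Longrightarrow> w \<in> upper_side c K s \<Longrightarrow> w \<in> above \<eta> Y"
    and lo: "\<And>w. \<bar>Re w\<bar> < \<eta> \<Longrightarrow> \<bar>Im w\<bar> < \<eta> \<Longrightarrow> w \<in> lower_side c K s \<Longrightarrow> w \<in> below \<eta> Y"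
    using chart_local_graph[OF T(1,2) X M flat] by metis
  have SX: "S = T' ` Some ` X" unfolding T(2)[symmetric] by (simp add: image_image T'(2))
  have bX: "bounded X"
    using homeomorphic_compactness[OF X] compact_sphere compact_imp_bounded by blast
  obtain V where V: "V \<in> components (- X)" "\<And>z. z \<in> V \<Longrightarrow> T' (Some z) \<in> U"
    using sphere_component_contains_plane_component[OF T'(1) bX U[unfolded SX]] by blast
  have MU: "M (Some w) \<in> U" if "\<bar>Re w\<bar> < \<eta>" "\<bar>Im w\<bar> < \<eta>" "E w \<in> V" for w
    using V(2)[OF that(3)] TM[OF that(1,2)] T'(2) by metis
  have box: "\<bar>Re w\<bar> < \<eta>" "\<bar>Im w\<bar> < \<eta>" if "norm w < \<eta>" for w
    using that abs_Re_le_cmod[of w] abs_Im_le_cmod[of w] by linarith+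
  show thesis
  proof (rule that[of \<eta>])
    show "0 < \<eta>" using lg by (simp add: local_graph_def)
    from local_graph.component_contains_side[OF lg V(1)]
    show "(\<forall>w. norm w < \<eta> \<longrightarrow> w \<in> upper_side c K s \<longrightarrow> M (Some w) \<in> U) \<or>
      (\<forall>w. norm w < \<eta> \<longrightarrow> w \<in> lower_side c K s \<longrightarrow> M (Some w) \<in> U)"
    proof
      assume "E ` above \<eta> Y \<subseteq> V"
      then have "M (Some w) \<in> U" if "norm w < \<eta>" "w \<in> upper_side c K s" for w
        using MU[OF box[OF that(1)]] up[OF box[OF that(1)] that(2)] by blast
      then show ?thesis by blast
    next
      assume "E ` below \<eta> Y \<subseteq> V"
      then have "M (Some w) \<in> U" if "norm w < \<eta>" "w \<in> lower_side c K s" for w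
        using MU[OF box[OF that(1)]] lo[OF box[OF that(1)] that(2)] by blast
      then show ?thesis by blast
    qed
  qed
qed

text \<open>
  The point of \<^term>\<open>D\<close> that the chart \<^term>\<open>T\<close> sends to \<open>\<infinity>\<close>, if there is one, can be removed without
  disconnecting \<^term>\<open>D\<close>; the rest is a connected set in the plane that avoids the curve.
\<close>

lemma domain_on_one_side:
  assumes S: "smooth_curve 3 S" and M: "moebius_transformation M" "M (Some 0) \<in> S"
    and flat: "flat_at_0 (chart_set M S) c K s \<eta>0"
    and D: "open D" "connected D" "Some ` D \<inter> S = {}"
    and touch: "\<And>\<epsilon>. 0 < \<epsilon> \<Longrightarrow> \<exists>w. norm w < \<epsilon> \<and> w \<in> upper_side c K s \<and> M (Some w) \<in> Some ` D"
  obtains \<eta> where "0 < \<eta>" "\<And>w. norm w < \<eta> \<Longrightarrow> w \<in> lower_side c K s \<Longrightarrow> M (Some w) \<notin> Some ` D"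
proof -
  obtain T X where T: "moebius_transformation T" "T ` S = Some ` X" "smooth_plane_curve 3 X"
    using S by (auto simp: smooth_curve_def)
  have X: "X homeomorphic sphere (0::complex) 1" using T(3) by (simp add: smooth_plane_curve_def)
  obtain \<eta> E Y where lg: "local_graph X E \<eta> Y"
    and TM: "\<And>w. \<bar>Re w\<bar> < \<eta> \<Longrightarrow> \<bar>Im w\<bar> < \<eta> \<Longrightarrow> T (M (Some w)) = Some (E w)"
    and up: "\<And>w. \<bar>Re w\<bar> < \<eta> \<Longrightarrow> \<bar>Im w\<bar> < \<eta> \<Longrightarrow> w \<in> upper_side c K s \<Longrightarrow> w \<in> above \<eta> Y"
    and lo: "\<And>w. \<bar>Re w\<bar> < \<eta> \<Longrightarrow> \<bar>Im w\<bar> < \<eta> \<Longrightarrow> w \<in> lower_side c K s \<Longrightarrow> w \<in> below \<eta> Y"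
    using chart_local_graph[OF T(1,2) X M flat] by metis
  have \<eta>: "0 < \<eta>" using lg by (simp add: local_graph_def)
  have box: "\<bar>Re w\<bar> < \<eta>" "\<bar>Im w\<bar> < \<eta>" if "norm w < \<eta>" for w
    using that abs_Re_le_cmod[of w] abs_Im_le_cmod[of w] by linarith+
  obtain v zv where v: "norm v < \<eta>" "v \<in> upper_side c K s" "M (Some v) = Some zv" "zv \<in> D"
    using touch[OF \<eta>] by blast
  obtain a b c' d where abcd: "a * d - b * c' \<noteq> 0"
    "\<And>z. c' * z + d \<noteq> 0 \<Longrightarrow> T (Some z) = Some ((a * z + b) / (c' * z + d))"
    "\<And>z. c' * z + d = 0 \<Longrightarrow> T (Some z) = None"
  proof -
    have "T (Some zv) = Some (E v)" using TM[OF box[OF v(1)]] v(3) by simp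
    from moebius_transformation_finite[OF T(1) this] show thesis using that by metis
  qed
  define D' where "D' = D - {z. c' * z + d = 0}"
  have cD': "connected D'"
  proof -
    have "\<exists>z0. D' = D - {z0} \<or> D' = D"
    proof (cases "c' = 0")
      case True
      then have "d \<noteq> 0" using abcd(1) by auto
      then show ?thesis using True by (simp add: D'_def)
    next
      case False
      then have "{z. c' * z + d = 0} = {- d / c'}" by (auto simp: field_simps add_eq_0_iff)
      then show ?thesis by (auto simp: D'_def)
    qed
    then show ?thesis using connected_open_delete[OF D(1,2)] D(2) by auto
  qed
  define A where "A = (\<lambda>z. (a * z + b) / (c' * z + d)) ` D'"
  have cA: "connected A" unfolding A_def
    by (intro connected_continuous_image cD' continuous_intros) (auto simp: D'_def)
  have AX: "A \<subseteq> - X"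
  proof
    fix x assume "x \<in> A"
    then obtain z where z: "z \<in> D" "c' * z + d \<noteq> 0" "x = (a * z + b) / (c' * z + d)" by (auto simp: A_def D'_def)
    have Tz: "T (Some z) = Some x" using abcd(2)[OF z(2)] z(3) by simp
    have "Some z \<notin> S" using D(3) z(1) by blast
    then have "Some x \<notin> T ` S" using Tz moebius_transformation_eq_iff[OF T(1)] by (metis imageE)
    then show "x \<in> - X" using T(2) by auto
  qed
  have EA: "E w \<in> A" if w: "norm w < \<eta>" "M (Some w) \<in> Some ` D" for w
  proof -
    obtain z where z: "M (Some w) = Some z" "z \<in> D" using w(2) by blast
    have Tz: "T (Some z) = Some (E w)" using TM[OF box[OF w(1)]] z(1) by simp
    then have n: "c' * z + d \<noteq> 0" using abcd(3) by force
    then have "E w = (a * z + b) / (c' * z + d)" using abcd(2) Tz by simp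
    then show ?thesis using n z(2) by (auto simp: A_def D'_def)
  qed
  show thesis
  proof (rule that[OF \<eta>])
    fix w assume w: "norm w < \<eta>" "w \<in> lower_side c K s"
    have "E w \<notin> A"
    proof (rule local_graph.sides_separated[OF lg cA AX])
      show "v \<in> above \<eta> Y" by (rule up[OF box[OF v(1)] v(2)])
      show "E v \<in> A" by (rule EA[OF v(1)]) (use v in auto)
      show "w \<in> below \<eta> Y" by (rule lo[OF box[OF w(1)] w(2)])
    qed
    then show "M (Some w) \<notin> Some ` D" using EA[OF w(1)] by blast
  qed
qed

lemma flat_at_0_uminus:
  assumes "flat_at_0 X c K s \<eta>" shows "flat_at_0 (uminus -` X) c K s \<eta>"
proof -
  have "\<bar>Im z - c * Re z * (norm z)\<^sup>2\<bar> \<le> K * \<bar>Re z\<bar> powr s" if "- z \<in> X" "norm z < \<eta>" for z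
  proof -
    have "\<bar>Im (- z) - c * Re (- z) * (norm (- z))\<^sup>2\<bar> \<le> K * \<bar>Re (- z)\<bar> powr s"
      using assms that unfolding flat_at_0_def by (metis norm_minus_cancel)
    then show ?thesis by simp
  qed
  moreover have "z = z'" if "- z \<in> X" "- z' \<in> X" "norm z < \<eta>" "norm z' < \<eta>" "Re z = Re z'" for z z'
  proof -
    have "- z = - z'" using assms that unfolding flat_at_0_def
      by (metis norm_minus_cancel uminus_complex.sel(1))
    then show ?thesis by simp
  qed
  ultimately show ?thesis using assms unfolding flat_at_0_def by auto
qed

text \<open>
  In an osculating chart the component contains the upper or the lower side. The rotation
  \<open>w \<mapsto> -w\<close> exchanges them and preserves the form of the flatness condition, including the sign of \<open>c\<close>.
\<close>

lemma chart_with_inner_side_above: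
  assumes S: "smooth_curve 3 S" "P \<in> S"
    and U: "U \<in> connected_components_of (subtopology Riemann_sphere (- S))"
  obtains M c K s \<eta>0 \<eta> where "moebius_transformation M" "M (Some 0) = P" "flat_at_0 (chart_set M S) c K s \<eta>0"
    "0 < \<eta>" "\<And>w. norm w < \<eta> \<Longrightarrow> w \<in> upper_side c K s \<Longrightarrow> M (Some w) \<in> U"
proof -
  obtain M s w a3 where M: "moebius_transformation M" "M (Some 0) = P" and s: "3 < s" "s < 4"
    and arc: "local_arc s (chart_set M S) w 0 1 0 a3" using osculating_chart[OF S] by metis
  obtain c K \<eta>0 where flat: "flat_at_0 (chart_set M S) c K s \<eta>0"
  proof (rule local_arc_flat[OF arc s(1)])
    fix c K \<eta> assume "0 < \<eta>" "0 \<le> K"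
      "\<And>z. z \<in> chart_set M S \<Longrightarrow> norm z < \<eta> \<Longrightarrow> \<bar>Im z - c * Re z * (norm z)\<^sup>2\<bar> \<le> K * \<bar>Re z\<bar> powr s"
      "\<And>z z'. z \<in> chart_set M S \<Longrightarrow> z' \<in> chart_set M S \<Longrightarrow> norm z < \<eta> \<Longrightarrow> norm z' < \<eta> \<Longrightarrow> Re z = Re z' \<Longrightarrow> z = z'"
    then show thesis using that[of c K \<eta>] s unfolding flat_at_0_def by blast
  qed (use s in auto)
  have M0: "M (Some 0) \<in> S" using M S by simp
  obtain \<eta> where \<eta>: "0 < \<eta>"
    "(\<forall>w. norm w < \<eta> \<longrightarrow> w \<in> upper_side c K s \<longrightarrow> M (Some w) \<in> U) \<or>
     (\<forall>w. norm w < \<eta> \<longrightarrow> w \<in> lower_side c K s \<longrightarrow> M (Some w) \<in> U)"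
    using component_contains_side_in_chart[OF S(1) M(1) M0 flat U] by metis
  from \<eta>(2) show thesis
  proof
    assume "\<forall>w. norm w < \<eta> \<longrightarrow> w \<in> upper_side c K s \<longrightarrow> M (Some w) \<in> U"
    then show thesis using that[OF M flat \<eta>(1)] by blast
  next
    assume lower: "\<forall>w. norm w < \<eta> \<longrightarrow> w \<in> lower_side c K s \<longrightarrow> M (Some w) \<in> U"
    define neg where "neg = moebius_ext (- 1) 0 0 1"
    have neg: "moebius_transformation neg" unfolding neg_def moebius_transformation_def
      by (intro exI[of _ "- 1"] exI[of _ 0] exI[of _ 0] exI[of _ 1]) auto
    have negS: "neg (Some w) = Some (- w)" for w by (simp add: neg_def moebius_ext_def moebius_def)
    have "chart_set (\<lambda>x. M (neg x)) S = uminus -` chart_set M S" by (auto simp: negS)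
    then have fl: "flat_at_0 (chart_set (\<lambda>x. M (neg x)) S) c K s \<eta>0" using flat_at_0_uminus[OF flat] by simp
    show thesis
    proof (rule that[OF moebius_transformation_compose[OF M(1) neg] _ fl \<eta>(1)])
      show "M (neg (Some 0)) = P" using M by (simp add: negS)
      fix w assume "norm w < \<eta>" "w \<in> upper_side c K s"
      then have "norm (- w) < \<eta>" "- w \<in> lower_side c K s" by (auto simp: upper_side_def lower_side_def)
      then show "M (neg (Some w)) \<in> U" unfolding negS using lower by blast
    qed
  qed
qed

section \<open>Domains with a common flat boundary point\<close>

theorem theorem6p2:
  fixes \<Omega> :: "real \<Rightarrow> complex set" and p :: ecomplex and C :: "ecomplex set"
  assumes "\<exists>d. L_admissible d \<Omega>"
    and "p \<in> Riemann_sphere frontier_of (Some ` \<Omega> 0)"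
    and "smooth_curve 3 C" and "p \<in> C"
    and "\<exists>U \<in> connected_components_of (subtopology Riemann_sphere (- C)). U \<subseteq> Some ` \<Omega> 0"
    and "\<forall>t>0. \<exists>C\<^sub>t. smooth_curve 3 C\<^sub>t \<and> p \<in> C\<^sub>t \<and> contact 2 C C\<^sub>t p \<and> Some ` \<Omega> t \<inter> C\<^sub>t = {}"
  shows "\<exists>F :: real \<Rightarrow> complex \<Rightarrow> complex. \<forall>t\<ge>0.
           univalent_on (F t) (ball 0 1) \<and> F t ` ball 0 1 = \<Omega> t \<and>
           inv_into (ball 0 1) (F t) \<circ> F 0 \<in> class_C_tilde"
proof -
  have dom: "simply_connected_domain (\<Omega> t)" if "0 \<le> t" for t
    using assms(1) that by (auto simp: L_admissible_def)
  have mono: "\<Omega> s \<subseteq> \<Omega> t" if "0 \<le> s" "s \<le> t" for s t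
    using assms(1) that unfolding L_admissible_def by blast
  have proper: "\<Omega> t \<noteq> UNIV" if "0 \<le> t" for t
    using assms(1) that unfolding L_admissible_def by blast
  obtain U where U: "U \<in> connected_components_of (subtopology Riemann_sphere (- C))" "U \<subseteq> Some ` \<Omega> 0"
    using assms(5) by blast
  obtain M c K s \<eta>0 \<eta> where M: "moebius_transformation M" "M (Some 0) = p"
    and flat: "flat_at_0 (chart_set M C) c K s \<eta>0" and \<eta>: "0 < \<eta>"
    and inner: "\<And>w. norm w < \<eta> \<Longrightarrow> w \<in> upper_side c K s \<Longrightarrow> M (Some w) \<in> U"
    using chart_with_inner_side_above[OF assms(3,4) U(1)] by metis
  \<comment> \<open>from here on the coordinate \<open>z = -1 / w\<close>, in which \<open>p\<close> is the point at infinity\<close>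
  define \<iota> where "\<iota> = moebius_ext 0 (- 1) 1 0"
  have \<iota>: "moebius_transformation \<iota>" unfolding \<iota>_def moebius_transformation_def
    by (intro exI[of _ 0] exI[of _ "- 1"] exI[of _ 1] exI[of _ 0]) auto
  have \<iota>z: "\<iota> (Some z) = Some (- 1 / z)" if "z \<noteq> 0" for z
    using that by (simp add: \<iota>_def moebius_ext_def moebius_def)
  have \<iota>N: "\<iota> None = Some 0" by (simp add: \<iota>_def moebius_ext_def)
  define N where "N = (\<lambda>x. M (\<iota> x))"
  have N: "moebius_transformation N" unfolding N_def by (rule moebius_transformation_compose[OF M(1) \<iota>])
  have NN: "N None = p" using M \<iota>N by (simp add: N_def)
  have Nz: "N (Some z) = M (Some (- 1 / z))" if "z \<noteq> 0" for z using \<iota>z[OF that] by (simp add: N_def)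
  obtain N' where N': "moebius_transformation N'" "\<And>x. N' (N x) = x" "\<And>x. N (N' x) = x"
    using moebius_transformation_inverse[OF N] by metis
  have side: "Re (- 1 / z) = - Re (1 / z)" "Im (- 1 / z) = Im z / (norm z)\<^sup>2" "norm (- 1 / z) = 1 / norm z" for z
    by (simp_all add: Im_divide cmod_power2 norm_divide)
  have K: "0 \<le> K" and \<beta>: "1 < s - 2" "s - 2 < 2" using flat by (auto simp: flat_at_0_def)
  obtain h C1 where holh: "h holomorphic_on upper_half_plane"
    and hlarge: "\<And>z. 0 < Im z \<Longrightarrow> 1 / \<eta> < norm (h z)"
    and habove: "\<And>z. 0 < Im z \<Longrightarrow> - c * Re (1 / h z) + K * norm (h z) powr (- (s - 2)) < Im (h z)"
    and hasym: "\<And>z. 0 < Im z \<Longrightarrow> norm (h z - z) \<le> C1 / Im z"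
    using inner_model_map[OF \<beta> K] by metis
  have hnz: "0 < norm (h z)" if "0 < Im z" for z using hlarge[OF that] \<eta> by (meson less_trans zero_less_divide_1_iff)
  have hU: "N (Some (h z)) \<in> U" if z: "0 < Im z" for z
  proof -
    define w where "w = - 1 / h z"
    have h0: "h z \<noteq> 0" using hnz[OF z] by auto
    have "norm w < \<eta>" using hlarge[OF z] hnz[OF z] \<eta> unfolding w_def side by (simp add: field_simps)
    moreover have "w \<in> upper_side c K s"
    proof -
      define n where "n = norm (h z)"
      have n: "0 < n" using hnz[OF z] by (simp add: n_def)
      have "\<bar>Re w\<bar> powr s \<le> (1 / n) powr s"
        using abs_Re_le_cmod[of w] flat unfolding w_def side(3) n_def
        by (intro powr_mono2) (auto simp: flat_at_0_def)
      then have "K * \<bar>Re w\<bar> powr s \<le> K * (1 / n) powr s" using K by (rule mult_left_mono)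
      also have "(1 / n) powr s = n powr (- (s - 2)) / n\<^sup>2"
        using n by (simp add: powr_divide powr_diff powr_minus field_simps)
      finally have "K * \<bar>Re w\<bar> powr s \<le> K * n powr (- (s - 2)) / n\<^sup>2" by simp
      moreover have "(- c * Re (1 / h z) + K * n powr (- (s - 2))) / n\<^sup>2 < Im (h z) / n\<^sup>2"
        using habove[OF z] n unfolding n_def by (intro divide_strict_right_mono) auto
      moreover have "c * Re w * (norm w)\<^sup>2 = - c * Re (1 / h z) / n\<^sup>2"
        unfolding w_def side n_def by (simp add: power_divide)
      moreover have "Im w = Im (h z) / n\<^sup>2" unfolding w_def side n_def ..
      ultimately show ?thesis unfolding upper_side_def by (simp add: add_divide_distrib diff_divide_distrib)
    qed
    ultimately have "M (Some w) \<in> U" by (rule inner)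
    then show ?thesis using Nz[OF h0] by (simp add: w_def)
  qed
  obtain a b c' d where N1: "a * d - b * c' \<noteq> 0"
    "\<And>z. c' * z + d \<noteq> 0 \<Longrightarrow> N (Some z) = Some ((a * z + b) / (c' * z + d))"
    "\<And>z. c' * z + d = 0 \<Longrightarrow> N (Some z) = None"
  proof -
    have "N (Some (h \<i>)) \<in> Some ` \<Omega> 0" using hU[of \<i>] U(2) by auto
    then obtain r where "N (Some (h \<i>)) = Some r" by blast
    from moebius_transformation_finite[OF N this] show thesis using that by metis
  qed
  define f where "f = (\<lambda>z. (a * h z + b) / (c' * h z + d))"
  have hfin: "c' * h z + d \<noteq> 0" if "0 < Im z" for z using hU[OF that] U(2) N1(3) by force
  have Nh: "N (Some (h z)) = Some (f z)" if "0 < Im z" for z using N1(2)[OF hfin[OF that]] by (simp add: f_def)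
  have holf: "f holomorphic_on upper_half_plane" unfolding f_def
    by (intro holomorphic_intros holh) (use hfin in auto)
  have mapf: "f z \<in> \<Omega> 0" if "0 < Im z" for z using hU[OF that] U(2) Nh[OF that] by auto
  have outer: "\<exists>G. G holomorphic_on \<Omega> t \<and> (\<forall>z\<in>\<Omega> t. 0 < Im (G z)) \<and>
      (\<exists>B Y. \<forall>y\<ge>Y. norm (G (f (\<i> * of_real y)) - \<i> * of_real y) \<le> B / y)" if t: "0 < t" for t
  proof -
    obtain S where S: "smooth_curve 3 S" "p \<in> S" "contact 2 C S p" "Some ` \<Omega> t \<inter> S = {}"
      using assms(6) t by blast
    obtain s' w a1 a2 a3 where s': "3 < s'" "s' < 4" and arc: "local_arc s' (chart_set M S) w 0 a1 a2 a3"
      using smooth_curve_arc_in_chart[OF S(1,2) M] by metis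
    have close: "second_order_close (chart_set M C) (chart_set M S) 0"
      by (rule contact_second_order_close[OF S(3) M])
    have real: "Im a1 = 0" "Im a2 = 0"
      using second_order_close_imp_real_2_jet[of "chart_set M C" \<eta>0 c K s, OF _ _ _ _ arc s'(1) close] flat
      unfolding flat_at_0_def by blast+
    obtain c1 K1 \<eta>1 where flat1: "flat_at_0 (chart_set M S) c1 K1 s' \<eta>1"
    proof (rule local_arc_flat[OF arc s'(1) _ real])
      fix c K \<eta> assume "0 < \<eta>" "0 \<le> K"
        "\<And>z. z \<in> chart_set M S \<Longrightarrow> norm z < \<eta> \<Longrightarrow> \<bar>Im z - c * Re z * (norm z)\<^sup>2\<bar> \<le> K * \<bar>Re z\<bar> powr s'"
        "\<And>z z'. z \<in> chart_set M S \<Longrightarrow> z' \<in> chart_set M S \<Longrightarrow> norm z < \<eta> \<Longrightarrow> norm z' < \<eta> \<Longrightarrow> Re z = Re z' \<Longrightarrow> z = z'"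
      then show thesis using that[of c K \<eta>] s' unfolding flat_at_0_def by blast
    qed (use s' in auto)
    have K1: "0 \<le> K1" and \<beta>1: "1 < s' - 2" "s' - 2 < 2" using flat1 s' by (auto simp: flat_at_0_def)
    have M0: "M (Some 0) \<in> S" using M(2) S(2) by simp
    have D: "open (\<Omega> t)" "connected (\<Omega> t)"
      using dom[of t] t simply_connected_imp_connected by (auto simp: simply_connected_domain_def)
    have sub: "\<Omega> 0 \<subseteq> \<Omega> t" using mono t by simp
    obtain \<eta>2 where \<eta>2: "0 < \<eta>2" "\<And>w. norm w < \<eta>2 \<Longrightarrow> w \<in> lower_side c1 K1 s' \<Longrightarrow> M (Some w) \<notin> Some ` \<Omega> t"
    proof (rule domain_on_one_side[OF S(1) M(1) M0 flat1 D S(4)])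
      fix \<epsilon> :: real assume \<epsilon>: "0 < \<epsilon>"
      define w where "w = \<i> * complex_of_real (min \<epsilon> \<eta> / 2)"
      have w: "Re w = 0" "0 < Im w" "norm w < \<epsilon>" "norm w < \<eta>" using \<epsilon> \<eta> by (auto simp: w_def norm_mult)
      then have "M (Some w) \<in> U" by (intro inner) (auto simp: upper_side_def)
      then have "M (Some w) \<in> Some ` \<Omega> t" using U(2) sub by blast
      moreover have "w \<in> upper_side c1 K1 s'" using w by (simp add: upper_side_def)
      ultimately show "\<exists>w. norm w < \<epsilon> \<and> w \<in> upper_side c1 K1 s' \<and> M (Some w) \<in> Some ` \<Omega> t" using w(3) by blast
    qed (rule that)
    define Z where "Z = {z. 1 / \<eta>2 < norm z \<longrightarrow> - c1 * Re (1 / z) - K1 * norm z powr (- (s' - 2)) \<le> Im z}"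
    obtain g C2 where holg: "g holomorphic_on Z" and mapg: "\<And>z. z \<in> Z \<Longrightarrow> 0 < Im (g z)"
      and gasym: "\<And>z. 0 < Im z \<Longrightarrow> norm (g z - z) \<le> C2 / Im z"
    proof (rule outer_model_map[OF \<beta>1 K1, of "1 / \<eta>2" c1])
      fix g C2
      assume "g holomorphic_on {z. 1 / \<eta>2 < norm z \<longrightarrow> - c1 * Re (1 / z) - K1 * norm z powr (- (s' - 2)) \<le> Im z}"
        and pos: "\<And>z. (1 / \<eta>2 < norm z \<Longrightarrow> - c1 * Re (1 / z) - K1 * norm z powr (- (s' - 2)) \<le> Im z) \<Longrightarrow> 0 < Im (g z)"
        and "\<And>z. 0 < Im z \<Longrightarrow> norm (g z - z) \<le> C2 / Im z"
      moreover have "0 < Im (g z)" if "z \<in> Z" for z by (rule pos) (use that in \<open>simp add: Z_def\<close>)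
      ultimately show thesis using that[of g C2] by (simp add: Z_def)
    qed
    have inZ: "z \<in> Z" if z: "N (Some z) \<in> Some ` \<Omega> t" for z
      unfolding Z_def
    proof (intro CollectI impI)
      assume large: "1 / \<eta>2 < norm z"
      define n where "n = norm z"
      have n: "0 < n" using large \<eta>2(1) unfolding n_def by (meson less_trans zero_less_divide_1_iff)
      have z0: "z \<noteq> 0" using n by (auto simp: n_def)
      define w where "w = - 1 / z"
      have "norm w < \<eta>2" using large n \<eta>2(1) unfolding w_def side n_def by (simp add: field_simps)
      moreover have "M (Some w) \<in> Some ` \<Omega> t" using z Nz[OF z0] by (simp add: w_def)
      ultimately have "w \<notin> lower_side c1 K1 s'" using \<eta>2(2) by blast
      then have low: "c1 * Re w * (norm w)\<^sup>2 - K1 * \<bar>Re w\<bar> powr s' \<le> Im w" by (simp add: lower_side_def)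
      have "\<bar>Re w\<bar> powr s' \<le> (1 / n) powr s'"
        using abs_Re_le_cmod[of w] s' unfolding w_def side(3) n_def by (intro powr_mono2) auto
      then have "K1 * \<bar>Re w\<bar> powr s' \<le> K1 * (1 / n) powr s'" using K1 by (rule mult_left_mono)
      also have "(1 / n) powr s' = n powr (- (s' - 2)) / n\<^sup>2"
        using n by (simp add: powr_divide powr_diff powr_minus field_simps)
      finally have "K1 * \<bar>Re w\<bar> powr s' \<le> K1 * n powr (- (s' - 2)) / n\<^sup>2" by simp
      moreover have "c1 * Re w * (norm w)\<^sup>2 = - c1 * Re (1 / z) / n\<^sup>2"
        unfolding w_def side n_def by (simp add: power_divide)
      moreover have "Im w = Im z / n\<^sup>2" unfolding w_def side n_def ..
      ultimately have "- c1 * Re (1 / z) / n\<^sup>2 - K1 * n powr (- (s' - 2)) / n\<^sup>2 \<le> Im z / n\<^sup>2" using low by linarith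
      then have "(- c1 * Re (1 / z) - K1 * n powr (- (s' - 2))) / n\<^sup>2 \<le> Im z / n\<^sup>2" by (simp add: diff_divide_distrib)
      then show "- c1 * Re (1 / z) - K1 * norm z powr (- (s' - 2)) \<le> Im z"
        using n by (simp add: divide_le_cancel n_def)
    qed
    have ft: "f (\<i> * of_real 1) \<in> \<Omega> t" using mapf[of "\<i> * of_real 1"] sub by auto
    have N'f: "N' (Some (f z)) = Some (h z)" if "0 < Im z" for z using Nh[OF that] N'(2) by metis
    obtain a' b' c'' d' where N2: "\<And>z. c'' * z + d' \<noteq> 0 \<Longrightarrow> N' (Some z) = Some ((a' * z + b') / (c'' * z + d'))"
      "\<And>z. c'' * z + d' = 0 \<Longrightarrow> N' (Some z) = None"
      using moebius_transformation_finite[OF N'(1) N'f[of \<i>]] by (metis imaginary_unit.sel(2) zero_less_one)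
    define k where "k = (\<lambda>z. (a' * z + b') / (c'' * z + d'))"
    \<comment> \<open>the only point with infinite coordinate is \<open>p\<close>, which lies on \<open>C\<^sub>t\<close>\<close>
    have fin: "c'' * z + d' \<noteq> 0" if z: "z \<in> \<Omega> t" for z
    proof
      assume "c'' * z + d' = 0"
      then have "Some z = N None" using N2(2)[of z] N'(3)[of "Some z"] by simp
      then have "Some z \<in> S" using NN S(2) by simp
      moreover have "Some z \<in> Some ` \<Omega> t" using z by simp
      ultimately show False using S(4) by (metis IntI empty_iff)
    qed
    have N'k: "N' (Some z) = Some (k z)" if "z \<in> \<Omega> t" for z using N2(1)[OF fin[OF that]] by (simp add: k_def)
    have kZ: "k z \<in> Z" if z: "z \<in> \<Omega> t" for z
      by (rule inZ) (use N'k[OF z] N'(3)[of "Some z"] z in simp)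
    have holk: "k holomorphic_on \<Omega> t" unfolding k_def by (intro holomorphic_intros) (use fin in auto)
    have kf: "k (f z) = h z" if z: "0 < Im z" for z
      using N'k[of "f z"] N'f[OF z] mapf[OF z] sub by auto
    show ?thesis
    proof (intro exI[of _ "\<lambda>z. g (k z)"] conjI ballI)
      show "(\<lambda>z. g (k z)) holomorphic_on \<Omega> t" by (rule holomorphic_on_compose_into[OF holk holg kZ])
      show "0 < Im (g (k z))" if "z \<in> \<Omega> t" for z by (rule mapg[OF kZ[OF that]])
      show "\<exists>B Y. \<forall>y\<ge>Y. norm (g (k (f (\<i> * of_real y))) - \<i> * of_real y) \<le> B / y"
      proof (rule exI[of _ "2 * \<bar>C2\<bar> + \<bar>C1\<bar>"], rule exI[of _ "1 + 2 * \<bar>C1\<bar>"], intro allI impI)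
        fix y :: real assume y: "1 + 2 * \<bar>C1\<bar> \<le> y"
        define z where "z = \<i> * complex_of_real y"
        have z: "Im z = y" "0 < Im z" "1 \<le> y" using y by (auto simp: z_def)
        have C1: "norm (h z - z) \<le> \<bar>C1\<bar> / y"
          using hasym[OF z(2)] z by (meson abs_ge_self divide_right_mono order_trans less_imp_le)
        have "\<bar>C1\<bar> / y \<le> \<bar>C1\<bar> / 1" using z by (intro divide_left_mono) auto
        then have "norm (h z - z) \<le> y / 2" using C1 y by simp
        then have hy: "y / 2 \<le> Im (h z)" using abs_Im_le_cmod[of "h z - z"] z(1) by simp
        then have hp: "0 < Im (h z)" using z by linarith
        have "norm (g (h z) - h z) \<le> C2 / Im (h z)" by (rule gasym[OF hp])
        also have "\<dots> \<le> \<bar>C2\<bar> / (y / 2)" using hy z by (intro frac_le) auto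
        finally have C2: "norm (g (h z) - h z) \<le> 2 * \<bar>C2\<bar> / y" by (simp add: mult.commute)
        have "norm (g (h z) - z) \<le> norm (g (h z) - h z) + norm (h z - z)"
          using norm_triangle_ineq[of "g (h z) - h z" "h z - z"] by simp
        also have "\<dots> \<le> (2 * \<bar>C2\<bar> + \<bar>C1\<bar>) / y" using C1 C2 by (simp add: add_divide_distrib)
        finally have "norm (g (k (f z)) - z) \<le> (2 * \<bar>C2\<bar> + \<bar>C1\<bar>) / y" using kf[OF z(2)] by simp
        then show "norm (g (k (f (\<i> * of_real y))) - \<i> * of_real y) \<le> (2 * \<bar>C2\<bar> + \<bar>C1\<bar>) / y"
          by (simp add: z_def)
      qed
    qed
  qed
  then obtain G where G: "\<And>t. 0 < t \<Longrightarrow> G t holomorphic_on \<Omega> t \<and> (\<forall>z\<in>\<Omega> t. 0 < Im (G t z)) \<and>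
      (\<exists>B Y. \<forall>y\<ge>Y. norm (G t (f (\<i> * of_real y)) - \<i> * of_real y) \<le> B / y)"
    by metis
  show ?thesis
    by (rule conjugates_in_class_C_tilde[of \<Omega> f G]) (use dom mono proper holf mapf G in auto)
qed

end
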